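(* Consider the decentralized finite-sum variational inequality of the context, where each $F_m$ is $L$-Lipschitz and $\mu$-strongly monotone ($\mu>0$) and for each $m$ the collection $\{F_{m,i}\}_{i=1}^n$ is $\overline L$-average Lipschitz, over a fixed connected network with gossip matrix $\mathbf W$ and characteristic number $\chi$. Let $\{\mathbf z^k\}$ be the sequence generated by Algorithm 1 (described in the context) with batch size $b\in\{1,\dots,n\}$, probability $p\in(0,1)$ and parameters satisfying $$\gamma=p\le\tfrac18,\quad \eta=\min\Big\{\tfrac{\sqrt{\gamma b}}{4\overline L},\tfrac1{16L\sqrt\chi}\Big\},\quad \beta=\min\Big\{\tfrac{\mu}{4L^2},\tfrac{b\gamma}{4\eta\overline L^2}\Big\},\quad \theta=\min\Big\{\tfrac1{2\beta},\tfrac1{16\eta}\Big\},$$ $$\alpha=\max\Big\{1-\tfrac{\mu\eta}4,\ 1-\beta\theta\chi^{-1},\ 1-\tfrac{p\eta\mu}{2\gamma+\eta\mu}\Big\}.$$ Then, given $\varepsilon>0$, the number of iterations sufficient for $\mathbb E[\|\mathbf z^k-\mathbf z^*\|^2]\le\varepsilon$ is $$\mathcal O\left(\left[\frac1p+\chi+\frac1{\sqrt{pb}}\frac{\overline L}{\mu}+\sqrt\chi\,\frac L\mu\right]\log\frac1\varepsilon\right).$$ That is, there are an absolute constant $C>0$ and a constant $C_0>0$ depending on the problem, the parameters and the initial point but not on $\varepsilon$ or $k$, such that $\mathbb E[\|\mathbf z^k-\mathbf z^*\|^2]\le\varepsilon$ for every integer $k\ge0$ with $k\ge C\big[\frac1p+\chi+\frac1{\sqrt{pb}}\frac{\overline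 L}{\mu}+\sqrt\chi\frac L\mu\big]\log\frac{C_0}\varepsilon$.
   Context: **Problem.** $F_m=\frac1n\sum_{i=1}^nF_{m,i}$ with $F_{m,i}:\mathbb R^d\to\mathbb R^d$, $m=1,\dots,M$, and $g:\mathbb R^d\to\mathbb R\cup\{+\infty\}$ is proper, lower semicontinuous and convex. Find $z^*\in\mathbb R^d$ with $\langle\sum_mF_m(z^* ),z-z^*\rangle+g(z)-g(z^* )\ge0$ for all $z\in\mathbb R^d$. Lifted form: for $\mathbf z=(z_1,\dots,z_M)\in(\mathbb R^d)^M$ (Euclidean norm) put $\mathbf F(\mathbf z)=(F_1(z_1),\dots,F_M(z_M))$, $\mathbf g(\mathbf z)=\frac1M\sum_mg(z_m)$, $\mathcal L=\{\mathbf z: z_1=\dots=z_M\}$; find $\mathbf z^*\in\mathcal L$ with $\langle\mathbf F(\mathbf z^* ),\mathbf z-\mathbf z^*\rangle+\mathbf g(\mathbf z)-\mathbf g(\mathbf z^* )\ge0$ for all $\mathbf z\in\mathcal L$; thus $\mathbf z^*=(z^*,\dots,z^* )$. **Regularity.** $L$-Lipschitz: $\|F_m(u)-F_m(v)\|\le L\|u-v\|$. $\overline L$-average Lipschitz: $\frac1n\sum_{i}\|F_{m,i}(u)-F_{m,i}(v)\|^2\le\overline L^2\|u-v\|^2$. $\mu$-strongly monotone: $\langle F_m(u)-F_m(v),u-v\rangle\ge\mu\|u-v\|^2$. All hold for all $u,v\in\mathbb R^d$. **Network.** $\mathcal G=(\{1,\dots,M\},\mathcal E)$ is an undirected connected graph;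 the gossip matrix $\mathbf W\in\mathbb R^{M\times M}$ is symmetric positive semidefinite, $\ker\mathbf W$ is the span of the all-ones vector (so $\ker(\mathbf W\otimes\mathbf I_d)=\mathcal L$), $w_{i,j}\ne0$ iff $i=j$ or $(i,j)\in\mathcal E$, and $\lambda_{\max}(\mathbf W)=1$. $\chi=1/\lambda^+_{\min}(\mathbf W)$, with $\lambda^+_{\min}$ the smallest positive eigenvalue. **Algorithm 1.** Parameters: stepsizes $\eta,\theta>0$, momentums $\alpha,\beta,\gamma$, batch size $b$, probability $p$. Initialization: $\mathbf z^0=\mathbf w^0\in(\mathrm{dom}\,g)^M$, $\mathbf y^0\in\mathcal L^\perp$, $\mathbf z^{-1}=\mathbf z^0$, $\mathbf w^{-1}=\mathbf w^0$, $\mathbf y^{-1}=\mathbf y^0$. For $k=0,1,2,\dots$: each worker $m$ samples indices $j^k_{m,1},\dots,j^k_{m,b}$ and $j^{k+1/2}_{m,1},\dots,j^{k+1/2}_{m,b}$, all independent and uniform on $\{1,\dots,n\}$ (independent of the past and across workers). For $l=1,\dots,b$ let $\mathbf F_l^{k}(\mathbf z)=(F_{1,j^k_{1,l}}(z_1),\dots,F_{M,j^k_{M,l}}(z_M))$ and define $\mathbf F_l^{k+1/2}$ analogously. Then - $\delta^k=\frac1b\sum_{l=1}^b\big(\mathbf F^k_l(\mathbf z^k)-\mathbf F^k_l(\mathbf w^{k-1})+\alpha[\mathbf F^k_l(\mathbf z^k)-\mathbf F^k_l(\mathbf z^{k-1})]\big)+\mathbf F(\mathbf w^{k-1})$; -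 $\Delta^k=\delta^k-(\mathbf y^k+\alpha(\mathbf y^k-\mathbf y^{k-1}))$; - $\mathbf z^{k+1}=\mathrm{prox}_{\eta\mathbf g}(\mathbf z^k+\gamma(\mathbf w^k-\mathbf z^k)-\eta\Delta^k)$, where $\mathrm{prox}_{\eta\mathbf g}(\mathbf v)=\arg\min_{\mathbf u}\{\eta\mathbf g(\mathbf u)+\frac12\|\mathbf u-\mathbf v\|^2\}$; - $\Delta^{k+1/2}=\frac1b\sum_{l=1}^b\big(\mathbf F^{k+1/2}_l(\mathbf z^{k+1})-\mathbf F^{k+1/2}_l(\mathbf w^k)\big)+\mathbf F(\mathbf w^k)$; - $\mathbf y^{k+1}=\mathbf y^k-\theta(\mathbf W\otimes\mathbf I_d)(\mathbf z^{k+1}-\beta(\Delta^{k+1/2}-\mathbf y^k))$; - $\mathbf w^{k+1}=\mathbf z^k$ with probability $p$ and $\mathbf w^{k+1}=\mathbf w^k$ with probability $1-p$ (independent of everything else). *)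

theory Defs
  imports
    "HOL-Probability.Probability"
    "HOL-Library.Function_Algebras"
    "HOL-Library.Monad_Syntax"
    "Jordan_Normal_Form.Char_Poly"
    "Jordan_Normal_Form.Matrix_Kernel"
begin

(* The dimension d and the number of workers M are natural numbers, so that a single constant can
   be asserted to work for all of them.  Vectors in R^d are the points of the library space
   Euclidean_space d, i.e. functions nat => real that vanish from index d on.  Workers, samples
   and coordinates are numbered from 0. *)

type_synonym rvec = "nat \<Rightarrow> real"
type_synonym lvec = "nat \<Rightarrow> rvec"

instantiation "fun" :: (type, real_vector) real_vector
begin

definition scaleR_fun :: "real \<Rightarrow> ('a \<Rightarrow> 'b) \<Rightarrow> 'a \<Rightarrow> 'b" where
  "scaleR_fun c f = (\<lambda>x. c *\<^sub>R f x)"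

instance
  by standard (simp_all add: scaleR_fun_def fun_eq_iff algebra_simps)

end

definition Rn :: "nat \<Rightarrow> rvec set" where
  "Rn d = topspace (Euclidean_space d)"

definition rdot :: "nat \<Rightarrow> rvec \<Rightarrow> rvec \<Rightarrow> real" where
  "rdot d x y = (\<Sum>i<d. x i * y i)"

definition rnorm :: "nat \<Rightarrow> rvec \<Rightarrow> real" where
  "rnorm d x = L2_set x {..<d}"

text \<open>The space of \<open>M\<close>-tuples of vectors in dimension \<open>d\<close>; entries beyond the last worker are
  \<open>0\<close>, so that tuples are equal as soon as their first \<open>M\<close> entries are.\<close>

definition Lifted :: "nat \<Rightarrow> nat \<Rightarrow> lvec set" where
  "Lifted d M = {z. (\<forall>m<M. z m \<in> Rn d) \<and> (\<forall>m\<ge>M. z m = 0)}"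

definition ldot :: "nat \<Rightarrow> nat \<Rightarrow> lvec \<Rightarrow> lvec \<Rightarrow> real" where
  "ldot d M z w = (\<Sum>m<M. rdot d (z m) (w m))"

definition lnorm :: "nat \<Rightarrow> nat \<Rightarrow> lvec \<Rightarrow> real" where
  "lnorm d M z = L2_set (\<lambda>m. rnorm d (z m)) {..<M}"

definition lift :: "nat \<Rightarrow> rvec \<Rightarrow> lvec" where
  "lift M x = (\<lambda>m. if m < M then x else 0)"

definition consensus :: "nat \<Rightarrow> nat \<Rightarrow> lvec set" where
  "consensus d M = lift M ` Rn d"

definition consensus_perp :: "nat \<Rightarrow> nat \<Rightarrow> lvec set" where
  "consensus_perp d M = {y \<in> Lifted d M. \<forall>z\<in>consensus d M. ldot d M y z = 0}"

text \<open>\<open>F m i\<close> is the operator of sample \<open>i\<close> at worker \<open>m\<close>.\<close>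

definition operators_on :: "nat \<Rightarrow> nat \<Rightarrow> nat \<Rightarrow> (nat \<Rightarrow> nat \<Rightarrow> rvec \<Rightarrow> rvec) \<Rightarrow> bool" where
  "operators_on d M n F \<longleftrightarrow> (\<forall>m<M. \<forall>i<n. F m i \<in> Rn d \<rightarrow> Rn d)"

definition mean_op :: "nat \<Rightarrow> (nat \<Rightarrow> rvec \<Rightarrow> rvec) \<Rightarrow> rvec \<Rightarrow> rvec" where
  "mean_op n f x = (1 / real n) *\<^sub>R (\<Sum>i<n. f i x)"

definition Lipschitz :: "nat \<Rightarrow> real \<Rightarrow> (rvec \<Rightarrow> rvec) \<Rightarrow> bool" where
  "Lipschitz d L f \<longleftrightarrow>
     0 \<le> L \<and> (\<forall>u\<in>Rn d. \<forall>v\<in>Rn d. rnorm d (f u - f v) \<le> L * rnorm d (u - v))"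

definition average_Lipschitz :: "nat \<Rightarrow> nat \<Rightarrow> real \<Rightarrow> (nat \<Rightarrow> rvec \<Rightarrow> rvec) \<Rightarrow> bool" where
  "average_Lipschitz d n L f \<longleftrightarrow>
     0 \<le> L \<and> (\<forall>u\<in>Rn d. \<forall>v\<in>Rn d.
       (1 / real n) * (\<Sum>i<n. (rnorm d (f i u - f i v))\<^sup>2) \<le> L\<^sup>2 * (rnorm d (u - v))\<^sup>2)"

definition strongly_monotone :: "nat \<Rightarrow> real \<Rightarrow> (rvec \<Rightarrow> rvec) \<Rightarrow> bool" where
  "strongly_monotone d \<mu> f \<longleftrightarrow>
     (\<forall>u\<in>Rn d. \<forall>v\<in>Rn d. rdot d (f u - f v) (u - v) \<ge> \<mu> * (rnorm d (u - v))\<^sup>2)"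

definition proper_lsc_convex :: "nat \<Rightarrow> (rvec \<Rightarrow> ereal) \<Rightarrow> bool" where
  "proper_lsc_convex d g \<longleftrightarrow>
     (\<forall>x\<in>Rn d. g x \<noteq> -\<infinity>) \<and> (\<exists>x\<in>Rn d. g x \<noteq> \<infinity>) \<and>
     (\<forall>x\<in>Rn d. g x \<le> Liminf (atin (Euclidean_space d) x) g) \<and>
     (\<forall>x\<in>Rn d. \<forall>y\<in>Rn d. \<forall>t\<in>{0..1}.
        g ((1 - t) *\<^sub>R x + t *\<^sub>R y) \<le> ereal (1 - t) * g x + ereal t * g y)"

text \<open>Since \<open>\<infinity> - \<infinity> = \<infinity>\<close> in type \<open>ereal\<close>, the finiteness of \<open>g zs\<close>, which is implicit in the
  inequality, has to be stated.\<close>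

definition VI_solution ::
  "nat \<Rightarrow> nat \<Rightarrow> nat \<Rightarrow> (nat \<Rightarrow> nat \<Rightarrow> rvec \<Rightarrow> rvec) \<Rightarrow> (rvec \<Rightarrow> ereal) \<Rightarrow> rvec \<Rightarrow> bool" where
  "VI_solution d M n F g zs \<longleftrightarrow>
     zs \<in> Rn d \<and> g zs \<noteq> \<infinity> \<and>
     (\<forall>z\<in>Rn d. ereal (rdot d (\<Sum>m<M. mean_op n (F m) zs) (z - zs)) + g z - g zs \<ge> 0)"

definition connected_graph :: "nat \<Rightarrow> (nat \<times> nat) set \<Rightarrow> bool" where
  "connected_graph M E \<longleftrightarrow>
     E \<subseteq> {..<M} \<times> {..<M} \<and> sym E \<and> (\<forall>i<M. \<forall>j<M. (i, j) \<in> E\<^sup>*)"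

definition lambda_max :: "real mat \<Rightarrow> real" where
  "lambda_max W = Max {k. eigenvalue W k}"

definition lambda_min_pos :: "real mat \<Rightarrow> real" where
  "lambda_min_pos W = Min {k. eigenvalue W k \<and> k > 0}"

definition gossip_matrix :: "nat \<Rightarrow> (nat \<times> nat) set \<Rightarrow> real mat \<Rightarrow> bool" where
  "gossip_matrix M E W \<longleftrightarrow>
     W \<in> carrier_mat M M \<and> W\<^sup>T = W \<and>
     (\<forall>v\<in>carrier_vec M. scalar_prod v (W *\<^sub>v v) \<ge> 0) \<and>
     mat_kernel W = {c \<cdot>\<^sub>v vec M (\<lambda>_. 1) |c. True} \<and>
     (\<forall>i<M. \<forall>j<M. W $$ (i, j) \<noteq> 0 \<longleftrightarrow> i = j \<or> (i, j) \<in> E) \<and>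
     lambda_max W = 1"

text \<open>The action of the Kronecker product of \<open>W\<close> with the identity matrix on the lifted space.\<close>

definition gossip :: "nat \<Rightarrow> real mat \<Rightarrow> lvec \<Rightarrow> lvec" where
  "gossip M W z = (\<lambda>m. if m < M then (\<Sum>m'<M. W $$ (m, m') *\<^sub>R z m') else 0)"

definition lifted_op :: "nat \<Rightarrow> nat \<Rightarrow> (nat \<Rightarrow> nat \<Rightarrow> rvec \<Rightarrow> rvec) \<Rightarrow> lvec \<Rightarrow> lvec" where
  "lifted_op M n F z = (\<lambda>m. if m < M then mean_op n (F m) (z m) else 0)"

text \<open>\<open>j (m, l)\<close> is the \<open>l\<close>-th index drawn by worker \<open>m\<close>.\<close>

definition sampled_op ::
  "nat \<Rightarrow> (nat \<Rightarrow> nat \<Rightarrow> rvec \<Rightarrow> rvec) \<Rightarrow> (nat \<times> nat \<Rightarrow> nat) \<Rightarrow> nat \<Rightarrow> lvec \<Rightarrow> lvec" where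
  "sampled_op M F j l z = (\<lambda>m. if m < M then F m (j (m, l)) (z m) else 0)"

definition lifted_reg :: "nat \<Rightarrow> (rvec \<Rightarrow> ereal) \<Rightarrow> lvec \<Rightarrow> ereal" where
  "lifted_reg M g z = ereal (1 / real M) * (\<Sum>m<M. g (z m))"

definition prox :: "nat \<Rightarrow> nat \<Rightarrow> real \<Rightarrow> (rvec \<Rightarrow> ereal) \<Rightarrow> lvec \<Rightarrow> lvec" where
  "prox d M \<eta> g v =
     arg_min (\<lambda>u. ereal \<eta> * lifted_reg M g u + ereal (1/2 * (lnorm d M (u - v))\<^sup>2))
       (\<lambda>u. u \<in> Lifted d M)"

definition sample_indices :: "nat \<Rightarrow> nat \<Rightarrow> nat \<Rightarrow> (nat \<times> nat \<Rightarrow> nat) pmf" where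
  "sample_indices M n b = Pi_pmf ({..<M} \<times> {..<b}) 0 (\<lambda>_. pmf_of_set {..<n})"

text \<open>The algorithm state after \<open>k\<close> iterations is
  \<open>(z\<^sup>k, z\<^sup>k\<^sup>-\<^sup>1, w\<^sup>k, w\<^sup>k\<^sup>-\<^sup>1, y\<^sup>k, y\<^sup>k\<^sup>-\<^sup>1)\<close>.\<close>

type_synonym state = "lvec \<times> lvec \<times> lvec \<times> lvec \<times> lvec \<times> lvec"

definition step ::
  "nat \<Rightarrow> nat \<Rightarrow> nat \<Rightarrow> (nat \<Rightarrow> nat \<Rightarrow> rvec \<Rightarrow> rvec) \<Rightarrow> (rvec \<Rightarrow> ereal) \<Rightarrow> real mat \<Rightarrow>
   real \<Rightarrow> real \<Rightarrow> real \<Rightarrow> real \<Rightarrow> real \<Rightarrow> nat \<Rightarrow> real \<Rightarrow> state \<Rightarrow> state pmf" where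
  "step d M n F g W \<eta> \<theta> \<alpha> \<beta> \<gamma> b p = (\<lambda>(z, z_prev, w, w_prev, y, y_prev). do {
     j \<leftarrow> sample_indices M n b;
     j_half \<leftarrow> sample_indices M n b;
     coin \<leftarrow> bernoulli_pmf p;
     let \<delta> = (1 / real b) *\<^sub>R (\<Sum>l<b.
               (sampled_op M F j l z - sampled_op M F j l w_prev)
               + \<alpha> *\<^sub>R (sampled_op M F j l z - sampled_op M F j l z_prev))
             + lifted_op M n F w_prev;
         \<Delta> = \<delta> - (y + \<alpha> *\<^sub>R (y - y_prev));
         z_next = prox d M \<eta> g (z + \<gamma> *\<^sub>R (w - z) - \<eta> *\<^sub>R \<Delta>);
         \<Delta>_half = (1 / real b) *\<^sub>R (\<Sum>l<b.
               sampled_op M F j_half l z_next - sampled_op M F j_half l w)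
             + lifted_op M n F w;
         y_next = y - \<theta> *\<^sub>R gossip M W (z_next - \<beta> *\<^sub>R (\<Delta>_half - y));
         w_next = (if coin then z else w)
     in return_pmf (z_next, z, w_next, w, y_next, y)
   })"

primrec iterates ::
  "nat \<Rightarrow> nat \<Rightarrow> nat \<Rightarrow> (nat \<Rightarrow> nat \<Rightarrow> rvec \<Rightarrow> rvec) \<Rightarrow> (rvec \<Rightarrow> ereal) \<Rightarrow> real mat \<Rightarrow>
   real \<Rightarrow> real \<Rightarrow> real \<Rightarrow> real \<Rightarrow> real \<Rightarrow> nat \<Rightarrow> real \<Rightarrow> lvec \<Rightarrow> lvec \<Rightarrow> nat \<Rightarrow> state pmf" where
  "iterates d M n F g W \<eta> \<theta> \<alpha> \<beta> \<gamma> b p z0 y0 0 = return_pmf (z0, z0, z0, z0, y0, y0)"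
| "iterates d M n F g W \<eta> \<theta> \<alpha> \<beta> \<gamma> b p z0 y0 (Suc k) =
     iterates d M n F g W \<eta> \<theta> \<alpha> \<beta> \<gamma> b p z0 y0 k \<bind> step d M n F g W \<eta> \<theta> \<alpha> \<beta> \<gamma> b p"

definition expected_error ::
  "nat \<Rightarrow> nat \<Rightarrow> state pmf \<Rightarrow> lvec \<Rightarrow> real" where
  "expected_error d M S zs = measure_pmf.expectation S (\<lambda>s. (lnorm d M (fst s - zs))\<^sup>2)"

end

theory Submission
  imports Defs
begin

text \<open>Let \<open>z\<^sup>*\<close> be the lifted solution, \<open>y\<^sup>*\<close> the projection of \<open>F(z\<^sup>*)\<close> onto the orthogonal complement of
  the consensus space, and let \<open>Q\<close> be the quadratic form given there by the pseudo-inverse of the gossip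
  matrix.  With \<open>z, w, y\<close> the current and \<open>z', w', y'\<close> the previous iterates, the potential
  \<open>(1 + 3\<eta>\<mu>/2) |z - z\<^sup>*|\<^sup>2 + (1 + \<eta>\<mu>/(2p)) |w - z\<^sup>*|\<^sup>2 + (\<eta>/\<theta>) Q(y - y\<^sup>*) + |z - z'|\<^sup>2 / 4 + (3p/4) |z - w'|\<^sup>2
  + (\<eta>/(2\<theta>)) |y - y'|\<^sup>2 - 2\<eta> \<langle>F z - F z', z - z\<^sup>*\<rangle> + 2\<eta> \<langle>y - y', z - z\<^sup>*\<rangle>\<close> is at least half the squared error,
  and one iteration multiplies its expectation by at most \<open>\<alpha>\<close>.  The two cross terms make the
  extrapolation steps telescope.  The dual term contracts by \<open>1 - \<beta>\<theta>/\<kappa>\<close>, where \<open>\<kappa>\<close> is the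
  characteristic number, because \<open>|v|\<^sup>2 \<le> Q v \<le> \<kappa> |v|\<^sup>2\<close>.\<close>

section \<open>One step in a semi-inner product space\<close>

text \<open>The obstacle is that sampling errors and iterates are correlated inside one iteration.
  The first mini-batch moves \<open>zp\<close>, so its error averages out only against
  \<open>z - zst\<close>; its product with \<open>zp - z\<close> is paid for by part of the squared
  step and by its variance. The second mini-batch moves \<open>yp\<close>, so its error is tested
  against the dual update made with the exact operator, and what remains is quadratic in the error.
  The variances are absorbed by step lengths and by distances to the anchor \<open>w\<close>, which
  is why the potential contains them. The dual limit \<open>yst\<close> is \<open>Fhat zst\<close>
  minus its average over the workers. Minus that average is a subgradient of the lifted regularizer
  at the solution, because the variational inequality says just this; so one multiplier serves both
  the proximal optimality condition and the consensus constraint. The forms are only semi-definite: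
  coordinates beyond the dimension have length zero, and so have constant vectors in the gossip
  form. Every distribution that occurs has finite support, so expectations are finite sums and raise
  no question of integrability.\<close>

locale semi_inner =
  fixes ip :: "'a::real_vector \<Rightarrow> 'a \<Rightarrow> real"
  assumes add_left: "ip (x + y) z = ip x z + ip y z"
    and scaleR_left: "ip (c *\<^sub>R x) z = c * ip x z"
    and commute: "ip x y = ip y x"
    and nonneg: "ip x x \<ge> 0"
begin

lemma add_right: "ip z (x + y) = ip z x + ip z y"
  by (metis add_left commute)

lemma scaleR_right: "ip z (c *\<^sub>R x) = c * ip z x"
  by (metis scaleR_left commute)

lemma minus_left: "ip (- x) z = - ip x z"
  using scaleR_left[of "-1" x z] by simp

lemma minus_right: "ip z (- x) = - ip z x"
  by (metis minus_left commute)

lemma diff_left: "ip (x - y) z = ip x z - ip y z"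
  using add_left[of x "- y" z] minus_left by simp

lemma diff_right: "ip z (x - y) = ip z x - ip z y"
  by (metis diff_left commute)

lemma zero_left: "ip 0 z = 0"
  using scaleR_left[of 0 0 z] by simp

lemma zero_right: "ip z 0 = 0"
  by (metis zero_left commute)

lemmas expand = add_left add_right diff_left diff_right scaleR_left scaleR_right
  minus_left minus_right zero_left zero_right

lemma young:
  assumes "c > 0"
  shows "2 * ip x y \<le> c * ip x x + ip y y / c"
proof -
  have "0 \<le> ip (c *\<^sub>R x - y) (c *\<^sub>R x - y) / c"
    using nonneg assms by simp
  also have "\<dots> = c * ip x x + ip y y / c - 2 * ip x y"
    using assms by (simp add: expand commute[of y x] field_simps power2_eq_square)
  finally show ?thesis by simp
qed

lemma young_minus:
  assumes "c > 0"
  shows "- (2 * ip x y) \<le> c * ip x x + ip y y / c"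
  using young[OF assms, of "- x" y] by (simp add: expand)

lemma norm_add_le: "ip (x + y) (x + y) \<le> 2 * ip x x + 2 * ip y y"
  using young[of 1 x y] by (simp add: expand commute[of y x])

text \<open>For a possibly degenerate form, null vectors need an argument of their own. Otherwise
  the square of the component of \<open>y\<close> orthogonal to \<open>x\<close>, scaled by
  \<open>ip x x\<close>, is expanded.\<close>

lemma cauchy_schwarz: "(ip x y)\<^sup>2 \<le> ip x x * ip y y"
proof (cases "ip x x = 0")
  case True
  have "ip x y = 0"
  proof (rule ccontr)
    assume nz: "ip x y \<noteq> 0"
    \<comment> \<open>With this \<open>c\<close>, \<open>c * ip x y\<close> is
      \<open>ip y y + 1\<close>, against the Young inequality, whose term in \<open>x\<close>
      vanishes.\<close>
    define c where "c = (ip y y + 1) / ip x y"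
    have "2 * c * ip x y \<le> ip y y"
      using young[of 1 "c *\<^sub>R x" y] True by (simp add: expand)
    moreover have "c * ip x y = ip y y + 1"
      using nz by (simp add: c_def)
    ultimately show False using nonneg[of y] by linarith
  qed
  then show ?thesis using True by simp
next
  case False
  then have pos: "ip x x > 0" using nonneg[of x] by linarith
  have "0 \<le> ip (ip x x *\<^sub>R y - ip x y *\<^sub>R x) (ip x x *\<^sub>R y - ip x y *\<^sub>R x)"
    by (rule nonneg)
  also have "\<dots> = ip x x * (ip x x * ip y y - (ip x y)\<^sup>2)"
    by (simp add: expand commute[of y x] algebra_simps power2_eq_square)
  finally show ?thesis using pos by (simp add: zero_le_mult_iff)
qed

lemma three_point: "2 * ip (u - v) (u - w) = ip (u - w) (u - w) + ip (u - v) (u - v) - ip (v - w) (v - w)"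
  by (simp add: expand commute[of v u] commute[of w u] commute[of w v])

lemma ip_swap: "ip (u - v) (u - v) = ip (v - u) (v - u)"
  by (simp add: expand commute)

text \<open>\<open>Fs - ys\<close> will be the averaged operator value at the solution, so
  \<open>prox\<close> is the optimality inequality of the proximal step. Both inner products with
  \<open>zp - zs\<close> are polarized; the anchor direction \<open>w - z\<close> brings in the
  distances to \<open>w\<close>.\<close>

lemma primal_step:
  assumes prox: "ip (zp - z - \<gamma> *\<^sub>R (w - z) + \<eta> *\<^sub>R (\<Delta> - (Fs - ys))) (zp - zs) \<le> 0"
  shows "ip (zp - zs) (zp - zs) \<le>
     (1 - \<gamma>) * ip (z - zs) (z - zs) + \<gamma> * ip (w - zs) (w - zs)
     - (1 - \<gamma>) * ip (zp - z) (zp - z) - \<gamma> * ip (w - zp) (w - zp)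
     - 2 * \<eta> * ip (\<Delta> - (Fs - ys)) (zp - zs)"
proof -
  have 1: "2 * ip (zp - z) (zp - zs)
    = ip (zp - zs) (zp - zs) + ip (zp - z) (zp - z) - ip (z - zs) (z - zs)"
    by (rule three_point)
  have 2: "2 * ip (w - z) (zp - zs)
     = ip (w - zs) (w - zs) - ip (z - zs) (z - zs) - ip (w - zp) (w - zp) + ip (zp - z) (zp - z)"
    by (simp add: expand commute)
  have "2 * ip (zp - z) (zp - zs) - \<gamma> * (2 * ip (w - z) (zp - zs)) 
      + 2 * \<eta> * ip (\<Delta> - (Fs - ys)) (zp - zs) \<le> 0"
    using prox by (simp add: expand algebra_simps)
  then show ?thesis unfolding 1 2 by (simp add: algebra_simps)
qed

text \<open>\<open>Q\<close> stands for the pseudo-inverse form, in which a gossip step pairs like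
  the vector before gossiping; this is \<open>upd\<close>. Polarizing in \<open>Q\<close> gives
  telescoping distances, and polarizing the term with \<open>y - ys\<close> gives the negative
  squares from which the dual contraction comes.\<close>

lemma dual_step:
  assumes Q: "semi_inner Q"
    and upd: "Q (yp - y) (yp - ys) = - \<theta> * ip (zp - zs - \<beta> *\<^sub>R (\<Delta>h - y)) (yp - ys)"
    and proj: "ip (Fs - ys) (yp - ys) = 0"
    and \<theta>: "\<theta> > 0"
  shows "2 * ip (zp - zs) (yp - ys) =
     (Q (y - ys) (y - ys) - Q (yp - ys) (yp - ys) - Q (yp - y) (yp - y)) / \<theta>
     + \<beta> * (ip (yp - y) (yp - y) - ip (y - ys) (y - ys) - ip (yp - ys) (yp - ys))
     + 2 * \<beta> * ip (\<Delta>h - Fs) (yp - ys)"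
proof -
  have 1: "2 * Q (yp - y) (yp - ys) = Q (yp - ys) (yp - ys) + Q (yp - y) (yp - y) - Q (y - ys) (y - ys)"
    using semi_inner.three_point[OF Q] .
  have 2: "2 * ip (y - ys) (yp - ys) 
      = ip (y - ys) (y - ys) + ip (yp - ys) (yp - ys) - ip (yp - y) (yp - y)"
    by (simp add: expand commute)
  have 3: "ip (\<Delta>h - y) (yp - ys) = ip (\<Delta>h - Fs) (yp - ys) - ip (y - ys) (yp - ys)"
    using proj by (simp add: expand)
  have "2 * ip (zp - zs) (yp - ys) = 2 * \<beta> * ip (\<Delta>h - y) (yp - ys) - 2 * Q (yp - y) (yp - ys) / \<theta>"
    using upd \<theta> by (simp add: expand field_simps)
  also have "\<dots> = 2 * \<beta> * ip (\<Delta>h - Fs) (yp - ys) - \<beta> * (2 * ip (y - ys) (yp - ys)) - 2 * Q (yp - y) (yp - ys) / \<theta>"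
    unfolding 3 by (simp add: algebra_simps)
  also have "\<dots> = (Q (y - ys) (y - ys) - Q (yp - ys) (yp - ys) - Q (yp - y) (yp - y)) / \<theta>
     + \<beta> * (ip (yp - y) (yp - y) - ip (y - ys) (y - ys) - ip (yp - ys) (yp - ys))
     + 2 * \<beta> * ip (\<Delta>h - Fs) (yp - ys)"
    unfolding 1 2 by (simp add: diff_divide_distrib add_divide_distrib algebra_simps)
  finally show ?thesis .
qed

text \<open>Pure algebra: the extrapolated values are compared with \<open>Fzp\<close> and
  \<open>yp\<close>, one step ahead. The differences tested at \<open>zp - zs\<close> are the new
  cross terms, and the old ones reappear with factor \<alpha> once \<open>zp - zs\<close> is split
  at \<open>z\<close>.\<close>

lemma split_drift:
  assumes "\<Delta> = \<delta> - (y + \<alpha> *\<^sub>R (y - ym))"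
  shows "- 2 * \<eta> * ip (\<Delta> - (Fs - ys)) (zp - zs) =
     - 2 * \<eta> * ip (\<delta> - (Fz + \<alpha> *\<^sub>R (Fz - Fzm))) (z - zs)
     - 2 * \<eta> * ip (\<delta> - (Fz + \<alpha> *\<^sub>R (Fz - Fzm))) (zp - z)
     - 2 * \<eta> * ip (Fzp - Fs) (zp - zs) + 2 * \<eta> * ip (Fzp - Fz) (zp - zs)
     - 2 * \<eta> * \<alpha> * ip (Fz - Fzm) (z - zs) - 2 * \<eta> * \<alpha> * ip (Fz - Fzm) (zp - z)
     + 2 * \<eta> * ip (zp - zs) (yp - ys) - 2 * \<eta> * ip (yp - y) (zp - zs)
     + 2 * \<eta> * \<alpha> * ip (y - ym) (z - zs) + 2 * \<eta> * \<alpha> * ip (y - ym) (zp - z)"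
proof -
  have 1: "ip (\<Delta> - (Fs - ys)) (zp - zs) =
     ip (\<delta> - (Fz + \<alpha> *\<^sub>R (Fz - Fzm))) (zp - zs) + ip (Fzp - Fs) (zp - zs) - ip (Fzp - Fz) (zp - zs)
     + \<alpha> * ip (Fz - Fzm) (zp - zs) - ip (yp - ys) (zp - zs) + ip (yp - y) (zp - zs)
     - \<alpha> * ip (y - ym) (zp - zs)"
    unfolding assms by (simp add: expand algebra_simps)
  have 2: "ip v (zp - zs) = ip v (z - zs) + ip v (zp - z)" for v
    by (simp add: expand)
  show ?thesis unfolding 1 commute[of "zp - zs" "yp - ys"]
    unfolding 2[of "\<delta> - (Fz + \<alpha> *\<^sub>R (Fz - Fzm))"] 2[of "Fz - Fzm"] 2[of "y - ym"]
    by (simp add: algebra_simps)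
qed

text \<open>No expectation is taken yet: both sampling errors stay on the right. \<open>ybar\<close>
  will be the dual update computed with the exact value \<open>Fzp\<close>, and \<open>G\<close> the
  gossip matrix.\<close>

lemma pointwise_descent:
  assumes Q: "semi_inner Q"
    and prox: "ip (zp - z - p *\<^sub>R (w - z) + \<eta> *\<^sub>R (\<Delta> - (Fs - ys))) (zp - zs) \<le> 0"
    and \<Delta>: "\<Delta> = \<delta> - (y + \<alpha> *\<^sub>R (y - ym))"
    and mono: "ip (Fzp - Fs) (zp - zs) \<ge> \<mu> * ip (zp - zs) (zp - zs)"
    and lip: "ip (Fz - Fzm) (Fz - Fzm) \<le> L\<^sup>2 * ip (z - zm) (z - zm)"
    and lips: "ip (Fzp - Fs) (Fzp - Fs) \<le> L\<^sup>2 * ip (zp - zs) (zp - zs)"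
    and upd: "Q (yp - y) (yp - ys) = - \<theta> * ip (zp - zs - \<beta> *\<^sub>R (\<Delta>h - y)) (yp - ys)"
    and yp: "yp = ybar + (\<theta> * \<beta>) *\<^sub>R G (\<Delta>h - Fzp)"
    and G: "ip (\<Delta>h - Fzp) (G (\<Delta>h - Fzp)) \<le> ip (\<Delta>h - Fzp) (\<Delta>h - Fzp)"
    and proj: "ip (Fs - ys) (yp - ys) = 0"
    and Q1: "ip (yp - y) (yp - y) \<le> Q (yp - y) (yp - y)"
    and Q2: "Q (y - ys) (y - ys) \<le> \<kappa> * ip (y - ys) (y - ys)"
    and par: "0 < p" "p \<le> 1/8" "0 < \<eta>" "0 < \<theta>" "0 < \<beta>" "0 < \<kappa>" "0 < L" "0 < \<alpha>" "\<alpha> \<le> 1"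
      "\<eta> * L \<le> 1/16" "\<beta> * L\<^sup>2 \<le> \<mu> / 4" "\<theta> * \<beta> \<le> 1/2" "\<eta> * \<theta> \<le> 1/16"
  shows "(1 + 3/2 * \<eta> * \<mu>) * ip (zp - zs) (zp - zs) + \<eta> / \<theta> * Q (yp - ys) (yp - ys)
     + 5/16 * ip (zp - z) (zp - z) + p * ip (zp - w) (zp - w)
     + \<eta> / (2 * \<theta>) * ip (yp - y) (yp - y)
     - 2 * \<eta> * ip (Fzp - Fz) (zp - zs) + 2 * \<eta> * ip (yp - y) (zp - zs)
     \<le> (1 - p) * ip (z - zs) (z - zs) + p * ip (w - zs) (w - zs)
     + (1 - \<beta> * \<theta> / \<kappa>) * (\<eta> / \<theta> * Q (y - ys) (y - ys))
     + \<alpha> * (- 2 * \<eta> * ip (Fz - Fzm) (z - zs) + 2 * \<eta> * ip (y - ym) (z - zs))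
     + 1/16 * ip (z - zm) (z - zm) + \<eta> / (4 * \<theta>) * ip (y - ym) (y - ym)
     - 2 * \<eta> * ip (\<delta> - (Fz + \<alpha> *\<^sub>R (Fz - Fzm))) (z - zs)
     + 4 * \<eta>\<^sup>2 * ip (\<delta> - (Fz + \<alpha> *\<^sub>R (Fz - Fzm))) (\<delta> - (Fz + \<alpha> *\<^sub>R (Fz - Fzm)))
     + 2 * \<eta> * \<beta> * ip (\<Delta>h - Fzp) (ybar - ys)
     + \<eta> * \<beta> * ip (\<Delta>h - Fzp) (\<Delta>h - Fzp)"
proof -
  define D where "D = \<delta> - (Fz + \<alpha> *\<^sub>R (Fz - Fzm))"
  define \<xi> where "\<xi> = \<Delta>h - Fzp"
  define a where "a = ip (zp - z) (zp - z)"
  define b where "b = ip (zp - zs) (zp - zs)"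
  define c where "c = ip (yp - y) (yp - y)"
  have a0: "a \<ge> 0" and b0: "b \<ge> 0" and c0: "c \<ge> 0"
    by (simp_all add: a_def b_def c_def nonneg)
  have pr: "b \<le> (1 - p) * ip (z - zs) (z - zs) + p * ip (w - zs) (w - zs)
     - (1 - p) * a - p * ip (zp - w) (zp - w) - 2 * \<eta> * ip (\<Delta> - (Fs - ys)) (zp - zs)"
    using primal_step[OF prox] ip_swap[of w zp] by (simp add: a_def b_def)
  note sp = split_drift[OF \<Delta>, where \<eta> = \<eta> and Fs = Fs and ys = ys and zp = zp and zs = zs and Fz = Fz
      and Fzm = Fzm and z = z and Fzp = Fzp and yp = yp, folded D_def]
  \<comment> \<open>This part of the first sampling error is correlated with \<open>zp\<close>, so
    it is bounded instead of being left to average out.\<close>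
  have n1: "- 2 * \<eta> * ip D (zp - z) \<le> 4 * \<eta>\<^sup>2 * ip D D + 1/4 * a"
  proof -
    have "- (2 * ip (\<eta> *\<^sub>R D) (zp - z)) \<le> 4 * ip (\<eta> *\<^sub>R D) (\<eta> *\<^sub>R D) + a / 4"
      unfolding a_def by (rule young_minus) simp
    then show ?thesis by (simp add: scaleR_left scaleR_right power2_eq_square mult.assoc)
  qed
  have n2: "- 2 * \<eta> * ip (Fzp - Fs) (zp - zs) \<le> - 2 * \<eta> * \<mu> * b"
    using mult_left_mono[OF mono, of "2 * \<eta>"] par by (simp add: b_def)
  have n3: "- 2 * \<eta> * \<alpha> * ip (Fz - Fzm) (zp - z) \<le> 1/16 * ip (z - zm) (z - zm) + 1/16 * a"
  proof -
    have "- (2 * ip (Fz - Fzm) (zp - z)) \<le> 1 / L * ip (Fz - Fzm) (Fz - Fzm) + a / (1 / L)"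
      unfolding a_def using par by (intro young_minus) simp
    also have "\<dots> \<le> 1 / L * (L\<^sup>2 * ip (z - zm) (z - zm)) + L * a"
      using lip par by (intro add_mono mult_left_mono) auto
    also have "\<dots> = L * (ip (z - zm) (z - zm) + a)"
      using par by (simp add: field_simps power2_eq_square)
    finally have "\<eta> * \<alpha> * (- (2 * ip (Fz - Fzm) (zp - z))) \<le> \<eta> * \<alpha> * (L * (ip (z - zm) (z - zm) + a))"
      using par by (intro mult_left_mono) auto
    also have "\<dots> = \<alpha> * ((\<eta> * L) * (ip (z - zm) (z - zm) + a))" by simp
    also have "\<dots> \<le> 1 * ((\<eta> * L) * (ip (z - zm) (z - zm) + a))"
      using par a0 nonneg by (intro mult_right_mono) auto
    also have "\<dots> \<le> 1/16 * (ip (z - zm) (z - zm) + a)"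
      unfolding mult_1 using par a0 nonneg by (intro mult_right_mono) auto
    finally show ?thesis by simp
  qed
  have n4: "2 * \<eta> * \<alpha> * ip (y - ym) (zp - z) \<le> \<eta> / (4 * \<theta>) * ip (y - ym) (y - ym) + 1/4 * a"
  proof -
    have "2 * ip (y - ym) (zp - z) \<le> 1 / (4 * \<theta>) * ip (y - ym) (y - ym) + a / (1 / (4 * \<theta>))"
      unfolding a_def using par by (intro young) simp
    also have "\<dots> = 1 / (4 * \<theta>) * ip (y - ym) (y - ym) + 4 * \<theta> * a" by simp
    finally have "\<eta> * \<alpha> * (2 * ip (y - ym) (zp - z)) \<le> \<eta> * \<alpha> * (1 / (4 * \<theta>) * ip (y - ym) (y - ym) + 4 * \<theta> * a)"
      using par by (intro mult_left_mono) auto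
    also have "\<dots> \<le> \<eta> * 1 * (1 / (4 * \<theta>) * ip (y - ym) (y - ym) + 4 * \<theta> * a)"
      using par a0 nonneg by (intro mult_right_mono mult_left_mono add_nonneg_nonneg) auto
    also have "\<dots> = \<eta> / (4 * \<theta>) * ip (y - ym) (y - ym) + 4 * (\<eta> * \<theta>) * a"
      by (simp add: algebra_simps)
    also have "\<dots> \<le> \<eta> / (4 * \<theta>) * ip (y - ym) (y - ym) + 4 * (1/16) * a"
      using par a0 by (intro add_left_mono mult_right_mono mult_left_mono) auto
    finally show ?thesis by simp
  qed
  have du: "2 * ip (zp - zs) (yp - ys) =
     (Q (y - ys) (y - ys) - Q (yp - ys) (yp - ys) - Q (yp - y) (yp - y)) / \<theta>
     + \<beta> * (c - ip (y - ys) (y - ys) - ip (yp - ys) (yp - ys))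
     + 2 * \<beta> * ip (\<Delta>h - Fs) (yp - ys)"
    unfolding c_def by (rule dual_step) (use Q upd proj par in auto)
  \<comment> \<open>Substituting \<open>yp\<close> isolates the noise-free partner
    \<open>ybar - ys\<close>; the interaction of the noise with itself through \<open>G\<close>
    costs at most its square because \<theta>\<beta> is at most 1/2. The remaining half of
    \<open>ip (yp - ys) (yp - ys)\<close> is covered by the negative square in
    \<open>du\<close>.\<close>
  have d1: "2 * ip (\<Delta>h - Fs) (yp - ys) \<le> 2 * ip \<xi> (ybar - ys) + ip \<xi> \<xi> + 
      1/2 * ip (yp - ys) (yp - ys) + 2 * L\<^sup>2 * b"
  proof -
    have "2 * ip (Fzp - Fs) (yp - ys) \<le> 2 * ip (Fzp - Fs) (Fzp - Fs) + ip (yp - ys) (yp - ys) / 2"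
      by (rule young) simp
    also have "\<dots> \<le> 2 * L\<^sup>2 * b + ip (yp - ys) (yp - ys) / 2"
      using lips by (simp add: b_def)
    finally have 1: "2 * ip (Fzp - Fs) (yp - ys) \<le> 2 * L\<^sup>2 * b + ip (yp - ys) (yp - ys) / 2" .
    have "ip \<xi> (yp - ys) = ip \<xi> (ybar - ys) + (\<theta> * \<beta>) * ip \<xi> (G \<xi>)"
      unfolding yp \<xi>_def by (simp add: expand)
    also have "(\<theta> * \<beta>) * ip \<xi> (G \<xi>) \<le> (\<theta> * \<beta>) * ip \<xi> \<xi>"
      using G par by (intro mult_left_mono) (auto simp: \<xi>_def)
    also have "\<dots> \<le> 1/2 * ip \<xi> \<xi>"
      using par nonneg by (intro mult_right_mono) auto
    finally have 2: "2 * ip \<xi> (yp - ys) \<le> 2 * ip \<xi> (ybar - ys) + ip \<xi> \<xi>" by simp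
    have "ip (\<Delta>h - Fs) (yp - ys) = ip \<xi> (yp - ys) + ip (Fzp - Fs) (yp - ys)"
      by (simp add: \<xi>_def expand)
    then show ?thesis using 1 2 by linarith
  qed
  have d2: "\<beta> * (2 * L\<^sup>2 * b) \<le> \<mu> / 2 * b"
    using mult_right_mono[OF par(11) b0] by simp
  have d3: "\<beta> * c \<le> 1/2 * (c / \<theta>)"
    using mult_right_mono[OF par(12) c0] par by (simp add: field_simps)
  have d4: "c / \<theta> \<le> Q (yp - y) (yp - y) / \<theta>"
    using Q1 par by (simp add: c_def divide_right_mono)
  \<comment> \<open>The dual contraction arises here: the negative square of \<open>y - ys\<close>
    in \<open>du\<close> is traded for the share \<open>\<beta> / \<kappa>\<close> of
    \<open>Q\<close>.\<close>
  have d5: "\<beta> / \<kappa> * Q (y - ys) (y - ys) \<le> \<beta> * ip (y - ys) (y - ys)"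
    using mult_left_mono[OF Q2, of "\<beta> / \<kappa>"] par by simp
  have d6: "0 \<le> \<beta> * ip (yp - ys) (yp - ys)" using par nonneg by simp
  have "2 * ip (zp - zs) (yp - ys) \<le> Q (y - ys) (y - ys) / \<theta> - Q (yp - ys) (yp - ys) / \<theta> - 1/2 * (c / \<theta>)
     - \<beta> / \<kappa> * Q (y - ys) (y - ys) + \<mu> / 2 * b + \<beta> * (2 * ip \<xi> (ybar - ys) + ip \<xi> \<xi>)"
    using mult_left_mono[OF d1, of \<beta>] d2 d3 d4 d5 d6 par(5)
    unfolding du
    by (simp add: algebra_simps diff_divide_distrib add_divide_distrib)
  note du0 = mult_left_mono[OF this, of \<eta>]
  have k: "(1 - \<beta> * \<theta> / \<kappa>) * (\<eta> / \<theta> * q) = \<eta> * (q / \<theta>) - \<eta> * (\<beta> / \<kappa> * q)" for q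
    using par by (simp add: field_simps)
  have du': "2 * \<eta> * ip (zp - zs) (yp - ys) \<le> (1 - \<beta> * \<theta> / \<kappa>) * (\<eta> / \<theta> * Q (y - ys) (y - ys))
     - \<eta> / \<theta> * Q (yp - ys) (yp - ys) - \<eta> / (2 * \<theta>) * c + \<eta> * \<mu> / 2 * b 
     + 2 * \<eta> * \<beta> * ip \<xi> (ybar - ys) + \<eta> * \<beta> * ip \<xi> \<xi>"
    using du0 par(3) unfolding k by (simp add: algebra_simps)
  \<comment> \<open>Budget for \<open>a\<close>: 1 - p - 1/4 - 1/16 - 1/4 is at least 5/16. Budget
    for \<open>b\<close>: strong monotonicity gives 2 \<eta> \<mu>, of which the dual part takes
    back \<eta> \<mu> / 2.\<close>
  have pa: "p * a \<le> 1/8 * a" using par a0 by (intro mult_right_mono)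
  show ?thesis
    unfolding D_def[symmetric] \<xi>_def[symmetric] a_def[symmetric] b_def[symmetric] c_def[symmetric]
    using pr sp n1 n2 n3 n4 du' pa
    by (simp add: algebra_simps)
qed

text \<open>Only the cross terms are indefinite. Young's inequality bounds them by 3/16 of the
  squared error plus parts of the step terms, which leaves more than half of the error.\<close>

lemma potential_lower_bound:
  assumes lip: "ip (Fz - Fzm) (Fz - Fzm) \<le> L\<^sup>2 * ip (z - zm) (z - zm)"
    and par: "0 < \<eta>" "0 < \<theta>" "0 < L" "\<eta> * L \<le> 1/16" "\<eta> * \<theta> \<le> 1/16"
  shows "1/2 * ip (z - zs) (z - zs) \<le> ip (z - zs) (z - zs) + 1/4 * ip (z - zm) (z - zm)
     + \<eta> / (2 * \<theta>) * ip (y - ym) (y - ym)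
     - 2 * \<eta> * ip (Fz - Fzm) (z - zs) + 2 * \<eta> * ip (y - ym) (z - zs)"
proof -
  define a where "a = ip (z - zs) (z - zs)"
  have a0: "a \<ge> 0" by (simp add: a_def nonneg)
  have 1: "2 * \<eta> * ip (Fz - Fzm) (z - zs) \<le> 1/16 * ip (z - zm) (z - zm) + 1/16 * a"
  proof -
    have "2 * ip (Fz - Fzm) (z - zs) \<le> 1 / L * ip (Fz - Fzm) (Fz - Fzm) + a / (1 / L)"
      unfolding a_def using par by (intro young) simp
    also have "\<dots> \<le> 1 / L * (L\<^sup>2 * ip (z - zm) (z - zm)) + L * a"
      using lip par by (intro add_mono mult_left_mono) auto
    also have "\<dots> = L * (ip (z - zm) (z - zm) + a)"
      using par by (simp add: field_simps power2_eq_square)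
    finally have "\<eta> * (2 * ip (Fz - Fzm) (z - zs)) \<le> \<eta> * (L * (ip (z - zm) (z - zm) + a))"
      using par by (intro mult_left_mono) auto
    also have "\<dots> = (\<eta> * L) * (ip (z - zm) (z - zm) + a)" by simp
    also have "\<dots> \<le> 1/16 * (ip (z - zm) (z - zm) + a)"
      using par a0 nonneg by (intro mult_right_mono) auto
    finally show ?thesis by simp
  qed
  have 2: "- (2 * \<eta> * ip (y - ym) (z - zs)) \<le> \<eta> / (2 * \<theta>) * ip (y - ym) (y - ym) + 1/8 * a"
  proof -
    have "- (2 * ip (y - ym) (z - zs)) \<le> 1 / (2 * \<theta>) * ip (y - ym) (y - ym) + a / (1 / (2 * \<theta>))"
      unfolding a_def using par by (intro young_minus) simp
    also have "\<dots> = 1 / (2 * \<theta>) * ip (y - ym) (y - ym) + 2 * \<theta> * a" by simp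
    finally have "\<eta> * (- (2 * ip (y - ym) (z - zs))) \<le> \<eta> * (1 / (2 * \<theta>) * ip (y - ym) (y - ym) + 2 * \<theta> * a)"
      using par by (intro mult_left_mono) auto
    also have "\<dots> = \<eta> / (2 * \<theta>) * ip (y - ym) (y - ym) + 2 * (\<eta> * \<theta>) * a"
      by (simp add: algebra_simps)
    also have "\<dots> \<le> \<eta> / (2 * \<theta>) * ip (y - ym) (y - ym) + 2 * (1/16) * a"
      using par a0 by (intro add_left_mono mult_right_mono mult_left_mono) auto
    finally show ?thesis by simp
  qed
  have 3: "0 \<le> ip (z - zm) (z - zm)" by (rule nonneg)
  show ?thesis using 1 2 3 a0 unfolding a_def by linarith
qed

end

section \<open>Spectral bounds for the gossip matrix\<close>

lemma rdot_semi_inner: "semi_inner (rdot d)"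
proof
  fix x y z :: rvec and c :: real
  show "rdot d (x + y) z = rdot d x z + rdot d y z"
    by (simp add: rdot_def sum.distrib algebra_simps)
  show "rdot d (c *\<^sub>R x) z = c * rdot d x z"
    by (simp add: rdot_def sum_distrib_left scaleR_fun_def algebra_simps)
  show "rdot d x y = rdot d y x"
    by (simp add: rdot_def mult.commute)
  show "rdot d x x \<ge> 0"
    by (simp add: rdot_def sum_nonneg)
qed

lemma sum_fun_apply: "(\<Sum>i\<in>A. f i) x = (\<Sum>i\<in>A. f i x)"
  for f :: "'i \<Rightarrow> 'a \<Rightarrow> 'b::comm_monoid_add"
  by (induction A rule: infinite_finite_induct) auto

lemma Rn_sum: "(\<And>i. i \<in> I \<Longrightarrow> f i \<in> Rn d) \<Longrightarrow> (\<Sum>i\<in>I. f i) \<in> Rn d"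
  by (auto simp: Rn_def topspace_Euclidean_space sum_fun_apply)

lemma Rn_scaleR: "v \<in> Rn d \<Longrightarrow> c *\<^sub>R v \<in> Rn d"
  by (auto simp: Rn_def topspace_Euclidean_space scaleR_fun_def)

lemma Rn_add: "u \<in> Rn d \<Longrightarrow> v \<in> Rn d \<Longrightarrow> u + v \<in> Rn d"
  by (auto simp: Rn_def topspace_Euclidean_space)

lemma Rn_diff: "u \<in> Rn d \<Longrightarrow> v \<in> Rn d \<Longrightarrow> u - v \<in> Rn d"
  by (auto simp: Rn_def topspace_Euclidean_space)

text \<open>Tychonoff: vectors of every dimension live in one function space with the product
  topology, where boxes are compact.\<close>

lemma compact_box: "compact {x :: nat \<Rightarrow> real. \<forall>i. \<bar>x i\<bar> \<le> r}"
proof -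
  have "compactin (product_topology (\<lambda>i::nat. euclideanreal) UNIV) (PiE UNIV (\<lambda>_. {-r..r}))"
    by (subst compactin_PiE) auto
  moreover have "PiE UNIV (\<lambda>_::nat. {-r..r}) = {x. \<forall>i. \<bar>x i\<bar> \<le> r}"
    by (auto simp: PiE_UNIV_domain Pi_iff abs_le_iff minus_le_iff)
  ultimately show ?thesis
    by (simp add: euclidean_product_topology)
qed

lemma continuous_on_coord: "continuous_on S (\<lambda>x :: nat \<Rightarrow> real. x i)"
  by (rule continuous_on_subset[OF continuous_on_product_coordinates]) simp

lemma rdot_eq_0_iff:
  assumes "x \<in> Rn d"
  shows "rdot d x x = 0 \<longleftrightarrow> x = 0"
proof
  assume "rdot d x x = 0"
  then have "\<forall>i<d. x i = 0"
    unfolding rdot_def by (subst (asm) sum_nonneg_eq_0_iff) auto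
  then show "x = 0" using assms
    by (auto simp: Rn_def topspace_Euclidean_space fun_eq_iff) (meson not_le)
qed (simp add: rdot_def)

lemma abs_coord_le:
  assumes "x \<in> Rn d" "rdot d x x \<le> r\<^sup>2" "r \<ge> 0"
  shows "\<bar>x i\<bar> \<le> r"
proof (cases "i < d")
  case True
  have "(x i)\<^sup>2 \<le> rdot d x x"
    unfolding rdot_def power2_eq_square[symmetric]
    by (rule member_le_sum) (use True in auto)
  with assms show ?thesis
    by (metis abs_le_square_iff abs_of_nonneg order_trans)
next
  case False
  then show ?thesis using assms by (auto simp: Rn_def topspace_Euclidean_space)
qed

lemma closed_Rn: "closed (Rn d)"
  unfolding Rn_def using closedin_Euclidean_space[of d]
  by (simp add: euclidean_product_topology)

section \<open>Rayleigh quotients of symmetric matrices\<close>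

definition mat_app :: "nat \<Rightarrow> (nat \<Rightarrow> nat \<Rightarrow> real) \<Rightarrow> rvec \<Rightarrow> rvec" where
  "mat_app M a v = (\<lambda>i. if i < M then (\<Sum>j<M. a i j * v j) else 0)"

lemma mat_app_in_Rn: "mat_app M a v \<in> Rn M"
  by (simp add: mat_app_def Rn_def topspace_Euclidean_space)

lemma mat_app_add: "mat_app M a (u + v) = mat_app M a u + mat_app M a v"
  by (auto simp: mat_app_def fun_eq_iff sum.distrib algebra_simps)

lemma mat_app_scaleR: "mat_app M a (c *\<^sub>R v) = c *\<^sub>R mat_app M a v"
  by (auto simp: mat_app_def fun_eq_iff scaleR_fun_def sum_distrib_left algebra_simps)

lemma rdot_mat_app_commute:
  assumes "\<And>i j. i < M \<Longrightarrow> j < M \<Longrightarrow> a i j = a j i"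
  shows "rdot M u (mat_app M a v) = rdot M (mat_app M a u) v"
proof -
  have "rdot M u (mat_app M a v) = (\<Sum>i<M. \<Sum>j<M. u i * (a i j * v j))"
    by (simp add: rdot_def mat_app_def sum_distrib_left)
  also have "\<dots> = (\<Sum>j<M. \<Sum>i<M. u i * (a i j * v j))"
    by (rule sum.swap)
  also have "\<dots> = (\<Sum>j<M. \<Sum>i<M. (a j i * u i) * v j)"
    using assms by (intro sum.cong refl) (auto simp: algebra_simps)
  also have "\<dots> = rdot M (mat_app M a u) v"
    by (simp add: rdot_def mat_app_def sum_distrib_right)
  finally show ?thesis .
qed

text \<open>First-order optimality: a quadratic that is nonnegative and vanishes at 0 has slope 0
  there.\<close>

lemma linear_coeff_zero:
  fixes b c :: real
  assumes "\<And>t. 0 \<le> 2 * t * b + t\<^sup>2 * c"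
  shows "b = 0"
proof (rule ccontr)
  assume b: "b \<noteq> 0"
  \<comment> \<open>Since \<open>s\<close> exceeds \<open>c\<close>, the linear term dominates at
    the step \<open>- b / s\<close>.\<close>
  define s where "s = \<bar>c\<bar> + 1"
  have s: "s > 0" "c < s" by (auto simp: s_def)
  have "0 \<le> 2 * (- b / s) * b + (- b / s)\<^sup>2 * c" by (rule assms)
  also have "\<dots> = b\<^sup>2 / s * (c / s - 2)"
    using s by (simp add: power2_eq_square field_simps)
  also have "\<dots> < 0"
    using b s by (intro mult_pos_neg) (auto simp: field_simps)
  finally show False by simp
qed

text \<open>Minimizing the quadratic form on the unit sphere of an invariant closed subspace
  produces an eigenvector. Applied to \<open>W\<close>, to its negative, and on the complement of
  the constants, this yields all spectral bounds below.\<close>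

lemma rayleigh_minimizer:
  assumes sym: "\<And>i j. i < M \<Longrightarrow> j < M \<Longrightarrow> a i j = a j i"
    and S: "S \<subseteq> Rn M" "closed S" "\<And>u v. u \<in> S \<Longrightarrow> v \<in> S \<Longrightarrow> u + v \<in> S"
      "\<And>c v. v \<in> S \<Longrightarrow> c *\<^sub>R v \<in> S" "\<And>v. v \<in> S \<Longrightarrow> mat_app M a v \<in> S"
    and v0: "v0 \<in> S" "v0 \<noteq> 0"
  obtains v m where "v \<in> S" "v \<noteq> 0" "mat_app M a v = m *\<^sub>R v"
    "\<And>u. u \<in> S \<Longrightarrow> m * rdot M u u \<le> rdot M u (mat_app M a u)"
proof -
  interpret semi_inner "rdot M" by (rule rdot_semi_inner)
  define q where "q u = rdot M u (mat_app M a u)" for u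
  define K where "K = S \<inter> {v. rdot M v v = 1}"
  have cont: "continuous_on UNIV (\<lambda>v. rdot M v v)" "continuous_on UNIV q"
  proof -
    show "continuous_on UNIV (\<lambda>v. rdot M v v)"
      unfolding rdot_def by (intro continuous_intros continuous_on_coord)
    have "q = (\<lambda>v. \<Sum>i<M. v i * (\<Sum>j<M. a i j * v j))"
      by (auto simp: q_def rdot_def mat_app_def fun_eq_iff intro!: sum.cong)
    then show "continuous_on UNIV q"
      by (auto intro!: continuous_intros continuous_on_coord)
  qed
  have "closed {v. rdot M v v = 1}"
    using cont(1) by (intro closed_Collect_eq) auto
  then have "closed K"
    unfolding K_def using S(2) by (rule closed_Int[rotated])
  from compact_Int_closed[OF compact_box[of 1] this]
  have "compact ({x. \<forall>i. \<bar>x i\<bar> \<le> 1} \<inter> K)" .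
  moreover have "K \<subseteq> {x. \<forall>i. \<bar>x i\<bar> \<le> 1}"
    using abs_coord_le[of _ M 1] S(1) by (auto simp: K_def)
  ultimately have "compact K"
    by (simp add: Int_absorb1)
  moreover
  have scale: "(1 / sqrt (rdot M u u)) *\<^sub>R u \<in> K" if "u \<in> S" "u \<noteq> 0" for u
  proof -
    have "rdot M u u > 0"
      using rdot_eq_0_iff[of u M] nonneg[of u] that S(1) by (metis less_eq_real_def subsetD)
    then show ?thesis using that S(4) by (simp add: K_def expand)
  qed
  then have "K \<noteq> {}" using v0 by blast
  ultimately obtain v where v: "v \<in> K" "\<And>u. u \<in> K \<Longrightarrow> q v \<le> q u"
    using continuous_attains_inf[of K q] cont(2) continuous_on_subset by blast
  have low: "q v * rdot M u u \<le> q u" if u: "u \<in> S" for u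
  proof (cases "u = 0")
    case True
    then show ?thesis by (simp add: q_def rdot_def)
  next
    case False
    have "rdot M u u > 0"
      using rdot_eq_0_iff[of u M] nonneg[of u] that S(1) False by (metis less_eq_real_def subsetD)
    moreover have "q v \<le> q ((1 / sqrt (rdot M u u)) *\<^sub>R u)"
      using v(2) scale[OF u False] by blast
    moreover have "q ((1 / sqrt (rdot M u u)) *\<^sub>R u) = q u / rdot M u u"
      using nonneg[of u] by (simp add: q_def mat_app_scaleR expand)
    ultimately show ?thesis by (simp add: field_simps)
  qed
  have vS: "v \<in> S" and v1: "rdot M v v = 1" using v(1) by (auto simp: K_def)
  \<comment> \<open>The residual of the eigenvalue equation. It lies in \<open>S\<close> by
    invariance, so \<open>v\<close> may be perturbed along it; the first-order term of the form
    minus \<open>q v\<close> times the squared norm is then twice the squared length of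
    \<open>u\<close>, which must vanish.\<close>
  define u where "u = mat_app M a v + (- q v) *\<^sub>R v"
  have uS: "u \<in> S" unfolding u_def using S vS by blast
  have comm: "rdot M v (mat_app M a u) = rdot M (mat_app M a v) u"
    using sym by (rule rdot_mat_app_commute)
  have "rdot M v (mat_app M a u) - q v * rdot M v u = 0"
  proof (rule linear_coeff_zero)
    fix t :: real
    have "v + t *\<^sub>R u \<in> S" using S vS uS by blast
    from low[OF this] 
    show "0 \<le> 2 * t * (rdot M v (mat_app M a u) - q v * rdot M v u) + t\<^sup>2 * (q u - q v * rdot M u u)"
      using v1 unfolding q_def mat_app_add mat_app_scaleR
      by (simp add: expand commute[of u v] commute[of u "mat_app M a v"]
          comm power2_eq_square algebra_simps)
  qed
  moreover have "rdot M v (mat_app M a u) - q v * rdot M v u = rdot M (mat_app M a v + (- q v) *\<^sub>R v) u"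
    unfolding comm add_left scaleR_left by simp
  then have "rdot M v (mat_app M a u) - q v * rdot M v u = rdot M u u"
    by (simp only: u_def[symmetric])
  ultimately have "u = 0" using rdot_eq_0_iff[of u M] uS S(1) by auto
  then have "mat_app M a v = q v *\<^sub>R v"
    by (simp add: u_def)
  moreover have "v \<noteq> 0" using v1 by (auto simp: zero_left)
  ultimately show thesis using that[of v "q v"] vS low by (simp add: q_def)
qed

lemma mult_vec_mat_app:
  assumes "W \<in> carrier_mat M M"
  shows "W *\<^sub>v vec M v = vec M (mat_app M (\<lambda>i j. W $$ (i, j)) v)"
  using assms by (auto simp: mat_app_def scalar_prod_def atLeast0LessThan intro!: eq_vecI)

lemma scalar_prod_rdot: "scalar_prod (vec M u) (vec M v) = rdot M u v"
  by (simp add: scalar_prod_def rdot_def atLeast0LessThan)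

lemma eigenvalue_mat_app:
  assumes W: "W \<in> carrier_mat M M" and v: "v \<in> Rn M" "v \<noteq> 0"
    and eq: "mat_app M (\<lambda>i j. W $$ (i, j)) v = k *\<^sub>R v"
  shows "eigenvalue W k"
proof -
  have "vec M v \<noteq> 0\<^sub>v M"
  proof
    assume z: "vec M v = 0\<^sub>v M"
    have "v i = 0" for i
    proof (cases "i < M")
      case True
      then have "v i = vec M v $ i" by simp
      then show ?thesis using z True by simp
    qed (use v in \<open>auto simp: Rn_def topspace_Euclidean_space\<close>)
    then show False using v(2) by (auto simp: fun_eq_iff)
  qed
  moreover have "W *\<^sub>v vec M v = k \<cdot>\<^sub>v vec M v"
    unfolding mult_vec_mat_app[OF W] eq by (auto simp: scaleR_fun_def)
  ultimately show ?thesis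
    using W unfolding eigenvalue_def eigenvector_def
    by (intro exI[of _ "vec M v"]) auto
qed

text \<open>This gives \<open>Max\<close> and \<open>Min\<close> in the definitions of the extremal
  eigenvalues their meaning: eigenvalues are roots of the nonzero characteristic polynomial.\<close>

lemma finite_eigenvalues:
  assumes "(W :: real mat) \<in> carrier_mat M M"
  shows "finite {k. eigenvalue W k}"
proof -
  have "char_poly W \<noteq> 0"
    using degree_monic_char_poly[OF assms] by (metis coeff_0 zero_neq_one)
  then show ?thesis
    using poly_roots_finite[of "char_poly W"] eigenvalue_root_char_poly[OF assms] by simp
qed

section \<open>Spectrum and inverse of the gossip matrix\<close>

locale gossip_network =
  fixes M :: nat and E :: "(nat \<times> nat) set" and W :: "real mat"
  assumes M: "M \<ge> 1" and W: "gossip_matrix M E W"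
begin

abbreviation app :: "rvec \<Rightarrow> rvec" where "app \<equiv> mat_app M (\<lambda>i j. W $$ (i, j))"

text \<open>Scalar counterpart of \<open>consensus_perp\<close>: what one coordinate of such a
  lifted vector looks like across the workers.\<close>

definition perp :: "rvec set" where "perp = {v \<in> Rn M. (\<Sum>i<M. v i) = 0}"

sublocale semi_inner "rdot M" by (rule rdot_semi_inner)

lemma carrier: "W \<in> carrier_mat M M"
  using W by (simp add: gossip_matrix_def)

lemma sym_entries: "i < M \<Longrightarrow> j < M \<Longrightarrow> W $$ (i, j) = W $$ (j, i)"
  using W carrier by (metis carrier_matD gossip_matrix_def index_transpose_mat(1))

lemmas app_commute = rdot_mat_app_commute[where a = "\<lambda>i j. W $$ (i, j)", OF sym_entries]

lemma psd: "rdot M v (app v) \<ge> 0"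
proof -
  have "scalar_prod (vec M v) (W *\<^sub>v vec M v) \<ge> 0"
    using W by (simp add: gossip_matrix_def)
  then show ?thesis
    unfolding mult_vec_mat_app[OF carrier] scalar_prod_rdot .
qed

lemma kernel_iff:
  assumes "v \<in> Rn M"
  shows "app v = 0 \<longleftrightarrow> (\<exists>c. \<forall>i<M. v i = c)"
proof -
  have "app v = 0 \<longleftrightarrow> W *\<^sub>v vec M v = 0\<^sub>v M"
  proof
    assume "W *\<^sub>v vec M v = 0\<^sub>v M"
    then have "app v i = 0" if "i < M" for i
      using that unfolding mult_vec_mat_app[OF carrier] by (metis index_vec index_zero_vec(1))
    then show "app v = 0" by (auto simp: fun_eq_iff mat_app_def)
  qed (auto simp: mult_vec_mat_app[OF carrier])
  also have "\<dots> \<longleftrightarrow> vec M v \<in> mat_kernel W"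
    using mat_kernel[OF carrier] by simp
  also have "\<dots> \<longleftrightarrow> (\<exists>c. vec M v = c \<cdot>\<^sub>v vec M (\<lambda>_. 1))"
    using W by (simp add: gossip_matrix_def)
  also have "\<dots> \<longleftrightarrow> (\<exists>c. \<forall>i<M. v i = c)"
    by (auto simp: vec_eq_iff)
  finally show ?thesis .
qed

lemma row_sum: "i < M \<Longrightarrow> (\<Sum>j<M. W $$ (i, j)) = 0"
proof -
  assume i: "i < M"
  define e where "e = (\<lambda>i. if i < M then 1 else 0 :: real)"
  have "e \<in> Rn M" "\<exists>c. \<forall>i<M. e i = c"
    by (auto simp: e_def Rn_def topspace_Euclidean_space)
  then have "app e = 0" using kernel_iff by blast
  then have "app e i = 0" by simp
  then show ?thesis using i by (simp add: mat_app_def e_def)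
qed

text \<open>Rows sum to zero because the all-ones vector is in the kernel; symmetry carries this
  over to the columns.\<close>

lemma app_sum: "(\<Sum>i<M. app v i) = 0"
proof -
  have "(\<Sum>i<M. app v i) = (\<Sum>i<M. \<Sum>j<M. W $$ (i, j) * v j)"
    by (simp add: mat_app_def)
  also have "\<dots> = (\<Sum>j<M. \<Sum>i<M. W $$ (i, j) * v j)" by (rule sum.swap)
  also have "\<dots> = (\<Sum>j<M. (\<Sum>i<M. W $$ (j, i)) * v j)"
    unfolding sum_distrib_right using sym_entries by (intro sum.cong refl) auto
  also have "\<dots> = 0" using row_sum by simp
  finally show ?thesis .
qed

lemma app_in_perp: "app v \<in> perp"
  using app_sum mat_app_in_Rn by (auto simp: perp_def)

lemma eigenvalue_le_1: "eigenvalue W k \<Longrightarrow> k \<le> 1"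
  using W Max_ge[OF finite_eigenvalues[OF carrier], of k]
  by (simp add: gossip_matrix_def lambda_max_def)

lemma one_coord: obtains v where "v \<in> Rn M" "v \<noteq> (0::rvec)"
proof (rule that[of "\<lambda>i. if i = 0 then 1 else 0"])
  show "(\<lambda>i. if i = 0 then 1 else 0) \<in> Rn M"
    using M by (auto simp: Rn_def topspace_Euclidean_space)
  show "(\<lambda>i. if i = 0 then 1 else 0) \<noteq> (0::rvec)"
    by (auto simp: fun_eq_iff intro!: exI[of _ 0])
qed

text \<open>The largest eigenvalue of \<open>W\<close> is minus the smallest of its negative, so
  Rayleigh minimization for the negated matrix turns \<open>lambda_max W = 1\<close> into an upper
  bound on the form.\<close>

lemma rdot_app_le: 
  assumes "u \<in> Rn M" shows "rdot M u (app u) \<le> rdot M u u"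
proof -
  define a where "a = (\<lambda>i j. - W $$ (i, j))"
  have neg: "mat_app M a v = - app v" for v
    by (auto simp: mat_app_def a_def fun_eq_iff sum_negf)
  obtain v0 where v0: "v0 \<in> Rn M" "v0 \<noteq> (0::rvec)" by (rule one_coord)
  obtain v m where v: "v \<in> Rn M" "v \<noteq> 0" "mat_app M a v = m *\<^sub>R v"
    and low: "\<And>u. u \<in> Rn M \<Longrightarrow> m * rdot M u u \<le> rdot M u (mat_app M a u)"
  proof (rule rayleigh_minimizer[of M a "Rn M" v0])
    show "a i j = a j i" if "i < M" "j < M" for i j
      using sym_entries that by (simp add: a_def)
  qed (use v0 closed_Rn mat_app_in_Rn Rn_add Rn_scaleR in auto)
  have "app v = (- m) *\<^sub>R v" using v(3) neg[of v] by (metis minus_minus scaleR_minus_left)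
  then have "- m \<le> 1"
    using eigenvalue_mat_app[OF carrier v(1,2)] eigenvalue_le_1 by blast
  then have "- rdot M u u \<le> m * rdot M u u"
    using mult_right_mono[of "-1" m "rdot M u u"] nonneg[of u] by simp
  also have "\<dots> \<le> - rdot M u (app u)"
    using low[OF assms] by (simp add: neg expand)
  finally show ?thesis by simp
qed

text \<open>A Rayleigh minimizer shows that eigenvalues exist, so their \<open>Max\<close> is
  attained. Hence the set of positive eigenvalues is nonempty, and its \<open>Min\<close> is
  positive and at most 1.\<close>

lemma eigenvalue_1: "eigenvalue W 1"
proof -
  obtain v0 where v0: "v0 \<in> Rn M" "v0 \<noteq> (0::rvec)" by (rule one_coord)
  obtain v m where v: "v \<in> Rn M" "v \<noteq> 0" "app v = m *\<^sub>R v"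
    by (rule rayleigh_minimizer[of M "\<lambda>i j. W $$ (i, j)" "Rn M" v0])
      (use v0 closed_Rn mat_app_in_Rn Rn_add Rn_scaleR sym_entries in auto)
  then have "{k. eigenvalue W k} \<noteq> {}"
    using eigenvalue_mat_app[OF carrier] by blast
  from Max_in[OF finite_eigenvalues[OF carrier] this] show ?thesis
    using W by (simp add: gossip_matrix_def lambda_max_def)
qed

lemma lambda_min_pos: "lambda_min_pos W > 0" "lambda_min_pos W \<le> 1"
  "eigenvalue W k \<Longrightarrow> k > 0 \<Longrightarrow> lambda_min_pos W \<le> k"
proof -
  have fin: "finite {k. eigenvalue W k \<and> k > 0}"
    using finite_eigenvalues[OF carrier] by (rule rev_finite_subset) auto
  have one: "1 \<in> {k. eigenvalue W k \<and> k > 0}" using eigenvalue_1 by simp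
  show "lambda_min_pos W > 0"
    using Min_in[OF fin] one unfolding lambda_min_pos_def by blast
  show "lambda_min_pos W \<le> 1"
    using Min_le[OF fin one] unfolding lambda_min_pos_def .
  show "lambda_min_pos W \<le> k" if "eigenvalue W k" "k > 0"
    using Min_le[OF fin] that unfolding lambda_min_pos_def by blast
qed

lemma perp_kernel:
  assumes "v \<in> perp" "app v = 0"
  shows "v = 0"
proof -
  obtain c where c: "\<forall>i<M. v i = c" using kernel_iff assms by (auto simp: perp_def)
  then have "real M * c = 0" using assms(1) by (simp add: perp_def)
  then have "c = 0" using M by simp
  then show ?thesis using c assms(1)
    by (auto simp: perp_def Rn_def topspace_Euclidean_space fun_eq_iff) (meson not_le)
qed

lemma closed_perp: "closed perp"
proof -
  have "closed {v :: rvec. (\<Sum>i<M. v i) = 0}"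
    by (intro closed_Collect_eq continuous_intros continuous_on_coord)
  then show ?thesis
    using closed_Int[OF closed_Rn] by (metis (no_types) Collect_conj_eq Collect_mem_eq perp_def)
qed

lemma perp_subspace:
  "u \<in> perp \<Longrightarrow> v \<in> perp \<Longrightarrow> u + v \<in> perp" "v \<in> perp \<Longrightarrow> c *\<^sub>R v \<in> perp"
  using Rn_add Rn_scaleR
  by (auto simp: perp_def sum.distrib) (simp add: scaleR_fun_def sum_distrib_left[symmetric])

text \<open>\<open>W\<close> preserves \<open>perp\<close>. The eigenvalue of the Rayleigh minimizer
  there is nonnegative by semi-definiteness and nonzero because kernel vectors in
  \<open>perp\<close> vanish, so it is one of those over which \<open>lambda_min_pos\<close> is
  taken.\<close>

lemma spectral_gap:
  assumes "u \<in> perp"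
  shows "lambda_min_pos W * rdot M u u \<le> rdot M u (app u)"
proof (cases "u = 0")
  case True
  then show ?thesis by (simp add: rdot_def)
next
  case False
  obtain v m where v: "v \<in> perp" "v \<noteq> 0" "app v = m *\<^sub>R v"
    and low: "\<And>u. u \<in> perp \<Longrightarrow> m * rdot M u u \<le> rdot M u (app u)"
    by (rule rayleigh_minimizer[of M "\<lambda>i j. W $$ (i, j)" perp u])
      (use assms False closed_perp app_in_perp perp_subspace sym_entries in \<open>auto simp: perp_def\<close>)
  have vR: "v \<in> Rn M" using v by (simp add: perp_def)
  have "rdot M v v > 0"
    using rdot_eq_0_iff[OF vR] nonneg[of v] v(2) by linarith
  moreover have "m * rdot M v v \<ge> 0" using psd[of v] by (simp add: v(3) expand)
  ultimately have "m \<ge> 0" by (simp add: zero_le_mult_iff)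
  moreover have "m \<noteq> 0" using perp_kernel[OF v(1)] v by auto
  ultimately have "lambda_min_pos W \<le> m"
    using lambda_min_pos(3) eigenvalue_mat_app[OF carrier vR v(2,3)] by simp
  then show ?thesis
    using low[OF assms] mult_right_mono[of "lambda_min_pos W" m "rdot M u u"] nonneg[of u] by linarith
qed

text \<open>\<open>W\<close> is singular, but adding 1 to every entry changes nothing on
  \<open>perp\<close> and removes the constants from the kernel; the ordinary inverse of that matrix
  serves.\<close>

lemma right_inverse:
  obtains B where "\<And>v. v \<in> perp \<Longrightarrow> app (mat_app M B v) = v" "\<And>v. v \<in> perp \<Longrightarrow> mat_app M B v \<in> perp"
proof -
  define a where "a = (\<lambda>i j. W $$ (i, j) + 1)"
  define A where "A = mat M M (\<lambda>(i, j). a i j)"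
  have A: "A \<in> carrier_mat M M" by (simp add: A_def)
  have Aa: "mat_app M (\<lambda>i j. A $$ (i, j)) v = mat_app M a v" for v
    by (auto simp: mat_app_def A_def fun_eq_iff intro!: sum.cong)
  have ma: "mat_app M a v i = app v i + (\<Sum>j<M. v j)" if "i < M" for v i
    using that by (simp add: mat_app_def a_def algebra_simps sum.distrib)
  \<comment> \<open>Since the columns of \<open>W\<close> sum to zero, the entries of the image sum
    to \<open>real M\<close> times the sum of \<open>v\<close>. This gives the injectivity and also
    that the inverse preserves \<open>perp\<close>.\<close>
  have sum0: "(\<Sum>j<M. v j) = 0" if "(\<Sum>i<M. mat_app M a v i) = 0" for v
  proof -
    have "(\<Sum>i<M. mat_app M a v i) = (\<Sum>i<M. app v i + (\<Sum>j<M. v j))"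
      using ma by simp
    also have "\<dots> = real M * (\<Sum>j<M. v j)" using app_sum by (simp add: sum.distrib)
    finally show ?thesis using that M by simp
  qed
  have "det A \<noteq> 0"
  proof
    assume "det A = 0"
    then obtain w where w: "w \<in> carrier_vec M" "w \<noteq> 0\<^sub>v M" "A *\<^sub>v w = 0\<^sub>v M"
      using det_0_iff_vec_prod_zero[OF A] by blast
    define v where "v = (\<lambda>i. if i < M then w $ i else 0)"
    have wv: "w = vec M v" using w(1) by (auto simp: v_def)
    have vR: "v \<in> Rn M" by (simp add: v_def Rn_def topspace_Euclidean_space)
    have z: "mat_app M a v i = 0" if "i < M" for i
      using w(3) that unfolding wv mult_vec_mat_app[OF A] Aa by (metis index_vec index_zero_vec(1))
    then have s: "(\<Sum>j<M. v j) = 0" using sum0 by simp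
    then have "app v = 0" using z ma by (auto simp: fun_eq_iff mat_app_def)
    then have "v = 0" using perp_kernel vR s by (simp add: perp_def)
    then show False using w(2) wv by auto
  qed
  from det_non_zero_imp_unit[OF A this, of "()"] obtain C where C: "C \<in> carrier_mat M M" "A * C = 1\<^sub>m M"
    by (auto simp: Units_def ring_mat_def)
  define B where "B = (\<lambda>i j. C $$ (i, j))"
  have inv: "mat_app M a (mat_app M B v) = v" if "v \<in> Rn M" for v
  proof -
    have "A *\<^sub>v (C *\<^sub>v vec M v) = vec M v"
      using assoc_mult_mat_vec[OF A C(1), of "vec M v"] C(2) by simp
    then have "vec M (mat_app M a (mat_app M B v)) = vec M v"
      unfolding mult_vec_mat_app[OF C(1)] mult_vec_mat_app[OF A] Aa B_def .
    then show ?thesis using that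
      by (auto simp: vec_eq_iff fun_eq_iff mat_app_def Rn_def topspace_Euclidean_space)
  qed
  show thesis
  proof (rule that[of B])
    fix v assume v: "v \<in> perp"
    then have vR: "v \<in> Rn M" and v0: "(\<Sum>i<M. v i) = 0" by (auto simp: perp_def)
    have s: "(\<Sum>j<M. mat_app M B v j) = 0" using sum0[of "mat_app M B v"] inv[OF vR] v0 by simp
    show "mat_app M B v \<in> perp" using s mat_app_in_Rn by (simp add: perp_def)
    have "app (mat_app M B v) i = v i" for i
    proof (cases "i < M")
      case True
      then show ?thesis using ma[OF True, of "mat_app M B v"] s inv[OF vR] by simp
    qed (use vR in \<open>auto simp: mat_app_def Rn_def topspace_Euclidean_space\<close>)
    then show "app (mat_app M B v) = v" by auto
  qed
qed

end

section \<open>The proximal step\<close>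

text \<open>Without a minimizer, each point has a neighbourhood on which \<open>f\<close> exceeds a
  value \<open>f (h x)\<close> taken in \<open>K\<close>. The smallest of the finitely many values
  belonging to a finite subcover would then have to exceed another of them.\<close>

lemma lsc_attains_inf:
  fixes f :: "'a::topological_space \<Rightarrow> ereal"
  assumes K: "compact K" "K \<noteq> {}"
    and lsc: "\<And>x t. x \<in> K \<Longrightarrow> t < f x \<Longrightarrow> \<exists>U. open U \<and> x \<in> U \<and> (\<forall>y\<in>U \<inter> K. t < f y)"
  shows "\<exists>x\<in>K. \<forall>y\<in>K. f x \<le> f y"
proof (rule ccontr)
  assume "\<not> (\<exists>x\<in>K. \<forall>y\<in>K. f x \<le> f y)"
  then have "\<forall>x\<in>K. \<exists>y\<in>K. f y < f x" by (meson not_le)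
  then obtain h where h: "\<And>x. x \<in> K \<Longrightarrow> h x \<in> K" "\<And>x. x \<in> K \<Longrightarrow> f (h x) < f x" by metis
  have "\<forall>x\<in>K. \<exists>U. open U \<and> x \<in> U \<and> (\<forall>y\<in>U \<inter> K. f (h x) < f y)"
    using lsc h(2) by blast
  then obtain U where U: "\<And>x. x \<in> K \<Longrightarrow> open (U x)" "\<And>x. x \<in> K \<Longrightarrow> x \<in> U x"
      "\<And>x y. x \<in> K \<Longrightarrow> y \<in> U x \<inter> K \<Longrightarrow> f (h x) < f y" by metis
  obtain C where C: "C \<subseteq> K" "finite C" "K \<subseteq> (\<Union>c\<in>C. U c)"
    using compactE_image[OF K(1), of K U] U(1,2) by blast
  have "C \<noteq> {}" using C(3) K(2) by blast
  then obtain c0 where c0: "c0 \<in> C" "\<And>c. c \<in> C \<Longrightarrow> f (h c0) \<le> f (h c)"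
    using C(2) ex_min_if_finite[of "(\<lambda>c. f (h c)) ` C"] by (auto simp: not_less)
  have "h c0 \<in> K" using c0 C(1) h(1) by blast
  then obtain c where c: "c \<in> C" "h c0 \<in> U c" using C(3) by blast
  then have "f (h c) < f (h c0)" using U(3)[of c "h c0"] C(1) \<open>h c0 \<in> K\<close> by blast
  then show False using c0(2)[OF c(1)] by simp
qed

lemma lsc_neighbourhood:
  assumes g: "proper_lsc_convex d g" and x: "x \<in> Rn d" and t: "t < g x"
  shows "\<exists>U. open U \<and> x \<in> U \<and> (\<forall>y\<in>U \<inter> Rn d. t < g y)"
proof -
  have "g x \<le> Liminf (atin (Euclidean_space d) x) g"
    using g x by (simp add: proper_lsc_convex_def)
  then have "eventually (\<lambda>y. t < g y) (atin (Euclidean_space d) x)"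
    using t by (simp add: le_Liminf_iff)
  then obtain V where V: "openin (Euclidean_space d) V" "x \<in> V" "\<forall>y\<in>V - {x}. t < g y"
    using x by (auto simp: eventually_atin Rn_def)
  then obtain U where U: "open U" "V = U \<inter> Rn d"
    by (auto simp: Euclidean_space_def openin_subtopology euclidean_product_topology
        Rn_def topspace_Euclidean_space)
  \<comment> \<open>The filter \<open>atin\<close> leaves out the point \<open>x\<close> itself;
    there the bound is the assumption \<open>t\<close>.\<close>
  show ?thesis
    using U V t by (intro exI[of _ U]) auto
qed

text \<open>One-sided first-order condition: only steps into a segment are admissible, so only the
  sign of the slope results.\<close>

lemma nonneg_of_small_steps:
  fixes a b :: real
  assumes "\<And>t. 0 < t \<Longrightarrow> t \<le> 1 \<Longrightarrow> 0 \<le> t * a + t\<^sup>2 * b"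
  shows "0 \<le> a"
proof (rule ccontr)
  assume "\<not> 0 \<le> a"
  then have a: "a < 0" by simp
  define s where "s = \<bar>a\<bar> + \<bar>b\<bar> + 1"
  define t where "t = - a / s"
  have s: "s > 0" "- a \<le> s" by (simp_all add: s_def)
  have "0 < t" unfolding t_def using a s(1) by (intro divide_pos_pos) auto
  moreover have "t \<le> 1" unfolding t_def pos_divide_le_eq[OF s(1)] using s(2) by simp
  ultimately have t: "0 < t" "t \<le> 1" by auto
  have "t * b < - a"
  proof -
    have "t * b \<le> t * \<bar>b\<bar>" using t by (intro mult_left_mono) auto
    also have "\<dots> = - a * (\<bar>b\<bar> / s)" by (simp add: t_def)
    also have "\<dots> < - a * 1" using a s by (intro mult_strict_left_mono) (auto simp: s_def)
    finally show ?thesis by simp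
  qed
  then have "t * (a + t * b) < 0" using t by (intro mult_pos_neg) auto
  then show False using assms[OF t] by (simp add: power2_eq_square algebra_simps)
qed

text \<open>\<open>arg_min\<close> says something only if a minimizer exists. Lower semicontinuity
  gives one on a ball, and the affine minorant plus the quadratic makes every value outside the ball
  no better than the one at \<open>x0\<close>.\<close>

lemma prox_coordinate_exists:
  assumes g: "proper_lsc_convex d g" and c: "c > 0"
    and x0: "x0 \<in> Rn d" "g x0 = ereal g0"
    and minor: "\<And>x. x \<in> Rn d \<Longrightarrow> ereal (g0 + rdot d s (x - x0)) \<le> g x"
  shows "\<exists>u\<in>Rn d. g u \<noteq> \<infinity> \<and> (\<forall>x\<in>Rn d. g x \<noteq> \<infinity> \<longrightarrow>
     real_of_ereal (g u) + c * rdot d (u - v) (u - v) \<le> real_of_ereal (g x) + c * rdot d (x - v) (x - v))"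
proof -
  interpret semi_inner "rdot d" by (rule rdot_semi_inner)
  define q where "q x = c * rdot d (x - v) (x - v)" for x
  define f where "f x = g x + ereal (q x)" for x
  \<comment> \<open>\<open>e\<close> is the slope at \<open>x0\<close> of the minorant plus the
    quadratic; beyond a distance of the length of \<open>e\<close> divided by \<open>c\<close>,
    quadratic growth outweighs it.\<close>
  define e where "e = (2 * c) *\<^sub>R (x0 - v) + s"
  define r where "r = sqrt (rdot d e e / c\<^sup>2)"
  define K where "K = {x \<in> Rn d. rdot d (x - x0) (x - x0) \<le> r\<^sup>2}"
  have r: "r \<ge> 0" "r\<^sup>2 = rdot d e e / c\<^sup>2" using nonneg[of e] by (auto simp: r_def)
  have sub: "x - x0 \<in> Rn d" if "x \<in> Rn d" for x
    using that x0(1) by (auto simp: Rn_def topspace_Euclidean_space)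
  have contd: "continuous_on UNIV (\<lambda>x. rdot d (x - w) (x - w))" for w
    unfolding rdot_def by (auto intro!: continuous_intros continuous_on_coord)
  have contq: "continuous_on UNIV q"
    unfolding q_def by (intro continuous_intros contd)
  have "compact K"
  proof -
    define R where "R = r + (\<Sum>i<d. \<bar>x0 i\<bar>)"
    have "\<bar>x i\<bar> \<le> R" if "x \<in> K" for x i
    proof -
      have "x - x0 \<in> Rn d" "rdot d (x - x0) (x - x0) \<le> r\<^sup>2"
        using that sub by (auto simp only: K_def mem_Collect_eq)
      from abs_coord_le[OF this r(1), of i] have "\<bar>(x - x0) i\<bar> \<le> r" .
      moreover have "\<bar>x0 i\<bar> \<le> (\<Sum>i<d. \<bar>x0 i\<bar>)"
      proof (cases "i < d")
        case True
        then show ?thesis by (intro member_le_sum) auto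
      next
        case False
        then show ?thesis using x0(1) by (auto simp: Rn_def topspace_Euclidean_space sum_nonneg)
      qed
      ultimately show ?thesis by (simp add: R_def)
    qed
    then have "K = {x. \<forall>i. \<bar>x i\<bar> \<le> R} \<inter> K" by auto
    moreover have "closed K"
    proof -
      have "closed {x. rdot d (x - x0) (x - x0) \<le> r\<^sup>2}"
        by (intro closed_Collect_le contd) auto
      from closed_Int[OF closed_Rn this] show ?thesis
        unfolding K_def by (simp add: Int_def)
    qed
    ultimately show ?thesis
      using compact_Int_closed[OF compact_box] by metis
  qed
  moreover have x0K: "x0 \<in> K" using x0(1) r(2) nonneg[of e] by (simp add: K_def zero_left)
  moreover have "\<exists>U. open U \<and> x \<in> U \<and> (\<forall>y\<in>U \<inter> K. t < f y)" if x: "x \<in> K" and t: "t < f x" for x t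
  proof -
    have xR: "x \<in> Rn d" using x by (simp add: K_def)
    have fin: "g y \<noteq> -\<infinity>" if "y \<in> Rn d" for y
      using g that by (simp add: proper_lsc_convex_def)
    show ?thesis
    proof (cases t)
      case (real t')
      have "ereal (t' - q x) < g x"
        using t real unfolding f_def by (cases "g x") auto
      then obtain s' where s': "ereal (t' - q x) < ereal s'" "ereal s' < g x"
        using ereal_dense2 by blast
      obtain U where U: "open U" "x \<in> U" "\<forall>y\<in>U \<inter> Rn d. ereal s' < g y"
        using lsc_neighbourhood[OF g xR s'(2)] by blast
      define V where "V = {y. t' - s' < q y}"
      have "open V" unfolding V_def by (intro open_Collect_less contq) auto
      moreover have "x \<in> V" using s'(1) by (simp add: V_def)
      moreover have "t < f y" if "y \<in> (U \<inter> V) \<inter> K" for y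
      proof -
        have "ereal s' < g y" "t' - s' < q y" using that U(3) by (auto simp: K_def V_def)
        then show ?thesis using real by (cases "g y") (auto simp: f_def)
      qed
      ultimately show ?thesis using U(1,2) by (intro exI[of _ "U \<inter> V"]) auto
    next
      case PInf
      then show ?thesis using t by simp
    next
      case MInf
      have "t < f y" if "y \<in> K" for y
        using fin[of y] that MInf by (cases "g y") (auto simp: f_def K_def)
      then show ?thesis by (intro exI[of _ UNIV]) auto
    qed
  qed
  ultimately obtain u where u: "u \<in> K" "\<And>y. y \<in> K \<Longrightarrow> f u \<le> f y"
    using lsc_attains_inf[of K f] by blast
  have uR: "u \<in> Rn d" using u(1) by (simp add: K_def)
  have fu0: "f u \<le> ereal (g0 + q x0)" using u(2)[OF x0K] x0(2) by (simp add: f_def)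
  have fr: "f x = ereal (real_of_ereal (g x) + q x)" if "x \<in> Rn d" "g x \<noteq> \<infinity>" for x
    using that g by (cases "g x") (auto simp: f_def proper_lsc_convex_def)
  have gu: "g u \<noteq> \<infinity>" using fu0 by (auto simp: f_def)
  have "real_of_ereal (g u) + q u \<le> real_of_ereal (g x) + q x" if x: "x \<in> Rn d" "g x \<noteq> \<infinity>" for x
  proof (cases "x \<in> K")
    case True
    then show ?thesis using u(2)[OF True] fr[OF x] fr[OF uR gu] by simp
  next
    case False
    have "real_of_ereal (g x) \<ge> g0 + rdot d s (x - x0)"
      using minor[OF x(1)] x(2) by (cases "g x") auto
    then have 1: "real_of_ereal (g x) + q x \<ge> g0 + rdot d s (x - x0) + q x" by simp
    have "rdot d (x - v) (x - v) = rdot d (x - x0) (x - x0) + 2 * rdot d (x0 - v) (x - x0) 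
        + rdot d (x0 - v) (x0 - v)"
      by (simp add: expand commute)
    then have "q x + rdot d s (x - x0) = c * rdot d (x - x0) (x - x0) + rdot d e (x - x0) + q x0"
      unfolding q_def e_def add_left scaleR_left by (simp add: algebra_simps)
    moreover have "- (2 * rdot d e (x - x0)) \<le> 1 / c * rdot d e e + rdot d (x - x0) (x - x0) / (1 / c)"
      using c by (intro young_minus) simp
    moreover have "1 / c * rdot d e e = c * r\<^sup>2" using c r(2) by (simp add: power2_eq_square)
    moreover have "c * r\<^sup>2 \<le> c * rdot d (x - x0) (x - x0)"
      using False x(1) c by (intro mult_left_mono) (auto simp: K_def)
    ultimately have "g0 + q x0 \<le> real_of_ereal (g x) + q x" using 1 by (simp add: algebra_simps)
    then show ?thesis using fu0 fr[OF uR gu] by simp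
  qed
  then show ?thesis using uR gu unfolding q_def by blast
qed

lemma ldot_semi_inner: "semi_inner (ldot d M)"
proof
  interpret semi_inner "rdot d" by (rule rdot_semi_inner)
  fix x y z :: lvec and c :: real
  show "ldot d M (x + y) z = ldot d M x z + ldot d M y z"
    by (simp add: ldot_def sum.distrib expand)
  show "ldot d M (c *\<^sub>R x) z = c * ldot d M x z"
  proof -
    have "(c *\<^sub>R x) m = c *\<^sub>R x m" for m by (simp add: scaleR_fun_def)
    then show ?thesis by (simp add: ldot_def sum_distrib_left scaleR_left)
  qed
  show "ldot d M x y = ldot d M y x"
    by (simp add: ldot_def commute)
  show "ldot d M x x \<ge> 0"
    by (simp add: ldot_def sum_nonneg nonneg)
qed

lemma rnorm_square: "(rnorm d x)\<^sup>2 = rdot d x x"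
  by (simp add: rnorm_def rdot_def L2_set_def sum_nonneg power2_eq_square[symmetric])

lemma lnorm_square: "(lnorm d M z)\<^sup>2 = ldot d M z z"
  unfolding lnorm_def ldot_def rnorm_square[symmetric] by (simp add: L2_set_def sum_nonneg)

lemma lifted_reg_eq:
  assumes g: "proper_lsc_convex d g" and u: "u \<in> Lifted d M" and M: "M \<ge> 1"
  shows "lifted_reg M g u = (if \<forall>m<M. g (u m) \<noteq> \<infinity> then ereal (1 / real M * (\<Sum>m<M. real_of_ereal (g (u m)))) else \<infinity>)"
proof -
  have fin: "g (u m) \<noteq> -\<infinity>" if "m < M" for m
    using g u that by (simp add: proper_lsc_convex_def Lifted_def)
  show ?thesis
  proof (cases "\<forall>m<M. g (u m) \<noteq> \<infinity>")
    case True
    have "(\<Sum>m<M. g (u m)) = (\<Sum>m<M. ereal (real_of_ereal (g (u m))))"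
      using True fin by (intro sum.cong refl) (auto simp: ereal_real)
    then show ?thesis using True by (simp add: lifted_reg_def)
  next
    case False
    then have "(\<Sum>m<M. g (u m)) = \<infinity>"
      by (subst sum_Pinfty) auto
    then show ?thesis using False M by (auto simp: lifted_reg_def)
  qed
qed

text \<open>Optimality of the proximal point is tested at the competitor \<open>lift M x0\<close>,
  and the minorant bounds the values of \<open>g\<close> at \<open>u\<close> from below. The result
  is monotonicity of subgradients between these two points, in which \<open>g\<close> no longer
  appears.\<close>

lemma prox_step_inequality:
  fixes v :: lvec
  assumes g: "proper_lsc_convex d g" and M: "M \<ge> 1" and \<eta>: "\<eta> > 0"
    and x0: "x0 \<in> Rn d" "g x0 = ereal g0"
    and minor: "\<And>x. x \<in> Rn d \<Longrightarrow> ereal (g0 + rdot d s (x - x0)) \<le> g x"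
  defines "u \<equiv> prox d M \<eta> g v"
  shows "u \<in> Lifted d M" and "ldot d M (u - v + \<eta> *\<^sub>R lift M ((1 / real M) *\<^sub>R s)) (u - lift M x0) \<le> 0"
proof -
  interpret semi_inner "ldot d M" by (rule ldot_semi_inner)
  define f where "f u = ereal \<eta> * lifted_reg M g u + ereal (1/2 * (lnorm d M (u - v))\<^sup>2)" for u
  define dm where "dm = {u \<in> Lifted d M. \<forall>m<M. g (u m) \<noteq> \<infinity>}"
  define G where "G u = (\<Sum>m<M. real_of_ereal (g (u m)))" for u
  define \<phi> where "\<phi> u = \<eta> / real M * G u + 1/2 * ldot d M (u - v) (u - v)" for u
  have f_dm: "f u = ereal (\<phi> u)" if "u \<in> dm" for u
    using that lifted_reg_eq[OF g, of u M] M
    by (simp add: f_def dm_def \<phi>_def G_def lnorm_square)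
  have f_inf: "f u = \<infinity>" if "u \<in> Lifted d M" "u \<notin> dm" for u
    using that lifted_reg_eq[OF g, of u M] M \<eta> by (simp add: f_def dm_def)
  \<comment> \<open>The lifted problem separates over the workers; dividing out
    \<open>\<eta> / real M\<close> leaves this weight on each squared distance.\<close>
  have "\<exists>um\<in>Rn d. g um \<noteq> \<infinity> \<and> (\<forall>x\<in>Rn d. g x \<noteq> \<infinity> \<longrightarrow>
     real_of_ereal (g um) + (real M / (2 * \<eta>)) * rdot d (um - v m) (um - v m)
       \<le> real_of_ereal (g x) + (real M / (2 * \<eta>)) * rdot d (x - v m) (x - v m))" for m
    by (rule prox_coordinate_exists[OF g _ x0 minor]) (use M \<eta> in auto)
  then obtain h where h: "\<And>m. h m \<in> Rn d" "\<And>m. g (h m) \<noteq> \<infinity>"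
    "\<And>m x. x \<in> Rn d \<Longrightarrow> g x \<noteq> \<infinity> \<Longrightarrow> 
     real_of_ereal (g (h m)) + (real M / (2 * \<eta>)) * rdot d (h m - v m) (h m - v m)
       \<le> real_of_ereal (g x) + (real M / (2 * \<eta>)) * rdot d (x - v m) (x - v m)"
    by metis
  define u0 where "u0 m = (if m < M then h m else 0)" for m
  have u0: "u0 \<in> dm" using h by (auto simp: u0_def dm_def Lifted_def)
  have \<phi>_sum: "\<phi> u = \<eta> / real M * (\<Sum>m<M. real_of_ereal (g (u m)) + (real M / (2 * \<eta>)) * rdot d (u m - v m) (u m - v m))" for u
    using M \<eta> unfolding sum.distrib sum_distrib_left[symmetric]
    by (simp add: \<phi>_def G_def ldot_def algebra_simps)
  have min0: "\<phi> u0 \<le> \<phi> x" if "x \<in> dm" for x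
    unfolding \<phi>_sum
  proof (intro mult_left_mono sum_mono)
    fix m assume "m \<in> {..<M}"
    then have "x m \<in> Rn d" "g (x m) \<noteq> \<infinity>" "u0 m = h m"
      using that by (auto simp: u0_def dm_def Lifted_def)
    then show "real_of_ereal (g (u0 m)) + real M / (2 * \<eta>) * rdot d (u0 m - v m) (u0 m - v m)
       \<le> real_of_ereal (g (x m)) + real M / (2 * \<eta>) * rdot d (x m - v m) (x m - v m)"
      using h(3) by metis
  qed (use \<eta> in auto)
  have "is_arg_min f (\<lambda>u. u \<in> Lifted d M) u0"
    unfolding is_arg_min_linorder
  proof safe
    show "u0 \<in> Lifted d M" using u0 by (simp add: dm_def)
    fix x assume "x \<in> Lifted d M"
    then show "f u0 \<le> f x"
      using min0[of x] f_dm[OF u0] f_dm[of x] f_inf[of x] by (cases "x \<in> dm") auto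
  qed
  then have "is_arg_min f (\<lambda>u. u \<in> Lifted d M) u"
    unfolding u_def prox_def f_def arg_min_def by (rule someI[of "is_arg_min _ _"])
  then have u: "u \<in> Lifted d M" "\<And>x. x \<in> Lifted d M \<Longrightarrow> f u \<le> f x"
    unfolding is_arg_min_linorder by auto
  show "u \<in> Lifted d M" by (rule u(1))
  have udm: "u \<in> dm"
  proof (rule ccontr)
    assume "u \<notin> dm"
    from f_inf[OF u(1) this] show False
      using u(2)[of u0] u0 f_dm[OF u0] by (simp add: dm_def)
  qed
  define x where "x = lift M x0"
  have xdm: "x \<in> dm" using x0 by (auto simp: dm_def x_def lift_def Lifted_def)
  have fin: "g y \<noteq> -\<infinity>" if "y \<in> Rn d" for y
    using g that by (simp add: proper_lsc_convex_def)
  have "0 \<le> \<eta> / real M * (G x - G u) + ldot d M (u - v) (x - u)"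
  \<comment> \<open>Minimality is used along the segment from \<open>u\<close> to \<open>x\<close>:
    convexity bounds the regularizer linearly in \<open>t\<close>, and the distance is quadratic in
    \<open>t\<close>.\<close>
  proof (rule nonneg_of_small_steps)
    fix t :: real assume t: "0 < t" "t \<le> 1"
    define y where "y = (1 - t) *\<^sub>R u + t *\<^sub>R x"
    have gy: "g (y m) \<noteq> \<infinity> \<and> real_of_ereal (g (y m)) \<le> (1 - t) * real_of_ereal (g (u m)) + t * real_of_ereal (g (x m))"
      and yR: "y m \<in> Rn d" if m: "m < M" for m
    proof -
      have R: "u m \<in> Rn d" "x m \<in> Rn d" "g (u m) \<noteq> \<infinity>" "g (x m) \<noteq> \<infinity>" 
        using m udm xdm by (auto simp: dm_def Lifted_def)
      have ym: "y m = (1 - t) *\<^sub>R u m + t *\<^sub>R x m" by (simp add: y_def scaleR_fun_def)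
      show yR: "y m \<in> Rn d" using R unfolding ym
        by (auto simp: Rn_def topspace_Euclidean_space scaleR_fun_def)
      have "g (y m) \<le> ereal (1 - t) * g (u m) + ereal t * g (x m)"
        unfolding ym using g R t by (simp add: proper_lsc_convex_def)
      then show "g (y m) \<noteq> \<infinity> \<and> real_of_ereal (g (y m)) \<le> (1 - t) * real_of_ereal (g (u m)) + t * real_of_ereal (g (x m))"
        using fin[OF R(1)] fin[OF R(2)] fin[OF yR] R(3,4)
        by (cases "g (u m)"; cases "g (x m)"; cases "g (y m)") auto
    qed
    have ydm: "y \<in> dm" using gy yR udm xdm
      by (auto simp: dm_def Lifted_def y_def scaleR_fun_def fun_eq_iff)
    have "\<phi> u \<le> \<phi> y" using u(2)[of y] ydm f_dm[OF udm] f_dm[OF ydm] by (simp add: dm_def)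
    moreover have "G y \<le> (1 - t) * G u + t * G x"
      unfolding G_def sum_distrib_left sum.distrib[symmetric] using gy by (intro sum_mono) auto
    then have "\<eta> / real M * G y \<le> \<eta> / real M * ((1 - t) * G u + t * G x)"
      using \<eta> by (intro mult_left_mono) auto
    moreover have "y - v = (u - v) + t *\<^sub>R (x - u)"
      by (simp add: y_def algebra_simps)
    then have "ldot d M (y - v) (y - v) = ldot d M (u - v) (u - v) + 2 * t * ldot d M (u - v) (x - u)
       + t\<^sup>2 * ldot d M (x - u) (x - u)"
      unfolding \<open>y - v = _\<close> add_left add_right scaleR_left scaleR_right commute[of "x - u" "u - v"]
      by (simp add: power2_eq_square algebra_simps)
    ultimately show "0 \<le> t * (\<eta> / real M * (G x - G u) + ldot d M (u - v) (x - u)) + t\<^sup>2 * (1/2 * ldot d M (x - u) (x - u))"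
      unfolding \<phi>_def by (simp add: algebra_simps)
  qed
  moreover have "G x - G u \<le> - real M * ldot d M (lift M ((1 / real M) *\<^sub>R s)) (u - x)"
  proof -
    interpret r: semi_inner "rdot d" by (rule rdot_semi_inner)
    have "real_of_ereal (g (x m)) - real_of_ereal (g (u m)) \<le> - rdot d s (u m - x m)" if m: "m < M" for m
    proof -
      have R: "u m \<in> Rn d" "g (u m) \<noteq> \<infinity>" "x m = x0"
        using m udm by (auto simp: dm_def Lifted_def x_def lift_def)
      show ?thesis using minor[OF R(1)] fin[OF R(1)] R x0(2) by (cases "g (u m)") auto
    qed
    then have "G x - G u \<le> (\<Sum>m<M. - rdot d s (u m - x m))"
      unfolding G_def sum_subtractf[symmetric] by (intro sum_mono) auto
    also have "\<dots> = - real M * ldot d M (lift M ((1 / real M) *\<^sub>R s)) (u - x)"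
      using M by (simp add: ldot_def lift_def r.scaleR_left sum_divide_distrib[symmetric] sum_negf)
    finally show ?thesis .
  qed
  then have "\<eta> / real M * (G x - G u) \<le> \<eta> / real M * (- real M * ldot d M (lift M ((1 / real M) *\<^sub>R s)) (u - x))"
    using \<eta> by (intro mult_left_mono) auto
  ultimately have "0 \<le> - \<eta> * ldot d M (lift M ((1 / real M) *\<^sub>R s)) (u - x) + ldot d M (u - v) (x - u)"
    using M by simp
  then show "ldot d M (u - v + \<eta> *\<^sub>R lift M ((1 / real M) *\<^sub>R s)) (u - lift M x0) \<le> 0"
    unfolding x_def[symmetric] using minus_right[of "u - v" "u - x"]
    by (simp add: add_left scaleR_left)
qed

section \<open>Mini-batch sampling\<close>

lemma set_pmf_of_lessThan: "n \<ge> 1 \<Longrightarrow> set_pmf (pmf_of_set {..<n}) = {..<n}" for n :: nat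
  by (rule set_pmf_of_set) (auto simp: lessThan_empty_iff)

lemma finite_sample_indices: "n \<ge> 1 \<Longrightarrow> finite (set_pmf (sample_indices M n b))"
  unfolding sample_indices_def
  by (subst set_Pi_pmf) (auto intro!: finite_PiE_dflt simp: set_pmf_of_lessThan)

lemma sample_indices_less:
  assumes "n \<ge> 1" "j \<in> set_pmf (sample_indices M n b)" "m < M" "l < b"
  shows "j (m, l) < n"
proof -
  have "j \<in> PiE_dflt ({..<M} \<times> {..<b}) 0 (set_pmf \<circ> (\<lambda>_. pmf_of_set {..<n}))"
    using assms(2) unfolding sample_indices_def by (subst (asm) set_Pi_pmf) auto
  then show ?thesis using assms by (auto simp: PiE_dflt_def set_pmf_of_lessThan)
qed

lemma expectation_sample:
  fixes h :: "nat \<Rightarrow> real"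
  assumes "n \<ge> 1" "m < M" "l < b"
  shows "measure_pmf.expectation (sample_indices M n b) (\<lambda>j. h (j (m, l))) = (\<Sum>i<n. h i) / real n"
proof -
  have "measure_pmf.expectation (sample_indices M n b) (\<lambda>j. h (j (m, l))) =
    measure_pmf.expectation (map_pmf (\<lambda>j. j (m, l)) (sample_indices M n b)) h"
    by simp
  also have "map_pmf (\<lambda>j. j (m, l)) (sample_indices M n b) = pmf_of_set {..<n}"
    unfolding sample_indices_def using assms by (subst Pi_pmf_component) auto
  also have "measure_pmf.expectation (pmf_of_set {..<n}) h = (\<Sum>i<n. h i) / real n"
    using assms(1) by (subst integral_pmf_of_set) (auto simp: lessThan_empty_iff)
  finally show ?thesis .
qed

lemma expectation_sample_product:
  fixes h h' :: "nat \<Rightarrow> real"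
  assumes "n \<ge> 1" "m < M" "l < b" "l' < b" "l \<noteq> l'"
  shows "measure_pmf.expectation (sample_indices M n b) (\<lambda>j. h (j (m, l)) * h' (j (m, l'))) =
     (\<Sum>i<n. h i) / real n * ((\<Sum>i<n. h' i) / real n)"
proof -
  define P where "P = sample_indices M n b"
  define X where "X = (\<lambda>x. if x = (m, l) then h else h')"
  have "prob_space.indep_vars (measure_pmf P) (\<lambda>_. count_space UNIV) (\<lambda>x f. f x) ({..<M} \<times> {..<b})"
    unfolding P_def sample_indices_def by (rule indep_vars_Pi_pmf) auto
  then have "prob_space.indep_vars (measure_pmf P) (\<lambda>_. count_space UNIV) (\<lambda>x f. f x) {(m, l), (m, l')}"
    by (rule prob_space.indep_vars_subset[OF measure_pmf.prob_space_axioms]) (use assms in auto)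
  then have "prob_space.indep_vars (measure_pmf P) (\<lambda>_. borel) (\<lambda>x f. X x (f x)) {(m, l), (m, l')}"
    by (rule prob_space.indep_vars_compose2[OF measure_pmf.prob_space_axioms]) auto
  then have "(\<integral>j. (\<Prod>x\<in>{(m, l), (m, l')}. X x (j x)) \<partial>P) = (\<Prod>x\<in>{(m, l), (m, l')}. \<integral>j. X x (j x) \<partial>P)"
    using finite_sample_indices[OF assms(1)]
    by (intro prob_space.indep_vars_lebesgue_integral[OF measure_pmf.prob_space_axioms] integrable_measure_pmf_finite) (auto simp: P_def)
  then show ?thesis
    using assms expectation_sample[of n m M _ b]
    by (simp add: X_def P_def)
qed

text \<open>Distinct draws are independent and centred, so only the \<open>b\<close> diagonal terms
  survive. This is the source of the gain 1/b from mini-batches.\<close>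

lemma expectation_square_sum_sample:
  fixes h :: "nat \<Rightarrow> real"
  assumes "n \<ge> 1" "m < M" "(\<Sum>i<n. h i) = 0"
  shows "measure_pmf.expectation (sample_indices M n b) (\<lambda>j. (\<Sum>l<b. h (j (m, l)))\<^sup>2) =
    real b * ((\<Sum>i<n. (h i)\<^sup>2) / real n)"
proof -
  define P where "P = sample_indices M n b"
  have int: "integrable P f" for f :: "_ \<Rightarrow> real"
    using finite_sample_indices[OF assms(1)] by (auto simp: P_def intro: integrable_measure_pmf_finite)
  have "measure_pmf.expectation P (\<lambda>j. (\<Sum>l<b. h (j (m, l)))\<^sup>2)
     = measure_pmf.expectation P (\<lambda>j. \<Sum>l<b. \<Sum>l'<b. h (j (m, l)) * h (j (m, l')))"
    by (simp add: power2_eq_square sum_product)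
  also have "\<dots> = (\<Sum>l<b. \<Sum>l'<b. measure_pmf.expectation P (\<lambda>j. h (j (m, l)) * h (j (m, l'))))"
    using int by simp
  also have "\<dots> = (\<Sum>l<b. \<Sum>l'<b. if l = l' then (\<Sum>i<n. (h i)\<^sup>2) / real n else 0)"
  proof (intro sum.cong refl)
    fix l l' assume l: "l \<in> {..<b}" "l' \<in> {..<b}"
    show "measure_pmf.expectation P (\<lambda>j. h (j (m, l)) * h (j (m, l'))) = (if l = l' then (\<Sum>i<n. (h i)\<^sup>2) / real n else 0)"
    proof (cases "l = l'")
      case True
      then show ?thesis
        using expectation_sample[OF assms(1,2), of l b "\<lambda>i. (h i)\<^sup>2"] l by (simp add: P_def power2_eq_square)
    next
      case False
      then show ?thesis
        using expectation_sample_product[OF assms(1,2), of l b l' h h] l assms(3) by (simp add: P_def)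
    qed
  qed
  also have "\<dots> = real b * ((\<Sum>i<n. (h i)\<^sup>2) / real n)"
    by simp
  finally show ?thesis by (simp add: P_def)
qed

text \<open>Both estimators of the algorithm differ from their means by an error of this kind, with
  \<open>H\<close> built from operator differences.\<close>

definition sample_noise :: "nat \<Rightarrow> nat \<Rightarrow> nat \<Rightarrow> (nat \<Rightarrow> nat \<Rightarrow> rvec) \<Rightarrow> (nat \<times> nat \<Rightarrow> nat) \<Rightarrow> lvec" where
  "sample_noise M n b H j = (\<lambda>m. if m < M then 
     (1 / real b) *\<^sub>R (\<Sum>l<b. H m (j (m, l))) - (1 / real n) *\<^sub>R (\<Sum>i<n. H m i) else 0)"

lemma sample_noise_coord:
  assumes "b \<ge> 1" "n \<ge> 1" "m < M"
  shows "sample_noise M n b H j m c = (\<Sum>l<b. H m (j (m, l)) c - (\<Sum>i<n. H m i c) / real n) / real b"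
  using assms by (simp add: sample_noise_def scaleR_fun_def sum_fun_apply sum_subtractf diff_divide_distrib)

lemma expectation_sample_noise_ldot:
  assumes b: "b \<ge> 1" and n: "n \<ge> 1"
  shows "measure_pmf.expectation (sample_indices M n b) (\<lambda>j. ldot d M (sample_noise M n b H j) v) = 0"
proof -
  have int: "integrable (sample_indices M n b) f" for f :: "_ \<Rightarrow> real"
    using finite_sample_indices[OF n] by (auto intro: integrable_measure_pmf_finite)
  have z: "measure_pmf.expectation (sample_indices M n b) (\<lambda>j. sample_noise M n b H j m c) = 0" if m: "m < M" for m c
  proof -
    have "measure_pmf.expectation (sample_indices M n b) (\<lambda>j. sample_noise M n b H j m c)
      = measure_pmf.expectation (sample_indices M n b) 
          (\<lambda>j. (\<Sum>l<b. H m (j (m, l)) c - (\<Sum>i<n. H m i c) / real n) / real b)"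
      using sample_noise_coord[OF b n m] by simp
    also have "\<dots> = (\<Sum>l<b. measure_pmf.expectation (sample_indices M n b) (\<lambda>j. H m (j (m, l)) c) - (\<Sum>i<n. H m i c) / real n) / real b"
      using int by simp
    also have "\<dots> = 0"
      using expectation_sample[OF n m, of _ b "\<lambda>i. H m i c"] by simp
    finally show ?thesis .
  qed
  have "measure_pmf.expectation (sample_indices M n b) (\<lambda>j. ldot d M (sample_noise M n b H j) v)
     = (\<Sum>m<M. \<Sum>c<d. measure_pmf.expectation (sample_indices M n b) (\<lambda>j. sample_noise M n b H j m c) * v m c)"
    unfolding ldot_def rdot_def using int by simp
  then show ?thesis using z by simp
qed

text \<open>In each coordinate the variance is at most the second moment, and second moments of
  operator differences are what average Lipschitz continuity controls.\<close>

lemma expectation_sample_noise_square: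
  assumes b: "b \<ge> 1" and n: "n \<ge> 1"
  shows "measure_pmf.expectation (sample_indices M n b)
      (\<lambda>j. ldot d M (sample_noise M n b H j) (sample_noise M n b H j))
    \<le> (\<Sum>m<M. (1 / real n) * (\<Sum>i<n. rdot d (H m i) (H m i))) / real b"
proof -
  have int: "integrable (sample_indices M n b) f" for f :: "_ \<Rightarrow> real"
    using finite_sample_indices[OF n] by (auto intro: integrable_measure_pmf_finite)
  have z: "measure_pmf.expectation (sample_indices M n b) (\<lambda>j. sample_noise M n b H j m c * sample_noise M n b H j m c)
      \<le> (1 / real n) * (\<Sum>i<n. H m i c * H m i c) / real b" if m: "m < M" for m c
  proof -
    define mu where "mu = (\<Sum>i<n. H m i c) / real n"
    define h where "h i = H m i c - mu" for i
    have h0: "(\<Sum>i<n. h i) = 0"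
      using n by (simp add: h_def sum_subtractf mu_def)
    have "(\<Sum>i<n. (h i)\<^sup>2) = (\<Sum>i<n. (H m i c)\<^sup>2) - 2 * mu * (\<Sum>i<n. H m i c) + real n * mu\<^sup>2"
      by (simp add: h_def power2_diff sum.distrib sum_subtractf sum_distrib_left algebra_simps)
    also have "(\<Sum>i<n. H m i c) = real n * mu" using n by (simp add: mu_def)
    finally have h2: "(\<Sum>i<n. (h i)\<^sup>2) \<le> (\<Sum>i<n. (H m i c)\<^sup>2)"
      using mult_nonneg_nonneg[of "real n" "mu\<^sup>2"] by (simp add: power2_eq_square mult_ac)
    have "measure_pmf.expectation (sample_indices M n b) (\<lambda>j. sample_noise M n b H j m c * sample_noise M n b H j m c)
      = measure_pmf.expectation (sample_indices M n b) (\<lambda>j. (\<Sum>l<b. h (j (m, l)))\<^sup>2 / (real b)\<^sup>2)"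
      unfolding sample_noise_coord[OF b n m] h_def mu_def
      by (simp add: power2_eq_square)
    also have "\<dots> = real b * ((\<Sum>i<n. (h i)\<^sup>2) / real n) / (real b)\<^sup>2"
      using expectation_square_sum_sample[OF n m h0, of b] by simp
    also have "\<dots> = (\<Sum>i<n. (h i)\<^sup>2) / real n / real b"
      using b by (simp add: power2_eq_square)
    also have "\<dots> \<le> (\<Sum>i<n. (H m i c)\<^sup>2) / real n / real b"
      using h2 by (intro divide_right_mono) auto
    finally show ?thesis by (simp add: power2_eq_square)
  qed
  have "measure_pmf.expectation (sample_indices M n b)
      (\<lambda>j. ldot d M (sample_noise M n b H j) (sample_noise M n b H j))
     = (\<Sum>m<M. \<Sum>c<d. measure_pmf.expectation (sample_indices M n b) (\<lambda>j. sample_noise M n b H j m c * sample_noise M n b H j m c))"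
    unfolding ldot_def rdot_def using int by simp
  also have "\<dots> \<le> (\<Sum>m<M. \<Sum>c<d. (1 / real n) * (\<Sum>i<n. H m i c * H m i c) / real b)"
    using z by (intro sum_mono) auto
  also have "\<dots> = (\<Sum>m<M. (1 / real n) * (\<Sum>i<n. rdot d (H m i) (H m i))) / real b"
    unfolding rdot_def sum_divide_distrib sum_distrib_left
    by (rule sum.cong[OF refl]) (rule sum.swap)
  finally show ?thesis .
qed

lemma expectation_bind_finite:
  fixes h :: "'b \<Rightarrow> real"
  assumes "finite (set_pmf p)" "\<And>x. x \<in> set_pmf p \<Longrightarrow> finite (set_pmf (f x))"
  shows "measure_pmf.expectation (p \<bind> f) h = measure_pmf.expectation p (\<lambda>x. measure_pmf.expectation (f x) h)"
proof -
  have "measure_pmf.expectation (p \<bind> f) h = (\<Sum>a\<in>set_pmf p. pmf p a *\<^sub>R measure_pmf.expectation (f a) h)"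
    by (rule pmf_expectation_bind) (use assms in auto)
  also have "\<dots> = measure_pmf.expectation p (\<lambda>x. measure_pmf.expectation (f x) h)"
    using assms(1) by (subst integral_measure_pmf_real[of "set_pmf p"]) (auto simp: mult.commute)
  finally show ?thesis .
qed

lemma expectation_mono_finite:
  fixes f g :: "'a \<Rightarrow> real"
  assumes "finite (set_pmf p)" "\<And>x. x \<in> set_pmf p \<Longrightarrow> f x \<le> g x"
  shows "measure_pmf.expectation p f \<le> measure_pmf.expectation p g"
  using assms by (intro integral_mono_AE integrable_measure_pmf_finite) (auto simp: AE_measure_pmf_iff)

section \<open>The gossip matrix on the lifted space\<close>

text \<open>Read across the workers, the Kronecker product becomes the scalar matrix acting on each
  coordinate separately, so the spectral bounds transfer by summing over coordinates.\<close>

definition column :: "lvec \<Rightarrow> nat \<Rightarrow> rvec" where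
  "column z c = (\<lambda>m. z m c)"

definition lifted_app :: "nat \<Rightarrow> (nat \<Rightarrow> nat \<Rightarrow> real) \<Rightarrow> lvec \<Rightarrow> lvec" where
  "lifted_app M a z = (\<lambda>m c. mat_app M a (column z c) m)"

lemma column_lifted_app: "column (lifted_app M a z) c = mat_app M a (column z c)"
  by (simp add: lifted_app_def column_def)

lemma column_add: "column (x + y) c = column x c + column y c"
  by (simp add: column_def fun_eq_iff)

lemma column_scaleR: "column (r *\<^sub>R x) c = r *\<^sub>R column x c"
  by (simp add: column_def scaleR_fun_def)

lemma column_eqI: "(\<And>c. column x c = column y c) \<Longrightarrow> x = y"
  by (auto simp: column_def fun_eq_iff)

lemma ldot_columns: "ldot d M x y = (\<Sum>c<d. rdot M (column x c) (column y c))"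
  unfolding ldot_def rdot_def column_def by (rule sum.swap)

lemma lifted_app_add: "lifted_app M a (x + y) = lifted_app M a x + lifted_app M a y"
  by (rule column_eqI) (simp add: column_lifted_app column_add mat_app_add)

lemma lifted_app_scaleR: "lifted_app M a (r *\<^sub>R x) = r *\<^sub>R lifted_app M a x"
  by (rule column_eqI) (simp add: column_lifted_app column_scaleR mat_app_scaleR)

lemma gossip_eq_lifted_app: "gossip M W z = lifted_app M (\<lambda>i j. W $$ (i, j)) z"
  by (auto simp: gossip_def lifted_app_def mat_app_def column_def fun_eq_iff scaleR_fun_def sum_fun_apply)

lemma gossip_diff: "gossip M W (x - y) = gossip M W x - gossip M W y"
  using lifted_app_add[of M _ "x - y" y] by (simp add: gossip_eq_lifted_app algebra_simps)

lemma gossip_scaleR: "gossip M W (r *\<^sub>R x) = r *\<^sub>R gossip M W x"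
  by (simp add: gossip_eq_lifted_app lifted_app_scaleR)

lemma Lifted_add: "x \<in> Lifted d M \<Longrightarrow> y \<in> Lifted d M \<Longrightarrow> x + y \<in> Lifted d M"
  by (simp add: Lifted_def Rn_def topspace_Euclidean_space)

lemma Lifted_scaleR: "x \<in> Lifted d M \<Longrightarrow> r *\<^sub>R x \<in> Lifted d M"
  by (auto simp: Lifted_def Rn_def topspace_Euclidean_space scaleR_fun_def)

lemma Lifted_diff: "x \<in> Lifted d M \<Longrightarrow> y \<in> Lifted d M \<Longrightarrow> x - y \<in> Lifted d M"
  by (simp add: Lifted_def Rn_def topspace_Euclidean_space)

lemma lift_in_Lifted: "x \<in> Rn d \<Longrightarrow> lift M x \<in> Lifted d M"
  by (simp add: Lifted_def lift_def)

lemma Lifted_iff_columns: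
  "x \<in> Lifted d M \<longleftrightarrow> (\<forall>c. column x c \<in> Rn M) \<and> (\<forall>c\<ge>d. column x c = 0)"
proof
  assume x: "x \<in> Lifted d M"
  have "x m c = 0" if "c \<ge> d" for m c
    using x that by (cases "m < M") (auto simp: Lifted_def Rn_def topspace_Euclidean_space)
  then show "(\<forall>c. column x c \<in> Rn M) \<and> (\<forall>c\<ge>d. column x c = 0)"
    using x by (auto simp: Lifted_def column_def Rn_def topspace_Euclidean_space)
next
  assume "(\<forall>c. column x c \<in> Rn M) \<and> (\<forall>c\<ge>d. column x c = 0)"
  then show "x \<in> Lifted d M"
    by (auto simp: Lifted_def column_def Rn_def topspace_Euclidean_space fun_eq_iff)
qed

text \<open>Testing orthogonality against lifted unit vectors reads off the worker sum of each
  coordinate.\<close>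

lemma consensus_perp_iff:
  "y \<in> consensus_perp d M \<longleftrightarrow> y \<in> Lifted d M \<and> (\<forall>c<d. (\<Sum>m<M. y m c) = 0)"
proof -
  have dot: "ldot d M y (lift M x) = (\<Sum>c<d. (\<Sum>m<M. y m c) * x c)" for x
    by (simp add: ldot_columns rdot_def column_def lift_def sum_distrib_right)
  show ?thesis
  proof safe
    assume y: "y \<in> consensus_perp d M"
    then show "y \<in> Lifted d M" by (simp add: consensus_perp_def)
    fix c assume c: "c < d"
    define x where "x = (\<lambda>i. if i = c then 1 else 0 :: real)"
    have "x \<in> Rn d" using c by (auto simp: x_def Rn_def topspace_Euclidean_space)
    then have "ldot d M y (lift M x) = 0"
      using y by (auto simp: consensus_perp_def consensus_def)
    then show "(\<Sum>m<M. y m c) = 0" using c by (simp add: dot x_def mult_delta_right)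
  next
    assume "y \<in> Lifted d M" "\<forall>c<d. (\<Sum>m<M. y m c) = 0"
    then show "y \<in> consensus_perp d M"
      by (auto simp: consensus_perp_def consensus_def dot)
  qed
qed

lemma ldot_consensus_perp: "y \<in> consensus_perp d M \<Longrightarrow> x \<in> Rn d \<Longrightarrow> ldot d M (lift M x) y = 0"
  using semi_inner.commute[OF ldot_semi_inner, of d M y "lift M x"]
  by (auto simp: consensus_perp_def consensus_def)

lemma consensus_perp_diff:
  "x \<in> consensus_perp d M \<Longrightarrow> y \<in> consensus_perp d M \<Longrightarrow> x - y \<in> consensus_perp d M"
  by (simp add: consensus_perp_iff Lifted_diff sum_subtractf)

lemma consensus_perp_scaleR: "x \<in> consensus_perp d M \<Longrightarrow> r *\<^sub>R x \<in> consensus_perp d M"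
  using Lifted_scaleR[of x d M r]
  by (auto simp: consensus_perp_iff) (simp add: scaleR_fun_def sum_distrib_left[symmetric])

context gossip_network
begin

lemma consensus_perp_columns:
  "y \<in> consensus_perp d M \<longleftrightarrow> (\<forall>c. column y c \<in> perp) \<and> (\<forall>c\<ge>d. column y c = 0)"
proof -
  have "(\<forall>c<d. (\<Sum>m<M. y m c) = 0) \<longleftrightarrow> (\<forall>c. (\<Sum>m<M. column y c m) = 0)" if "\<forall>c\<ge>d. column y c = 0"
  proof -
    have "y m c = 0" if "c \<ge> d" for m c
      using \<open>\<forall>c\<ge>d. column y c = 0\<close> that by (auto simp: column_def fun_eq_iff)
    then show ?thesis unfolding column_def by (metis not_le sum.neutral)
  qed
  then show ?thesis
    unfolding consensus_perp_iff Lifted_iff_columns perp_def by auto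
qed

lemma column_gossip: "column (gossip M W z) c = app (column z c)"
  by (simp add: gossip_eq_lifted_app column_lifted_app)

lemma gossip_in_perp:
  assumes "z \<in> Lifted d M" shows "gossip M W z \<in> consensus_perp d M"
proof -
  have "app 0 = 0" by (auto simp: mat_app_def)
  then show ?thesis using assms
    unfolding consensus_perp_columns column_gossip Lifted_iff_columns by (auto simp: app_in_perp)
qed

lemma gossip_commute: "ldot d M x (gossip M W y) = ldot d M (gossip M W x) y"
  unfolding ldot_columns column_gossip using app_commute by simp

lemma gossip_psd: "ldot d M x (gossip M W x) \<ge> 0"
  unfolding ldot_columns column_gossip by (intro sum_nonneg psd)

lemma gossip_le: "x \<in> Lifted d M \<Longrightarrow> ldot d M x (gossip M W x) \<le> ldot d M x x"
  unfolding ldot_columns column_gossip Lifted_iff_columns by (intro sum_mono rdot_app_le) auto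

lemma gossip_gap: "x \<in> consensus_perp d M \<Longrightarrow> 
    lambda_min_pos W * ldot d M x x \<le> ldot d M x (gossip M W x)"
  unfolding ldot_columns column_gossip consensus_perp_columns sum_distrib_left
  by (intro sum_mono spectral_gap) auto

section \<open>The pseudo-inverse form for dual variables\<close>

definition inv_entries :: "nat \<Rightarrow> nat \<Rightarrow> real" where
  "inv_entries = (SOME B. \<forall>v\<in>perp. app (mat_app M B v) = v \<and> mat_app M B v \<in> perp)"

lemma inv_entries: "v \<in> perp \<Longrightarrow> app (mat_app M inv_entries v) = v" "v \<in> perp \<Longrightarrow> mat_app M inv_entries v \<in> perp"
proof -
  have "\<exists>B. \<forall>v\<in>perp. app (mat_app M B v) = v \<and> mat_app M B v \<in> perp"
    using right_inverse by metis
  from someI_ex[OF this] show "v \<in> perp \<Longrightarrow> app (mat_app M inv_entries v) = v" "v \<in> perp \<Longrightarrow> mat_app M inv_entries v \<in> perp"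
    unfolding inv_entries_def by auto
qed

abbreviation gossip_inv :: "lvec \<Rightarrow> lvec" where
  "gossip_inv \<equiv> lifted_app M inv_entries"

lemma gossip_inv:
  assumes "y \<in> consensus_perp d M"
  shows "gossip M W (gossip_inv y) = y" and "gossip_inv y \<in> consensus_perp d M"
proof -
  have "mat_app M inv_entries 0 = 0" by (auto simp: mat_app_def)
  then show "gossip_inv y \<in> consensus_perp d M"
    using assms inv_entries(2) by (auto simp: consensus_perp_columns column_lifted_app)
  show "gossip M W (gossip_inv y) = y"
    by (rule column_eqI)
      (use assms inv_entries(1) in \<open>auto simp: consensus_perp_columns column_gossip column_lifted_app\<close>)
qed

text \<open>On the orthogonal complement of the consensus space this is the inner product induced by the
  pseudo-inverse of the gossip matrix; composing with the gossip matrix makes it semi-definite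
  everywhere.\<close>

definition dual_dot :: "nat \<Rightarrow> lvec \<Rightarrow> lvec \<Rightarrow> real" where
  "dual_dot d u v = ldot d M (gossip M W (gossip_inv u)) (gossip_inv v)"

lemma dual_dot_semi_inner: "semi_inner (dual_dot d)"
proof -
  interpret l: semi_inner "ldot d M" by (rule ldot_semi_inner)
  show ?thesis
  proof
    fix x y z :: lvec and c :: real
    show "dual_dot d (x + y) z = dual_dot d x z + dual_dot d y z"
      by (simp add: dual_dot_def lifted_app_add gossip_eq_lifted_app l.add_left)
    show "dual_dot d (c *\<^sub>R x) z = c * dual_dot d x z"
      by (simp add: dual_dot_def lifted_app_scaleR gossip_scaleR l.scaleR_left)
    show "dual_dot d x y = dual_dot d y x"
      unfolding dual_dot_def by (metis gossip_commute l.commute)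
    show "dual_dot d x x \<ge> 0"
      using gossip_psd by (simp add: dual_dot_def gossip_commute[symmetric])
  qed
qed

lemma gossip_form: "semi_inner (\<lambda>x y. ldot d M x (gossip M W y))"
proof -
  interpret l: semi_inner "ldot d M" by (rule ldot_semi_inner)
  show ?thesis
  proof
    fix x y z :: lvec and c :: real
    show "ldot d M x (gossip M W y) = ldot d M y (gossip M W x)"
      by (metis gossip_commute l.commute)
  qed (simp_all add: l.add_left l.scaleR_left gossip_psd)
qed

text \<open>Cauchy-Schwarz for the gossip form between \<open>v\<close> and its preimage, followed
  by the upper eigenvalue bound 1 on the factor with \<open>v\<close>.\<close>

lemma dual_dot_ge:
  assumes "v \<in> consensus_perp d M"
  shows "ldot d M v v \<le> dual_dot d v v"
proof -
  interpret l: semi_inner "ldot d M" by (rule ldot_semi_inner)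
  interpret f: semi_inner "\<lambda>x y. ldot d M x (gossip M W y)" by (rule gossip_form)
  define x where "x = gossip_inv v"
  have v: "gossip M W x = v" using gossip_inv(1)[OF assms] by (simp add: x_def)
  have q: "dual_dot d v v = ldot d M x v"
    using l.commute by (simp add: dual_dot_def x_def[symmetric] v)
  have "(ldot d M x (gossip M W v))\<^sup>2 \<le> ldot d M x (gossip M W x) * ldot d M v (gossip M W v)"
    by (rule f.cauchy_schwarz)
  also have "ldot d M x (gossip M W v) = ldot d M v v" by (simp add: gossip_commute v)
  also have "ldot d M x (gossip M W x) = ldot d M x v" by (simp add: v)
  also have "ldot d M x v * ldot d M v (gossip M W v) \<le> ldot d M x v * ldot d M v v"
    using gossip_le[of v d] assms f.nonneg[of x] by (intro mult_left_mono) (auto simp: consensus_perp_def v)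
  finally have "ldot d M v v * ldot d M v v \<le> ldot d M x v * ldot d M v v"
    by (simp add: power2_eq_square)
  then show ?thesis
    using l.nonneg[of v] f.nonneg[of x] unfolding q v by (cases "ldot d M v v = 0") (auto simp: mult_le_cancel_right)
qed

text \<open>Cauchy-Schwarz for the ordinary product between \<open>v\<close> and its preimage, whose
  length the spectral gap controls.\<close>

lemma dual_dot_le:
  assumes "v \<in> consensus_perp d M"
  shows "dual_dot d v v \<le> 1 / lambda_min_pos W * ldot d M v v"
proof -
  interpret l: semi_inner "ldot d M" by (rule ldot_semi_inner)
  define x where "x = gossip_inv v"
  have v: "gossip M W x = v" and x: "x \<in> consensus_perp d M" 
    using gossip_inv[OF assms] by (auto simp: x_def)
  define q where "q = ldot d M x v"
  have q: "dual_dot d v v = q"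
    using l.commute by (simp add: dual_dot_def x_def[symmetric] v q_def)
  have q0: "q \<ge> 0" using gossip_psd[of d x] by (simp add: v q_def)
  have "lambda_min_pos W * ldot d M x x \<le> q"
    using gossip_gap[OF x] by (simp add: v q_def)
  then have 1: "ldot d M x x \<le> q / lambda_min_pos W"
    using lambda_min_pos(1) by (simp add: field_simps)
  have "q * q \<le> ldot d M x x * ldot d M v v"
    using l.cauchy_schwarz[of x v] by (simp add: q_def power2_eq_square)
  also have "\<dots> \<le> q / lambda_min_pos W * ldot d M v v"
    using 1 l.nonneg by (intro mult_right_mono) auto
  finally have "q * q \<le> q * (1 / lambda_min_pos W * ldot d M v v)" by simp
  moreover have "0 \<le> 1 / lambda_min_pos W * ldot d M v v"
    using lambda_min_pos(1) l.nonneg by simp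
  ultimately show ?thesis using q0 unfolding q
    by (cases "q = 0") (simp, metis less_eq_real_def mult_le_cancel_left_pos)
qed

text \<open>The form undoes one gossip application, so the dual update, a multiple of a gossip
  vector, pairs like an ordinary inner product. This provides \<open>upd\<close> of the one-step
  estimate.\<close>

lemma dual_dot_gossip:
  assumes "x \<in> Lifted d M" "v \<in> consensus_perp d M"
  shows "dual_dot d (gossip M W x) v = ldot d M x v"
  using gossip_inv(1)[OF gossip_in_perp[OF assms(1)]] gossip_inv(1)[OF assms(2)]
  by (simp add: dual_dot_def gossip_commute[symmetric])

end

section \<open>Descent of the potential\<close>

lemma LiftedD: "z \<in> Lifted d M \<Longrightarrow> m < M \<Longrightarrow> z m \<in> Rn d"
  by (simp add: Lifted_def)

lemma Lipschitz_rdot: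
  assumes "Lipschitz d L f" "u \<in> Rn d" "v \<in> Rn d"
  shows "rdot d (f u - f v) (f u - f v) \<le> L\<^sup>2 * rdot d (u - v) (u - v)"
proof -
  have "rnorm d (f u - f v) \<le> L * rnorm d (u - v)"
    using assms by (simp add: Lipschitz_def)
  then have "(rnorm d (f u - f v))\<^sup>2 \<le> (L * rnorm d (u - v))\<^sup>2"
    by (intro power_mono) (auto simp: rnorm_def)
  then show ?thesis by (simp add: rnorm_square power_mult_distrib)
qed

lemma mean_op_in_Rn:
  assumes "operators_on d M n F" "m < M" "u \<in> Rn d"
  shows "mean_op n (F m) u \<in> Rn d"
  using assms by (auto simp: mean_op_def operators_on_def intro!: Rn_scaleR Rn_sum)

text \<open>The stepsizes enter through inequalities implied by their formulas, and \<open>p\<close>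
  also takes the place of \<gamma>. The three lower bounds on \<alpha> serve the primal, the dual
  and the anchor term, in this order.\<close>

locale decentralized_vi = gossip_network M E W for M E W +
  fixes d n :: nat and F :: "nat \<Rightarrow> nat \<Rightarrow> rvec \<Rightarrow> rvec" and g :: "rvec \<Rightarrow> ereal"
    and L Lbar \<mu> :: real and b :: nat and p \<alpha> \<beta> \<eta> \<theta> \<kappa> :: real and zs :: rvec
  assumes n: "n \<ge> 1" and b: "b \<ge> 1"
    and ops: "operators_on d M n F"
    and g: "proper_lsc_convex d g"
    and lip: "\<And>m. m < M \<Longrightarrow> Lipschitz d L (mean_op n (F m))"
    and mono: "\<And>m. m < M \<Longrightarrow> strongly_monotone d \<mu> (mean_op n (F m))"
    and avg: "\<And>m. m < M \<Longrightarrow> average_Lipschitz d n Lbar (F m)"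
    and sol: "VI_solution d M n F g zs"
    and \<kappa>: "\<kappa> = 1 / lambda_min_pos W"
    and p: "0 < p" "p \<le> 1/8"
    and pos: "0 < \<mu>" "0 < L" "0 < \<eta>" "0 < \<theta>" "0 < \<beta>"
    and \<eta>L: "\<eta> * L \<le> 1/16" and \<eta>\<mu>: "\<eta> * \<mu> \<le> 1/16"
    and \<eta>Lbar: "16 * \<eta>\<^sup>2 * Lbar\<^sup>2 \<le> p * real b"
    and \<beta>L: "\<beta> * L\<^sup>2 \<le> \<mu> / 4" and \<beta>Lbar: "4 * \<eta> * \<beta> * Lbar\<^sup>2 \<le> real b * p"
    and \<theta>\<beta>: "\<theta> * \<beta> \<le> 1/2" and \<eta>\<theta>: "\<eta> * \<theta> \<le> 1/16"
    and \<alpha>: "\<alpha> \<le> 1" "1 - \<mu> * \<eta> / 4 \<le> \<alpha>" "1 - \<beta> * \<theta> / \<kappa> \<le> \<alpha>" 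
      "1 - p * \<eta> * \<mu> / (2 * p + \<eta> * \<mu>) \<le> \<alpha>"
begin

sublocale l: semi_inner "ldot d M" by (rule ldot_semi_inner)

abbreviation Fhat :: "lvec \<Rightarrow> lvec" where "Fhat \<equiv> lifted_op M n F"
abbreviation N :: "lvec \<Rightarrow> real" where "N x \<equiv> ldot d M x x"
abbreviation Q :: "lvec \<Rightarrow> real" where "Q x \<equiv> dual_dot d x x"
abbreviation Lft :: "lvec set" where "Lft \<equiv> Lifted d M"
abbreviation Perp :: "lvec set" where "Perp \<equiv> consensus_perp d M"

definition zst :: lvec where "zst = lift M zs"
definition S :: rvec where "S = (\<Sum>m<M. mean_op n (F m) zs)"
text \<open>Minus this is a subgradient of the lifted regularizer at \<open>zst\<close>; as a
  consensus vector it is also orthogonal to differences of dual variables.\<close>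

definition Sl :: lvec where "Sl = lift M ((1 / real M) *\<^sub>R S)"
definition yst :: lvec where "yst = Fhat zst - Sl"

lemma \<kappa>_pos: "\<kappa> > 0" using \<kappa> lambda_min_pos(1) by simp

lemma \<alpha>_ge: "\<alpha> \<ge> 3/4" using \<alpha>(2) \<eta>\<mu> by (simp add: mult.commute)

lemma zs: "zs \<in> Rn d" using sol by (simp add: VI_solution_def)

lemma zst_in: "zst \<in> Lft" using zs by (simp add: zst_def lift_in_Lifted)

lemma S_in: "S \<in> Rn d" unfolding S_def by (intro Rn_sum mean_op_in_Rn[OF ops] zs) auto

lemma Fhat_in: "z \<in> Lft \<Longrightarrow> Fhat z \<in> Lft"
  using mean_op_in_Rn[OF ops] by (auto simp: lifted_op_def Lifted_def)

lemma yst_in: "yst \<in> Perp"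
proof -
  have "Sl \<in> Lft" unfolding Sl_def by (intro lift_in_Lifted Rn_scaleR S_in)
  moreover have "(\<Sum>m<M. yst m c) = 0" for c
    using M by (simp add: yst_def zst_def Sl_def lift_def lifted_op_def sum_subtractf scaleR_fun_def 
        S_def sum_fun_apply)
  ultimately show ?thesis
    using Fhat_in[OF zst_in] by (simp add: consensus_perp_iff yst_def Lifted_diff)
qed

lemma Fhat_lip:
  assumes "u \<in> Lft" "v \<in> Lft"
  shows "N (Fhat u - Fhat v) \<le> L\<^sup>2 * N (u - v)"
  unfolding ldot_def sum_distrib_left
  by (intro sum_mono) (use Lipschitz_rdot[OF lip] assms in \<open>auto simp: lifted_op_def LiftedD\<close>)

lemma Fhat_mono:
  assumes "u \<in> Lft" "v \<in> Lft"
  shows "ldot d M (Fhat u - Fhat v) (u - v) \<ge> \<mu> * N (u - v)"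
  unfolding ldot_def sum_distrib_left
  by (intro sum_mono) (use mono assms in \<open>auto simp: lifted_op_def LiftedD strongly_monotone_def rnorm_square\<close>)

text \<open>The variational inequality is itself the statement that \<open>- S\<close> is a
  subgradient of \<open>g\<close> at \<open>zs\<close>; finiteness of \<open>g zs\<close> allows the
  rearrangement in \<open>ereal\<close>.\<close>

lemma minorant: 
  obtains g0 where "g zs = ereal g0" "\<And>x. x \<in> Rn d \<Longrightarrow> ereal (g0 + rdot d (- S) (x - zs)) \<le> g x"
proof -
  have fin: "g x \<noteq> -\<infinity>" if "x \<in> Rn d" for x
    using g that by (simp add: proper_lsc_convex_def)
  have "g zs \<noteq> \<infinity>" using sol by (simp add: VI_solution_def)
  then obtain g0 where g0: "g zs = ereal g0" using fin[OF zs] by (cases "g zs") auto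
  have "ereal (g0 + rdot d (- S) (x - zs)) \<le> g x" if x: "x \<in> Rn d" for x
  proof -
    interpret r: semi_inner "rdot d" by (rule rdot_semi_inner)
    have "ereal (rdot d S (x - zs)) + g x - g zs \<ge> 0"
      using sol x by (simp add: VI_solution_def S_def)
    then show ?thesis using fin[OF x] by (cases "g x") (auto simp: g0 r.minus_left)
  qed
  then show thesis using that g0 by blast
qed

lemma prox_in: "prox d M \<eta> g v \<in> Lft"
  and prox_ineq: "ldot d M (prox d M \<eta> g v - v - \<eta> *\<^sub>R Sl) (prox d M \<eta> g v - zst) \<le> 0"
proof -
  obtain g0 where g0: "g zs = ereal g0" "\<And>x. x \<in> Rn d \<Longrightarrow> ereal (g0 + rdot d (- S) (x - zs)) \<le> g x"
    by (rule minorant) blast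
  note prox_step_inequality[OF g M pos(3) zs g0, of v]
  moreover have "lift M ((1 / real M) *\<^sub>R (- S)) = - Sl"
    by (auto simp: lift_def Sl_def fun_eq_iff)
  ultimately show "prox d M \<eta> g v \<in> Lft" 
    "ldot d M (prox d M \<eta> g v - v - \<eta> *\<^sub>R Sl) (prox d M \<eta> g v - zst) \<le> 0"
    by (simp_all add: zst_def)
qed

section \<open>The two estimators and one iteration\<close>

definition mixed_est :: "lvec \<Rightarrow> lvec \<Rightarrow> lvec \<Rightarrow> (nat \<times> nat \<Rightarrow> nat) \<Rightarrow> lvec" where
  "mixed_est z zm wm j = (1 / real b) *\<^sub>R (\<Sum>l<b.
               (sampled_op M F j l z - sampled_op M F j l wm)
               + \<alpha> *\<^sub>R (sampled_op M F j l z - sampled_op M F j l zm)) + Fhat wm"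

definition next_z :: "lvec \<Rightarrow> lvec \<Rightarrow> lvec \<Rightarrow> lvec \<Rightarrow> lvec \<Rightarrow> lvec \<Rightarrow> (nat \<times> nat \<Rightarrow> nat) \<Rightarrow> lvec" where
  "next_z z zm w wm y ym j = prox d M \<eta> g (z + p *\<^sub>R (w - z) 
     - \<eta> *\<^sub>R (mixed_est z zm wm j - (y + \<alpha> *\<^sub>R (y - ym))))"

definition half_est :: "lvec \<Rightarrow> lvec \<Rightarrow> (nat \<times> nat \<Rightarrow> nat) \<Rightarrow> lvec" where
  "half_est zp w j = (1 / real b) *\<^sub>R (\<Sum>l<b. sampled_op M F j l zp - sampled_op M F j l w) + Fhat w"

definition next_y :: "lvec \<Rightarrow> lvec \<Rightarrow> lvec \<Rightarrow> (nat \<times> nat \<Rightarrow> nat) \<Rightarrow> lvec" where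
  "next_y zp w y j = y - \<theta> *\<^sub>R gossip M W (zp - \<beta> *\<^sub>R (half_est zp w j - y))"

abbreviation the_step :: "state \<Rightarrow> state pmf" where
  "the_step \<equiv> step d M n F g W \<eta> \<theta> \<alpha> \<beta> p b p"

lemma step_eq:
  "the_step (z, zm, w, wm, y, ym) = do {
     j \<leftarrow> sample_indices M n b;
     jh \<leftarrow> sample_indices M n b;
     coin \<leftarrow> bernoulli_pmf p;
     return_pmf (next_z z zm w wm y ym j, z, if coin then z else w, w,
       next_y (next_z z zm w wm y ym j) w y jh, y)}"
  by (simp add: step_def next_z_def mixed_est_def next_y_def half_est_def Let_def)

text \<open>In the mean the sampled values at \<open>wm\<close> cancel against
  \<open>Fhat wm\<close>, so the estimator is centred at the exact extrapolated value.\<close>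

lemma mixed_noise: "mixed_est z zm wm j - (Fhat z + \<alpha> *\<^sub>R (Fhat z - Fhat zm)) =
   sample_noise M n b (\<lambda>m i. F m i (z m) - F m i (wm m) + \<alpha> *\<^sub>R (F m i (z m) - F m i (zm m))) j"
proof (intro ext)
  fix m c
  show "(mixed_est z zm wm j - (Fhat z + \<alpha> *\<^sub>R (Fhat z - Fhat zm))) m c =
   sample_noise M n b (\<lambda>m i. F m i (z m) - F m i (wm m) + \<alpha> *\<^sub>R (F m i (z m) - F m i (zm m))) j m c"
    by (cases "m < M")
     (simp_all add: mixed_est_def sample_noise_def sampled_op_def lifted_op_def mean_op_def sum_fun_apply
      scaleR_fun_def sum.distrib sum_subtractf sum_distrib_left[symmetric] algebra_simps)
qed

lemma half_noise: "half_est zp w j - Fhat zp =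
   sample_noise M n b (\<lambda>m i. F m i (zp m) - F m i (w m)) j"
proof (intro ext)
  fix m c
  show "(half_est zp w j - Fhat zp) m c = sample_noise M n b (\<lambda>m i. F m i (zp m) - F m i (w m)) j m c"
    by (cases "m < M")
     (simp_all add: half_est_def sample_noise_def sampled_op_def lifted_op_def mean_op_def sum_fun_apply
      scaleR_fun_def sum.distrib sum_subtractf sum_distrib_left[symmetric] algebra_simps)
qed

lemma F_in: "m < M \<Longrightarrow> i < n \<Longrightarrow> z \<in> Lft \<Longrightarrow> F m i (z m) \<in> Rn d"
  using ops LiftedD[of z d M m] by (auto simp: operators_on_def Pi_iff)

lemma half_est_in:
  assumes "zp \<in> Lft" "w \<in> Lft" "j \<in> set_pmf (sample_indices M n b)"
  shows "half_est zp w j \<in> Lft"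
proof -
  have "sampled_op M F j l zp - sampled_op M F j l w \<in> Lft" if "l < b" for l
    using F_in sample_indices_less[OF n assms(3)] assms that
    by (auto simp: Lifted_def sampled_op_def intro!: Rn_diff)
  then have "(\<Sum>l<b. sampled_op M F j l zp - sampled_op M F j l w) \<in> Lft"
    by (auto simp: Lifted_def sum_fun_apply intro!: Rn_sum)
  then show ?thesis using Fhat_in assms unfolding half_est_def by (intro Lifted_add Lifted_scaleR)
qed

lemma next_y_in:
  assumes "zp \<in> Lft" "w \<in> Lft" "y \<in> Perp" "j \<in> set_pmf (sample_indices M n b)"
  shows "next_y zp w y j \<in> Perp"
proof -
  have "y \<in> Lft" using assms(3) by (simp add: consensus_perp_def)
  then have "zp - \<beta> *\<^sub>R (half_est zp w j - y) \<in> Lft"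
    using assms half_est_in by (intro Lifted_diff Lifted_scaleR) auto
  then show ?thesis
    unfolding next_y_def by (intro consensus_perp_diff consensus_perp_scaleR gossip_in_perp assms)
qed

lemma avg_rdot:
  assumes "m < M" "u \<in> Rn d" "v \<in> Rn d"
  shows "1 / real n * (\<Sum>i<n. rdot d (F m i u - F m i v) (F m i u - F m i v)) \<le> Lbar\<^sup>2 * rdot d (u - v) (u - v)"
  using avg[OF assms(1)] assms by (simp add: average_Lipschitz_def rnorm_square)

lemma half_noise_square:
  assumes "zp \<in> Lft" "w \<in> Lft"
  shows "measure_pmf.expectation (sample_indices M n b) (\<lambda>j. N (half_est zp w j - Fhat zp))
      \<le> Lbar\<^sup>2 * N (zp - w) / real b"
proof -
  have "(\<Sum>m<M. 1 / real n * (\<Sum>i<n. rdot d (F m i (zp m) - F m i (w m)) (F m i (zp m) - F m i (w m)))) 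
      \<le> (\<Sum>m<M. Lbar\<^sup>2 * rdot d (zp m - w m) (zp m - w m))"
    by (intro sum_mono avg_rdot) (use assms in \<open>auto simp: LiftedD\<close>)
  also have "\<dots> = Lbar\<^sup>2 * N (zp - w)" by (simp add: ldot_def sum_distrib_left)
  finally have *: "(\<Sum>m<M. 1 / real n * (\<Sum>i<n. rdot d (F m i (zp m) - F m i (w m)) (F m i (zp m) - F m i (w m)))) 
      \<le> Lbar\<^sup>2 * N (zp - w)" .
  show ?thesis
    unfolding half_noise
    by (rule order_trans[OF expectation_sample_noise_square[OF b n] divide_right_mono[OF *]]) simp
qed

text \<open>The factor 2 comes from splitting the anchor difference from the extrapolation
  difference, whose coefficient \<alpha> is at most 1.\<close>

lemma mixed_noise_square:
  assumes "z \<in> Lft" "zm \<in> Lft" "wm \<in> Lft"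
  shows "measure_pmf.expectation (sample_indices M n b) 
      (\<lambda>j. N (mixed_est z zm wm j - (Fhat z + \<alpha> *\<^sub>R (Fhat z - Fhat zm))))
      \<le> 2 * Lbar\<^sup>2 * (N (z - wm) + N (z - zm)) / real b"
proof -
  interpret r: semi_inner "rdot d" by (rule rdot_semi_inner)
  define D where "D m i = F m i (z m) - F m i (wm m)" for m i
  define D' where "D' m i = F m i (z m) - F m i (zm m)" for m i
  have "(\<Sum>m<M. 1 / real n * (\<Sum>i<n. rdot d (D m i + \<alpha> *\<^sub>R D' m i) (D m i + \<alpha> *\<^sub>R D' m i)))
      \<le> (\<Sum>m<M. 2 * Lbar\<^sup>2 * (rdot d (z m - wm m) (z m - wm m) + rdot d (z m - zm m) (z m - zm m)))"
  proof (intro sum_mono)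
    fix m assume m: "m \<in> {..<M}"
    have "rdot d (D m i + \<alpha> *\<^sub>R D' m i) (D m i + \<alpha> *\<^sub>R D' m i) \<le> 2 * rdot d (D m i) (D m i) + 2 * rdot d (D' m i) (D' m i)" for i
    proof -
      have "\<alpha> * \<alpha> \<le> 1" using \<alpha>(1) \<alpha>_ge by (intro mult_le_one) auto
      then have "rdot d (\<alpha> *\<^sub>R D' m i) (\<alpha> *\<^sub>R D' m i) \<le> rdot d (D' m i) (D' m i)"
        using mult_right_mono[of "\<alpha> * \<alpha>" 1 "rdot d (D' m i) (D' m i)"] r.nonneg
        by (simp add: r.scaleR_left r.scaleR_right mult.assoc)
      then show ?thesis using r.norm_add_le[of "D m i" "\<alpha> *\<^sub>R D' m i"] by linarith
    qed
    then have "1 / real n * (\<Sum>i<n. rdot d (D m i + \<alpha> *\<^sub>R D' m i) (D m i + \<alpha> *\<^sub>R D' m i))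
       \<le> 1 / real n * (\<Sum>i<n. 2 * rdot d (D m i) (D m i) + 2 * rdot d (D' m i) (D' m i))"
      by (intro mult_left_mono sum_mono) auto
    also have "\<dots> = 2 * (1 / real n * (\<Sum>i<n. rdot d (D m i) (D m i))) + 2 * (1 / real n * (\<Sum>i<n. rdot d (D' m i) (D' m i)))"
      by (simp add: sum.distrib sum_distrib_left[symmetric] add_divide_distrib)
    also have "\<dots> \<le> 2 * (Lbar\<^sup>2 * rdot d (z m - wm m) (z m - wm m)) + 2 * (Lbar\<^sup>2 * rdot d (z m - zm m) (z m - zm m))"
      unfolding D_def D'_def
      by (intro add_mono mult_left_mono avg_rdot) (use m assms in \<open>auto simp: LiftedD\<close>)
    finally show "1 / real n * (\<Sum>i<n. rdot d (D m i + \<alpha> *\<^sub>R D' m i) (D m i + \<alpha> *\<^sub>R D' m i))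
      \<le> 2 * Lbar\<^sup>2 * (rdot d (z m - wm m) (z m - wm m) + rdot d (z m - zm m) (z m - zm m))"
      by (simp add: algebra_simps)
  qed
  also have "\<dots> = 2 * Lbar\<^sup>2 * (N (z - wm) + N (z - zm))"
    unfolding sum_distrib_left[symmetric] sum.distrib by (simp add: ldot_def)
  finally have *: "(\<Sum>m<M. 1 / real n * (\<Sum>i<n. rdot d (D m i + \<alpha> *\<^sub>R D' m i) (D m i + \<alpha> *\<^sub>R D' m i)))
     \<le> 2 * Lbar\<^sup>2 * (N (z - wm) + N (z - zm))" .
  show ?thesis
    unfolding mixed_noise
    by (rule order_trans[OF expectation_sample_noise_square[OF b n] divide_right_mono[OF *[unfolded D_def D'_def]]]) simp
qed

section \<open>The potential and its expected decrease\<close>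

definition cross :: "lvec \<Rightarrow> lvec \<Rightarrow> lvec \<Rightarrow> lvec \<Rightarrow> real" where
  "cross z zm y ym = - 2 * \<eta> * ldot d M (Fhat z - Fhat zm) (z - zst) + 2 * \<eta> * ldot d M (y - ym) (z - zst)"

text \<open>Weights are what one step leaves over: 3/2 \<eta> \<mu> is 2 \<eta> \<mu> from strong
  monotonicity less \<eta> \<mu> / 2 for the dual part, and 3/4 p is p less p/4 for the half-step
  variance. The extra weight of \<open>w\<close> is such that replacing the anchor with probability
  p adds just \<eta> \<mu> / 2 to the weight of \<open>z - zst\<close>.\<close>

definition potential :: "state \<Rightarrow> real" where
  "potential = (\<lambda>(z, zm, w, wm, y, ym).
     (1 + 3/2 * \<eta> * \<mu>) * N (z - zst) + (1 + \<eta> * \<mu> / (2 * p)) * N (w - zst) + \<eta> / \<theta> * Q (y - yst)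
     + 1/4 * N (z - zm) + 3/4 * p * N (z - wm) + \<eta> / (2 * \<theta>) * N (y - ym) + cross z zm y ym)"

definition valid :: "state \<Rightarrow> bool" where
  "valid = (\<lambda>(z, zm, w, wm, y, ym). z \<in> Lft \<and> zm \<in> Lft \<and> w \<in> Lft \<and> wm \<in> Lft \<and> y \<in> Perp \<and> ym \<in> Perp)"

lemma potential_ge:
  assumes "valid s"
  shows "N (fst s - zst) \<le> 2 * potential s"
proof -
  obtain z zm w wm y ym where s: "s = (z, zm, w, wm, y, ym)" by (cases s)
  have v: "z \<in> Lft" "zm \<in> Lft" using assms by (auto simp: valid_def s)
  have "1/2 * N (z - zst) \<le> N (z - zst) + 1/4 * N (z - zm) + \<eta> / (2 * \<theta>) * N (y - ym) + cross z zm y ym"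
    using l.potential_lower_bound[OF Fhat_lip[OF v] pos(3,4,2) \<eta>L \<eta>\<theta>, of zst y ym]
    unfolding cross_def by simp
  moreover have "0 \<le> 3/2 * \<eta> * \<mu> * N (z - zst)" "0 \<le> (1 + \<eta> * \<mu> / (2 * p)) * N (w - zst)"
    "0 \<le> \<eta> / \<theta> * Q (y - yst)" "0 \<le> 3/4 * p * N (z - wm)"
    using pos p l.nonneg semi_inner.nonneg[OF dual_dot_semi_inner] by simp_all
  ultimately show ?thesis by (simp add: potential_def s algebra_simps)
qed

text \<open>The right-hand side of one step without the sampling errors; it depends on the current
  state only.\<close>

definition base :: "lvec \<Rightarrow> lvec \<Rightarrow> lvec \<Rightarrow> lvec \<Rightarrow> lvec \<Rightarrow> real" where
  "base z zm w y ym = (1 - p) * N (z - zst) + p * N (w - zst)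
     + (1 - \<beta> * \<theta> / \<kappa>) * (\<eta> / \<theta> * Q (y - yst)) + \<alpha> * cross z zm y ym
     + 1/16 * N (z - zm) + \<eta> / (4 * \<theta>) * N (y - ym)"

text \<open>The vector paired with \<open>\<xi>\<close> depends on \<open>j\<close> through
  \<open>zp\<close>, but not on \<open>jh\<close>, so this term will vanish when \<open>jh\<close>
  is averaged for fixed \<open>j\<close>.\<close>

lemma sampled_descent:
  fixes j jh :: "nat \<times> nat \<Rightarrow> nat"
  assumes s: "z \<in> Lft" "zm \<in> Lft" "w \<in> Lft" "wm \<in> Lft" "y \<in> Perp" "ym \<in> Perp"
    and jh: "jh \<in> set_pmf (sample_indices M n b)"
  defines "zp \<equiv> next_z z zm w wm y ym j"
  defines "yp \<equiv> next_y zp w y jh"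
  defines "D \<equiv> mixed_est z zm wm j - (Fhat z + \<alpha> *\<^sub>R (Fhat z - Fhat zm))"
  defines "\<xi> \<equiv> half_est zp w jh - Fhat zp"
  shows "(1 + 3/2 * \<eta> * \<mu>) * N (zp - zst) + \<eta> / \<theta> * Q (yp - yst) + 1/4 * N (zp - z)
     + p * N (zp - w) + \<eta> / (2 * \<theta>) * N (yp - y) + cross zp z yp y
     \<le> base z zm w y ym - 2 * \<eta> * ldot d M D (z - zst) + 4 * \<eta>\<^sup>2 * N D
     + 2 * \<eta> * \<beta> * ldot d M \<xi> (y - \<theta> *\<^sub>R gossip M W (zp - \<beta> *\<^sub>R (Fhat zp - y)) - yst) + \<eta> * \<beta> * N \<xi>"
proof -
  have zp: "zp \<in> Lft" unfolding zp_def next_z_def by (rule prox_in)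
  have he: "half_est zp w jh \<in> Lft" using half_est_in zp s jh by blast
  have yL: "y \<in> Lft" using s by (simp add: consensus_perp_def)
  have yp: "yp \<in> Perp" unfolding yp_def using next_y_in zp s jh by blast
  have \<xi>L: "\<xi> \<in> Lft" unfolding \<xi>_def using he Fhat_in[OF zp] by (intro Lifted_diff)
  define x where "x = zp - \<beta> *\<^sub>R (half_est zp w jh - y)"
  have xL: "x \<in> Lft" unfolding x_def using zp he yL by (intro Lifted_diff Lifted_scaleR)
  have e: "yp - yst \<in> Perp" using yp yst_in by (rule consensus_perp_diff)
  define \<Delta> where "\<Delta> = mixed_est z zm wm j - (y + \<alpha> *\<^sub>R (y - ym))"
  have prox: "ldot d M (zp - z - p *\<^sub>R (w - z) + \<eta> *\<^sub>R (\<Delta> - (Fhat zst - yst))) (zp - zst) \<le> 0"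
  proof -
    have "zp = prox d M \<eta> g (z + p *\<^sub>R (w - z) - \<eta> *\<^sub>R \<Delta>)"
      by (simp add: zp_def next_z_def \<Delta>_def)
    then have "ldot d M (zp - (z + p *\<^sub>R (w - z) - \<eta> *\<^sub>R \<Delta>) - \<eta> *\<^sub>R Sl) (zp - zst) \<le> 0"
      using prox_ineq by simp
    moreover have "zp - (z + p *\<^sub>R (w - z) - \<eta> *\<^sub>R \<Delta>) - \<eta> *\<^sub>R Sl
       = zp - z - p *\<^sub>R (w - z) + \<eta> *\<^sub>R (\<Delta> - (Fhat zst - yst))"
      by (simp add: yst_def scaleR_diff_right)
    ultimately show ?thesis by simp
  qed
  have upd: "dual_dot d (yp - y) (yp - yst) = - \<theta> * ldot d M (zp - zst - \<beta> *\<^sub>R (half_est zp w jh - y)) (yp - yst)"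
  proof -
    interpret q: semi_inner "dual_dot d" by (rule dual_dot_semi_inner)
    have "yp - y = (- \<theta>) *\<^sub>R gossip M W x" by (simp add: yp_def next_y_def x_def)
    then have "dual_dot d (yp - y) (yp - yst) = - \<theta> * dual_dot d (gossip M W x) (yp - yst)"
      by (simp only: q.scaleR_left)
    also have "\<dots> = - \<theta> * ldot d M x (yp - yst)"
      by (simp only: dual_dot_gossip[OF xL e])
    also have "ldot d M x (yp - yst) = ldot d M (x - zst) (yp - yst)"
      using ldot_consensus_perp[OF e zs] by (simp add: l.diff_left zst_def)
    also have "x - zst = zp - zst - \<beta> *\<^sub>R (half_est zp w jh - y)" by (simp add: x_def)
    finally show ?thesis .
  qed
  \<comment> \<open>The second sampling error enters the dual update affinely, which separates it
    from the update with the exact operator.\<close>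
  have split: "yp = y - \<theta> *\<^sub>R gossip M W (zp - \<beta> *\<^sub>R (Fhat zp - y)) + (\<theta> * \<beta>) *\<^sub>R gossip M W (half_est zp w jh - Fhat zp)"
  proof -
    have "zp - \<beta> *\<^sub>R (half_est zp w jh - y) = (zp - \<beta> *\<^sub>R (Fhat zp - y)) - \<beta> *\<^sub>R (half_est zp w jh - Fhat zp)"
      by (simp add: scaleR_diff_right)
    then show ?thesis
      by (simp add: yp_def next_y_def gossip_diff gossip_scaleR scaleR_diff_right)
  qed
  have proj: "ldot d M (Fhat zst - yst) (yp - yst) = 0"
    using ldot_consensus_perp[OF e Rn_scaleR[OF S_in]] by (simp add: yst_def Sl_def)
  have Q1: "N (yp - y) \<le> Q (yp - y)" using yp s by (intro dual_dot_ge consensus_perp_diff)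
  have Q2: "Q (y - yst) \<le> \<kappa> * N (y - yst)"
    unfolding \<kappa> using yst_in s by (intro dual_dot_le consensus_perp_diff)
  have \<alpha>0: "0 < \<alpha>" using \<alpha>_ge by simp
  note main = l.pointwise_descent[where G = "gossip M W" and \<Delta>h = "half_est zp w jh" and Fzp = "Fhat zp"
      and ybar = "y - \<theta> *\<^sub>R gossip M W (zp - \<beta> *\<^sub>R (Fhat zp - y))", OF dual_dot_semi_inner prox \<Delta>_def Fhat_mono[OF zp zst_in] Fhat_lip[OF s(1,2)]
      Fhat_lip[OF zp zst_in] upd split gossip_le[OF \<xi>L, unfolded \<xi>_def] proj Q1 Q2 p pos(3,4,5) \<kappa>_pos pos(2) \<alpha>0 \<alpha>(1) \<eta>L \<beta>L \<theta>\<beta> \<eta>\<theta>]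
  have "1/4 * N (zp - z) \<le> 5/16 * N (zp - z)" using l.nonneg[of "zp - z"] by simp
  then show ?thesis
    using main unfolding D_def[symmetric] \<xi>_def[symmetric] base_def cross_def by linarith
qed

lemma finite_step: "finite (set_pmf (the_step s))"
proof (cases s)
  case (fields z zm w wm y ym)
  have fb: "finite (set_pmf (bernoulli_pmf p))" by (rule finite_subset[of _ UNIV]) auto
  show ?thesis unfolding fields step_eq
    using finite_sample_indices[OF n] fb by (auto simp: set_bind_pmf)
qed

lemma step_valid:
  assumes "valid s" "s' \<in> set_pmf (the_step s)"
  shows "valid s'"
proof (cases s)
  case (fields z zm w wm y ym)
  have v: "z \<in> Lft" "zm \<in> Lft" "w \<in> Lft" "wm \<in> Lft" "y \<in> Perp" "ym \<in> Perp"
    using assms(1) by (auto simp: fields valid_def)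
  obtain j jh c where jh: "jh \<in> set_pmf (sample_indices M n b)" and 
    s': "s' = (next_z z zm w wm y ym j, z, if c then z else w, w, next_y (next_z z zm w wm y ym j) w y jh, y)"
    using assms(2) unfolding fields step_eq by (auto simp: set_bind_pmf)
  have "next_z z zm w wm y ym j \<in> Lft" unfolding next_z_def by (rule prox_in)
  then show ?thesis using v next_y_in[OF _ v(3) v(5) jh] by (simp add: s' valid_def)
qed

text \<open>Added to \<open>base\<close> are the mean of the new anchor term and the variance of the
  first sample; the weights are compared with the potential one by one.\<close>

lemma base_bound:
  "base z zm w y ym + (1 + \<eta> * \<mu> / (2 * p)) * (p * N (z - zst) + (1 - p) * N (w - zst)) + p / 2 * (N (z - wm) + N (z - zm))
    \<le> \<alpha> * potential (z, zm, w, wm, y, ym)"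
proof -
  define x where "x = \<eta> * \<mu>"
  have x: "0 < x" "x \<le> 1/16" using pos \<eta>\<mu> by (auto simp: x_def)
  \<comment> \<open>The new anchor costs x/2, and the weight 1 + 3/2 x leaves room for a contraction
    by 1 - x/4.\<close>
  have c1: "1 - p + (1 + x / (2 * p)) * p \<le> \<alpha> * (1 + 3/2 * x)"
  proof -
    have "1 - p + (1 + x / (2 * p)) * p = 1 + x / 2" using p by (simp add: field_simps)
    also have "\<dots> \<le> (1 - x / 4) * (1 + 3/2 * x)"
    proof -
      have "(1 - x / 4) * (1 + 3/2 * x) - (1 + x / 2) = 3/4 * x * (1 - x / 2)" by (simp add: field_simps)
      moreover have "0 \<le> 3/4 * x * (1 - x / 2)" using x by (intro mult_nonneg_nonneg) auto
      ultimately show ?thesis by linarith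
    qed
    also have "\<dots> \<le> \<alpha> * (1 + 3/2 * x)"
      using \<alpha>(2) x by (intro mult_right_mono) (auto simp: x_def mult.commute)
    finally show ?thesis .
  qed
  \<comment> \<open>The bound on \<alpha> with denominator 2 p + x fits exactly: that factor times
    the anchor weight equals the left side.\<close>
  have c2: "p + (1 + x / (2 * p)) * (1 - p) \<le> \<alpha> * (1 + x / (2 * p))"
  proof -
    define q where "q = 2 * p + x"
    have q: "q > 0" "1 + x / (2 * p) = q / (2 * p)" using p x by (simp_all add: q_def field_simps)
    have "p + (1 + x / (2 * p)) * (1 - p) = (q - p * x) / (2 * p)"
      using p x by (simp add: q_def field_simps)
    also have "\<dots> = (1 - p * x / q) * (q / (2 * p))"
      using p(1) q(1) by (simp add: field_simps)
    also have "\<dots> = (1 - p * x / (2 * p + x)) * (1 + x / (2 * p))"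
      by (simp only: q(2)) (simp only: q_def)
    also have "\<dots> \<le> \<alpha> * (1 + x / (2 * p))"
      using \<alpha>(4) x p by (intro mult_right_mono) (auto simp: x_def mult.assoc)
    finally show ?thesis .
  qed
  have c3: "(1 - \<beta> * \<theta> / \<kappa>) * (\<eta> / \<theta> * Q (y - yst)) \<le> \<alpha> * (\<eta> / \<theta> * Q (y - yst))"
    using \<alpha>(3) pos semi_inner.nonneg[OF dual_dot_semi_inner] by (intro mult_right_mono) auto
  have c4: "1/16 + p / 2 \<le> \<alpha> * (1/4)" using p \<alpha>_ge by simp
  have c5: "p / 2 \<le> \<alpha> * (3/4 * p)" using mult_right_mono[OF \<alpha>_ge, of "3/4 * p"] p by simp
  have c6: "\<eta> / (4 * \<theta>) \<le> \<alpha> * (\<eta> / (2 * \<theta>))" 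
    using mult_right_mono[OF \<alpha>_ge, of "\<eta> / (2 * \<theta>)"] pos
    by (simp add: field_simps)
  have m1: "(1 - p + (1 + x / (2 * p)) * p) * N (z - zst) \<le> \<alpha> * (1 + 3/2 * x) * N (z - zst)"
    using c1 l.nonneg by (intro mult_right_mono)
  have m2: "(p + (1 + x / (2 * p)) * (1 - p)) * N (w - zst) \<le> \<alpha> * (1 + x / (2 * p)) * N (w - zst)"
    using c2 l.nonneg by (intro mult_right_mono)
  have m4: "(1/16 + p / 2) * N (z - zm) \<le> \<alpha> * (1/4) * N (z - zm)" 
    using c4 l.nonneg by (intro mult_right_mono)
  have m5: "p / 2 * N (z - wm) \<le> \<alpha> * (3/4 * p) * N (z - wm)" 
    using c5 l.nonneg by (intro mult_right_mono)
  have m6: "\<eta> / (4 * \<theta>) * N (y - ym) \<le> \<alpha> * (\<eta> / (2 * \<theta>)) * N (y - ym)" 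
    using c6 l.nonneg by (intro mult_right_mono)
  define k where "k = 1 + x / (2 * p)"
  have k: "1 + \<eta> * \<mu> / (2 * p) = k" "1 + 3/2 * \<eta> * \<mu> = 1 + 3/2 * x" by (simp_all add: k_def x_def)
  have "base z zm w y ym + k * (p * N (z - zst) + (1 - p) * N (w - zst)) + p / 2 * (N (z - wm) + N (z - zm))
    = (1 - p + k * p) * N (z - zst) + (p + k * (1 - p)) * N (w - zst)
      + (1 - \<beta> * \<theta> / \<kappa>) * (\<eta> / \<theta> * Q (y - yst)) + \<alpha> * cross z zm y ym
      + (1/16 + p / 2) * N (z - zm) + p / 2 * N (z - wm) + \<eta> / (4 * \<theta>) * N (y - ym)"
    unfolding base_def by (simp add: algebra_simps)
  also have "\<dots> \<le> \<alpha> * (1 + 3/2 * x) * N (z - zst) + \<alpha> * k * N (w - zst) + \<alpha> * (\<eta> / \<theta> * Q (y - yst)) + \<alpha> * cross z zm y ym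
      + \<alpha> * (1/4) * N (z - zm) + \<alpha> * (3/4 * p) * N (z - wm) + \<alpha> * (\<eta> / (2 * \<theta>)) * N (y - ym)"
    using m1 m2 c3 m4 m5 m6 unfolding k_def[symmetric] by linarith
  also have "\<dots> = \<alpha> * potential (z, zm, w, wm, y, ym)"
    unfolding potential_def k by (simp add: algebra_simps)
  finally show ?thesis unfolding k .
qed

text \<open>The order of averaging matters. For fixed \<open>j\<close> the half-step sample sees
  \<open>zp\<close> and \<open>u\<close> as constants; afterwards \<open>j\<close> is averaged
  against \<open>z - zst\<close>, which is fixed by the state.\<close>

lemma expected_descent:
  assumes "valid s"
  shows "measure_pmf.expectation (the_step s) potential \<le> \<alpha> * potential s"
proof (cases s)
  case (fields z zm w wm y ym)
  have v: "z \<in> Lft" "zm \<in> Lft" "w \<in> Lft" "wm \<in> Lft" "y \<in> Perp" "ym \<in> Perp"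
    using assms(1) by (auto simp: fields valid_def)
  define P where "P = sample_indices M n b"
  have fP: "finite (set_pmf P)" using finite_sample_indices[OF n] by (simp add: P_def)
  have fb: "finite (set_pmf (bernoulli_pmf p))" by (rule finite_subset[of _ UNIV]) auto
  have int: "integrable P f" for f :: "_ \<Rightarrow> real"
    using fP by (auto intro: integrable_measure_pmf_finite)
  define zp where "zp j = next_z z zm w wm y ym j" for j
  define yp where "yp j jh = next_y (zp j) w y jh" for j jh
  define T where "T j jh c = potential (zp j, z, if c then z else w, w, yp j jh, y)" for j jh c
  define D where "D j = mixed_est z zm wm j - (Fhat z + \<alpha> *\<^sub>R (Fhat z - Fhat zm))" for j
  define \<xi> where "\<xi> j jh = half_est (zp j) w jh - Fhat (zp j)" for j jh
  define u where "u j = y - \<theta> *\<^sub>R gossip M W (zp j - \<beta> *\<^sub>R (Fhat (zp j) - y)) - yst" for j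
  define R where "R = base z zm w y ym + (1 + \<eta> * \<mu> / (2 * p)) * (p * N (z - zst) + (1 - p) * N (w - zst))"
  have zp: "zp j \<in> Lft" for j unfolding zp_def next_z_def by (rule prox_in)
  have "measure_pmf.expectation (the_step s) potential =
     measure_pmf.expectation P (\<lambda>j. measure_pmf.expectation P (\<lambda>jh. T j jh True * p + T j jh False * (1 - p)))"
    unfolding fields step_eq P_def[symmetric] zp_def[symmetric] yp_def[symmetric] T_def
    using fP fb p by (simp add: expectation_bind_finite set_bind_pmf)
  also have "\<dots> \<le> measure_pmf.expectation P (\<lambda>j. R - 2 * \<eta> * ldot d M (D j) (z - zst) + 4 * \<eta>\<^sup>2 * N (D j))"
  proof (rule expectation_mono_finite[OF fP])
    fix j
    have "measure_pmf.expectation P (\<lambda>jh. T j jh True * p + T j jh False * (1 - p)) 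
      \<le> measure_pmf.expectation P (\<lambda>jh. R - p / 4 * N (zp j - w) - 2 * \<eta> * ldot d M (D j) (z - zst) + 4 * \<eta>\<^sup>2 * N (D j)
           + 2 * \<eta> * \<beta> * ldot d M (\<xi> j jh) (u j) + \<eta> * \<beta> * N (\<xi> j jh))"
    proof (rule expectation_mono_finite[OF fP])
      fix jh assume jh: "jh \<in> set_pmf P"
      \<comment> \<open>The potential weighs \<open>zp j - w\<close> by 3/4 p, while one step
        provides p; the difference p/4 is kept for the variance of the half step.\<close>
      have "T j jh True * p + T j jh False * (1 - p) = 
          (1 + 3/2 * \<eta> * \<mu>) * N (zp j - zst) + \<eta> / \<theta> * Q (yp j jh - yst) + 1/4 * N (zp j - z)
         + p * N (zp j - w) + \<eta> / (2 * \<theta>) * N (yp j jh - y) + cross (zp j) z (yp j jh) y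
         + (1 + \<eta> * \<mu> / (2 * p)) * (p * N (z - zst) + (1 - p) * N (w - zst)) - p / 4 * N (zp j - w)"
      proof -
        define X where "X = (1 + 3/2 * \<eta> * \<mu>) * N (zp j - zst) + \<eta> / \<theta> * Q (yp j jh - yst) + 1/4 * N (zp j - z)
          + 3/4 * p * N (zp j - w) + \<eta> / (2 * \<theta>) * N (yp j jh - y) + cross (zp j) z (yp j jh) y"
        define k where "k = 1 + \<eta> * \<mu> / (2 * p)"
        have "T j jh True = X + k * N (z - zst)" "T j jh False = X + k * N (w - zst)"
          by (simp_all add: T_def potential_def X_def k_def)
        then have "T j jh True * p + T j jh False * (1 - p) = X + k * (p * N (z - zst) + (1 - p) * N (w - zst))"
          by (simp add: algebra_simps)
        then show ?thesis unfolding X_def k_def by simp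
      qed
      also have "\<dots> \<le> R - p / 4 * N (zp j - w) - 2 * \<eta> * ldot d M (D j) (z - zst) + 4 * \<eta>\<^sup>2 * N (D j)
           + 2 * \<eta> * \<beta> * ldot d M (\<xi> j jh) (u j) + \<eta> * \<beta> * N (\<xi> j jh)"
        using sampled_descent[OF v jh[unfolded P_def], of j]
        unfolding R_def D_def \<xi>_def u_def yp_def zp_def by linarith
      finally show "T j jh True * p + T j jh False * (1 - p) \<le> R - p / 4 * N (zp j - w) - 2 * \<eta> * ldot d M (D j) (z - zst) + 4 * \<eta>\<^sup>2 * N (D j)
           + 2 * \<eta> * \<beta> * ldot d M (\<xi> j jh) (u j) + \<eta> * \<beta> * N (\<xi> j jh)" .
    qed
    also have "\<dots> = R - p / 4 * N (zp j - w) - 2 * \<eta> * ldot d M (D j) (z - zst) + 4 * \<eta>\<^sup>2 * N (D j)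
           + 2 * \<eta> * \<beta> * measure_pmf.expectation P (\<lambda>jh. ldot d M (\<xi> j jh) (u j)) 
           + \<eta> * \<beta> * measure_pmf.expectation P (\<lambda>jh. N (\<xi> j jh))"
      using int by simp
    also have "measure_pmf.expectation P (\<lambda>jh. ldot d M (\<xi> j jh) (u j)) = 0"
      unfolding \<xi>_def half_noise P_def by (rule expectation_sample_noise_ldot[OF b n])
    also have "\<eta> * \<beta> * measure_pmf.expectation P (\<lambda>jh. N (\<xi> j jh)) \<le> p / 4 * N (zp j - w)"
    proof -
      have "\<eta> * \<beta> * measure_pmf.expectation P (\<lambda>jh. N (\<xi> j jh)) \<le> \<eta> * \<beta> * (Lbar\<^sup>2 * N (zp j - w) / real b)"
        unfolding \<xi>_def P_def using half_noise_square[OF zp v(3)] pos by (intro mult_left_mono) auto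
      also have "\<dots> = (4 * \<eta> * \<beta> * Lbar\<^sup>2) / (4 * real b) * N (zp j - w)" by simp
      also have "\<dots> \<le> (real b * p) / (4 * real b) * N (zp j - w)"
        using \<beta>Lbar l.nonneg by (intro mult_right_mono divide_right_mono) auto
      also have "\<dots> = p / 4 * N (zp j - w)" using b by simp
      finally show ?thesis .
    qed
    finally show "measure_pmf.expectation P (\<lambda>jh. T j jh True * p + T j jh False * (1 - p)) \<le> 
       R - 2 * \<eta> * ldot d M (D j) (z - zst) + 4 * \<eta>\<^sup>2 * N (D j)" by linarith
  qed
  also have "\<dots> = R - 2 * \<eta> * measure_pmf.expectation P (\<lambda>j. ldot d M (D j) (z - zst)) 
      + 4 * \<eta>\<^sup>2 * measure_pmf.expectation P (\<lambda>j. N (D j))"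
    using int by simp
  also have "measure_pmf.expectation P (\<lambda>j. ldot d M (D j) (z - zst)) = 0"
    unfolding D_def mixed_noise P_def by (rule expectation_sample_noise_ldot[OF b n])
  \<comment> \<open>The bound \<open>\<eta>Lbar\<close> is tailored to this: 8 \<eta>^2 Lbar^2 / b
    is at most p/2, the share that \<open>base_bound\<close> provides.\<close>
  also have "4 * \<eta>\<^sup>2 * measure_pmf.expectation P (\<lambda>j. N (D j)) \<le> p / 2 * (N (z - wm) + N (z - zm))"
  proof -
    have "4 * \<eta>\<^sup>2 * measure_pmf.expectation P (\<lambda>j. N (D j)) \<le> 4 * \<eta>\<^sup>2 * (2 * Lbar\<^sup>2 * (N (z - wm) + N (z - zm)) / real b)"
      unfolding D_def P_def by (intro mult_left_mono mixed_noise_square v) auto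
    also have "\<dots> = (16 * \<eta>\<^sup>2 * Lbar\<^sup>2) / (2 * real b) * (N (z - wm) + N (z - zm))" by simp
    also have "\<dots> \<le> (p * real b) / (2 * real b) * (N (z - wm) + N (z - zm))"
      using \<eta>Lbar l.nonneg by (intro mult_right_mono divide_right_mono add_nonneg_nonneg) auto
    also have "\<dots> = p / 2 * (N (z - wm) + N (z - zm))" using b by simp
    finally show ?thesis .
  qed
  finally have "measure_pmf.expectation (the_step s) potential \<le> R + p / 2 * (N (z - wm) + N (z - zm))" by simp
  also have "\<dots> \<le> \<alpha> * potential s"
    unfolding R_def fields using base_bound[of z zm w y ym wm] by simp
  finally show ?thesis .
qed

abbreviation iter :: "lvec \<Rightarrow> lvec \<Rightarrow> nat \<Rightarrow> state pmf" where
  "iter z0 y0 \<equiv> iterates d M n F g W \<eta> \<theta> \<alpha> \<beta> p b p z0 y0"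

text \<open>Finite support and validity are carried through the induction because the expectation of
  a bind and the descent estimate rely on them.\<close>

lemma iterates_linear_rate:
  assumes "z0 \<in> Lft" "y0 \<in> Perp"
  shows "finite (set_pmf (iter z0 y0 k)) \<and> (\<forall>s\<in>set_pmf (iter z0 y0 k). valid s) \<and>
    measure_pmf.expectation (iter z0 y0 k) potential \<le> \<alpha> ^ k * potential (z0, z0, z0, z0, y0, y0)"
proof (induction k)
  case 0
  then show ?case using assms by (simp add: valid_def)
next
  case (Suc k)
  define I where "I = iter z0 y0 k"
  have IH: "finite (set_pmf I)" "\<And>s. s \<in> set_pmf I \<Longrightarrow> valid s"
    "measure_pmf.expectation I potential \<le> \<alpha> ^ k * potential (z0, z0, z0, z0, y0, y0)"
    using Suc by (auto simp: I_def)
  have S: "iter z0 y0 (Suc k) = I \<bind> the_step" by (simp add: I_def)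
  have "measure_pmf.expectation (iter z0 y0 (Suc k)) potential
     = measure_pmf.expectation I (\<lambda>s. measure_pmf.expectation (the_step s) potential)"
    unfolding S by (rule expectation_bind_finite[OF IH(1) finite_step])
  also have "\<dots> \<le> measure_pmf.expectation I (\<lambda>s. \<alpha> * potential s)"
    by (rule expectation_mono_finite[OF IH(1) expected_descent[OF IH(2)]])
  also have "\<dots> = \<alpha> * measure_pmf.expectation I potential" by simp
  also have "\<dots> \<le> \<alpha> * (\<alpha> ^ k * potential (z0, z0, z0, z0, y0, y0))"
    using IH(3) \<alpha>_ge by (intro mult_left_mono) auto
  finally have "measure_pmf.expectation (iter z0 y0 (Suc k)) potential
     \<le> \<alpha> ^ Suc k * potential (z0, z0, z0, z0, y0, y0)" by simp
  moreover have "finite (set_pmf (I \<bind> the_step))"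
    unfolding set_bind_pmf using IH(1) finite_step by blast
  moreover have "\<forall>s\<in>set_pmf (I \<bind> the_step). valid s"
    unfolding set_bind_pmf using IH(2) step_valid by blast
  ultimately show ?case unfolding S by blast
qed

lemma expected_error_le:
  assumes "z0 \<in> Lft" "y0 \<in> Perp"
  shows "expected_error d M (iter z0 y0 k) (lift M zs) \<le> 2 * \<alpha> ^ k * potential (z0, z0, z0, z0, y0, y0)"
proof -
  note it = iterates_linear_rate[OF assms, of k]
  have "expected_error d M (iter z0 y0 k) (lift M zs) \<le> measure_pmf.expectation (iter z0 y0 k) (\<lambda>s. 2 * potential s)"
    unfolding expected_error_def lnorm_square zst_def[symmetric]
    by (rule expectation_mono_finite) (use it potential_ge in auto)
  then show ?thesis using it by simp
qed

end

section \<open>The convergence rate\<close>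

lemma unit_vector: "d \<ge> 1 \<Longrightarrow> \<exists>u\<in>Rn d. rdot d u u > 0"
proof -
  assume d: "d \<ge> 1"
  define u where "u = (\<lambda>i::nat. if i = 0 then 1 else 0 :: real)"
  have "u \<in> Rn d" "u \<noteq> 0" using d by (auto simp: u_def Rn_def topspace_Euclidean_space fun_eq_iff)
  then show ?thesis
    using rdot_eq_0_iff[of u d] semi_inner.nonneg[OF rdot_semi_inner, of d u] by (metis less_eq_real_def)
qed

text \<open>Both properties are tested at 0 and a nonzero vector, which exists in positive
  dimension. The result lets the bound on \<eta> L control \<eta> \<mu> as well.\<close>

lemma strongly_monotone_le_Lipschitz:
  assumes d: "d \<ge> 1" and lip: "Lipschitz d L f" and mono: "strongly_monotone d \<mu> f" and \<mu>: "\<mu> > 0"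
  shows "\<mu> \<le> L"
proof -
  interpret semi_inner "rdot d" by (rule rdot_semi_inner)
  obtain u where u: "u \<in> Rn d" "rdot d u u > 0" using unit_vector[OF d] by blast
  have z: "0 \<in> Rn d" by (simp add: Rn_def topspace_Euclidean_space)
  have L: "L \<ge> 0" using lip by (simp add: Lipschitz_def)
  define x where "x = f u - f 0"
  have 1: "\<mu> * rdot d u u \<le> rdot d x u"
    using mono u(1) z unfolding strongly_monotone_def rnorm_square x_def by (metis diff_zero)
  have "(\<mu> * rdot d u u)\<^sup>2 \<le> (rdot d x u)\<^sup>2" using 1 \<mu> u(2) by (intro power_mono) auto
  also have "\<dots> \<le> rdot d x x * rdot d u u" by (rule cauchy_schwarz)
  also have "\<dots> \<le> (L\<^sup>2 * rdot d u u) * rdot d u u"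
    using Lipschitz_rdot[OF lip u(1) z] u(2) by (intro mult_right_mono) (auto simp: x_def)
  finally have "\<mu>\<^sup>2 * (rdot d u u)\<^sup>2 \<le> L\<^sup>2 * (rdot d u u)\<^sup>2" by (simp add: power2_eq_square mult_ac)
  then have "\<mu>\<^sup>2 \<le> L\<^sup>2" using u(2) by simp
  then show ?thesis using L \<mu> by (simp add: power2_le_iff_abs_le)
qed

text \<open>If \<open>Lbar\<close> were 0, all sample operators, and so their mean, would agree at
  \<open>u\<close> and 0, against strong monotonicity. Positivity matters because
  \<open>Lbar\<close> is a divisor in the stepsizes.\<close>

lemma average_Lipschitz_pos:
  assumes d: "d \<ge> 1" and n: "n \<ge> 1" and ops: "\<And>i. i < n \<Longrightarrow> f i \<in> Rn d \<rightarrow> Rn d"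
    and avg: "average_Lipschitz d n Lbar f" and mono: "strongly_monotone d \<mu> (mean_op n f)" and \<mu>: "\<mu> > 0"
  shows "Lbar > 0"
proof (rule ccontr)
  interpret semi_inner "rdot d" by (rule rdot_semi_inner)
  assume "\<not> Lbar > 0"
  then have L: "Lbar = 0" using avg by (simp add: average_Lipschitz_def)
  obtain u where u: "u \<in> Rn d" "rdot d u u > 0" using unit_vector[OF d] by blast
  have z: "0 \<in> Rn d" by (simp add: Rn_def topspace_Euclidean_space)
  have "1 / real n * (\<Sum>i<n. (rnorm d (f i u - f i 0))\<^sup>2) \<le> Lbar\<^sup>2 * (rnorm d (u - 0))\<^sup>2"
    using avg u(1) z unfolding average_Lipschitz_def by blast
  then have "(\<Sum>i<n. rdot d (f i u - f i 0) (f i u - f i 0)) \<le> 0"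
    using n unfolding L rnorm_square by (simp add: mult_le_0_iff divide_le_0_iff)
  then have "(\<Sum>i<n. rdot d (f i u - f i 0) (f i u - f i 0)) = 0"
    by (intro antisym sum_nonneg nonneg)
  then have "rdot d (f i u - f i 0) (f i u - f i 0) = 0" if "i < n" for i
    using that nonneg by (subst (asm) sum_nonneg_eq_0_iff) auto
  moreover have "f i u - f i 0 \<in> Rn d" if "i < n" for i
    using ops[OF that] u(1) z by (intro Rn_diff) auto
  ultimately have "f i u = f i 0" if "i < n" for i
    using rdot_eq_0_iff[of "f i u - f i 0" d] that by (metis eq_iff_diff_eq_0)
  then have "mean_op n f u = mean_op n f 0" by (simp add: mean_op_def)
  moreover have "rdot d (mean_op n f u - mean_op n f 0) u \<ge> \<mu> * rdot d u u"
    using mono u(1) z unfolding strongly_monotone_def rnorm_square by (metis diff_zero)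
  ultimately have "\<mu> * rdot d u u \<le> 0" by (simp add: zero_left)
  then show False using u(2) \<mu> by (simp add: mult_le_0_iff)
qed

text \<open>Each of the three entries of the maximum stays below 1 by at least 1 / (64 T), as a case
  analysis over the minima shows. The constant is 4 times 16: \<eta> \<mu> is at least 1 / (16 T),
  and the first gap is a quarter of it.\<close>

lemma rate_bound:
  fixes \<alpha> \<beta> \<eta> \<theta> \<kappa> \<mu> L Lbar p b :: real
  assumes pos: "0 < \<mu>" "0 < L" "0 < Lbar" "0 < \<kappa>" "0 < p" "0 < b"
    and \<eta>: "\<eta> = min (sqrt (p * b) / (4 * Lbar)) (1 / (16 * L * sqrt \<kappa>))"
    and \<beta>: "\<beta> = min (\<mu> / (4 * L\<^sup>2)) (b * p / (4 * \<eta> * Lbar\<^sup>2))"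
    and \<theta>: "\<theta> = min (1 / (2 * \<beta>)) (1 / (16 * \<eta>))"
    and \<alpha>: "\<alpha> = Max {1 - \<mu> * \<eta> / 4, 1 - \<beta> * \<theta> * inverse \<kappa>, 1 - p * \<eta> * \<mu> / (2 * p + \<eta> * \<mu>)}"
  shows "\<alpha> < 1" and "1 / (1 - \<alpha>) \<le> 64 * (1 / p + \<kappa> + 1 / sqrt (p * b) * (Lbar / \<mu>) + sqrt \<kappa> * (L / \<mu>))"
proof -
  define T where "T = 1 / p + \<kappa> + 1 / sqrt (p * b) * (Lbar / \<mu>) + sqrt \<kappa> * (L / \<mu>)"
  have \<eta>0: "\<eta> > 0" using pos by (simp add: \<eta>)
  have \<beta>0: "\<beta> > 0" using pos \<eta>0 by (simp add: \<beta>)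
  have \<theta>0: "\<theta> > 0" using \<beta>0 \<eta>0 by (simp add: \<theta>)
  have T1: "1 / p \<le> T" "\<kappa> \<le> T" "1 / sqrt (p * b) * (Lbar / \<mu>) \<le> T" "sqrt \<kappa> * (L / \<mu>) \<le> T" and T0: "T > 0"
    unfolding T_def using pos by (simp_all add: add_pos_pos)
  have inv_\<eta>: "1 / (\<eta> * \<mu>) \<le> 16 * T"
  proof -
    have "\<eta> = sqrt (p * b) / (4 * Lbar) \<or> \<eta> = 1 / (16 * L * sqrt \<kappa>)" by (auto simp: \<eta> min_def)
    then show ?thesis
    proof
      assume "\<eta> = sqrt (p * b) / (4 * Lbar)"
      then have "1 / (\<eta> * \<mu>) = 4 * (1 / sqrt (p * b) * (Lbar / \<mu>))" by simp
      then show ?thesis using T1(3) T0 by linarith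
    next
      assume "\<eta> = 1 / (16 * L * sqrt \<kappa>)"
      then have "1 / (\<eta> * \<mu>) = 16 * (sqrt \<kappa> * (L / \<mu>))" by simp
      then show ?thesis using T1(4) by linarith
    qed
  qed
  have a: "1 / (64 * T) \<le> \<mu> * \<eta> / 4"
  proof -
    have "1 \<le> 16 * T * (\<eta> * \<mu>)" using inv_\<eta> pos \<eta>0 by (simp add: pos_divide_le_eq)
    then show ?thesis using T0 by (simp add: pos_divide_le_eq mult_ac)
  qed
  have bt: "1 / (64 * T) \<le> \<beta> * \<theta> * inverse \<kappa>"
  proof -
    have i: "\<kappa> / (\<beta> * \<theta>) \<le> 64 * T"
    proof -
      have "\<theta> = 1 / (2 * \<beta>) \<or> \<theta> = 1 / (16 * \<eta>)" by (auto simp: \<theta> min_def)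
      then show ?thesis
      proof
        assume "\<theta> = 1 / (2 * \<beta>)"
        then have "\<kappa> / (\<beta> * \<theta>) = 2 * \<kappa>" using \<beta>0 by simp
        then show ?thesis using T1(2) T0 by linarith
      next
        assume t: "\<theta> = 1 / (16 * \<eta>)"
        have "\<beta> = \<mu> / (4 * L\<^sup>2) \<or> \<beta> = b * p / (4 * \<eta> * Lbar\<^sup>2)" by (auto simp: \<beta> min_def)
        then show ?thesis
        proof
          assume bb: "\<beta> = \<mu> / (4 * L\<^sup>2)"
          \<comment> \<open>The second argument of the minimum in \<eta> removes the surplus factor,
            leaving a multiple of \<open>sqrt \<kappa> * (L / \<mu>)\<close>.\<close>
          have "\<kappa> / (\<beta> * \<theta>) = 64 * (\<kappa> * L\<^sup>2 / \<mu>) * \<eta>" by (simp add: t bb)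
          also have "\<dots> \<le> 64 * (\<kappa> * L\<^sup>2 / \<mu>) * (1 / (16 * L * sqrt \<kappa>))"
            using pos by (intro mult_left_mono) (auto simp: \<eta>)
          also have "\<dots> = 4 * (sqrt \<kappa> * (L / \<mu>))"
          proof -
            have "\<kappa> / sqrt \<kappa> = sqrt \<kappa>" using pos by (metis real_div_sqrt less_imp_le)
            then show ?thesis using pos by (simp add: field_simps power2_eq_square)
          qed
          finally show ?thesis using T1(4) T0 by linarith
        next
          assume bb: "\<beta> = b * p / (4 * \<eta> * Lbar\<^sup>2)"
          \<comment> \<open>The first argument of that minimum makes \<eta>^2 Lbar^2 at most b p /
            16, so only a multiple of \<kappa> remains.\<close>
          have "\<eta> * (4 * Lbar) \<le> sqrt (p * b)" using pos by (simp add: \<eta> field_simps min_def)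
          then have "(\<eta> * (4 * Lbar))\<^sup>2 \<le> (sqrt (p * b))\<^sup>2" using \<eta>0 pos by (intro power_mono) auto
          then have sq: "16 * (\<eta>\<^sup>2 * Lbar\<^sup>2) \<le> b * p" using pos by (simp add: power_mult_distrib mult_ac)
          have "\<kappa> / (\<beta> * \<theta>) = \<kappa> * (64 * (\<eta>\<^sup>2 * Lbar\<^sup>2)) / (b * p)"
            by (simp add: t bb power2_eq_square)
          also have "\<dots> \<le> \<kappa> * (4 * (b * p)) / (b * p)"
            using sq pos by (intro divide_right_mono mult_left_mono) (auto simp: mult_ac)
          also have "\<dots> = 4 * \<kappa>" using pos by simp
          finally show ?thesis using T1(2) T0 by linarith
        qed
      qed
    qed
    then have "\<kappa> \<le> 64 * T * (\<beta> * \<theta>)" using \<beta>0 \<theta>0 by (simp add: pos_divide_le_eq)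
    then show ?thesis using T0 pos by (simp add: field_simps)
  qed
  have c: "1 / (64 * T) \<le> p * \<eta> * \<mu> / (2 * p + \<eta> * \<mu>)"
  proof -
    have "(2 * p + \<eta> * \<mu>) / (p * \<eta> * \<mu>) = 2 * (1 / (\<eta> * \<mu>)) + 1 / p"
      using pos \<eta>0 by (simp add: field_simps)
    also have "\<dots> \<le> 64 * T" using inv_\<eta> T1(1) T0 by linarith
    finally have "2 * p + \<eta> * \<mu> \<le> 64 * T * (p * \<eta> * \<mu>)" using pos \<eta>0 by (simp add: pos_divide_le_eq)
    moreover have "2 * p + \<eta> * \<mu> > 0" using pos \<eta>0 by (simp add: add_pos_pos)
    ultimately show ?thesis using T0 by (simp add: field_simps)
  qed
  have "\<alpha> \<le> 1 - 1 / (64 * T)" unfolding \<alpha> using a bt c by simp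
  then have ab: "1 / (64 * T) \<le> 1 - \<alpha>" by simp
  moreover have "0 < 1 / (64 * T)" using T0 by simp
  ultimately show "\<alpha> < 1" by linarith
  then show "1 / (1 - \<alpha>) \<le> 64 * T"
    using ab T0 by (simp add: field_simps)
qed

text \<open>The rate follows from \<alpha> being at most \<open>exp (- (1 - \<alpha>))\<close>.
  Writing R + 1 keeps the argument of the logarithm positive even for R = 0.\<close>

lemma geometric_decay:
  fixes \<alpha> R T \<epsilon> e :: real
  assumes \<alpha>: "0 \<le> \<alpha>" "\<alpha> < 1" and T: "1 / (1 - \<alpha>) \<le> T" and R: "R \<ge> 0" and \<epsilon>: "\<epsilon> > 0"
    and k: "real k \<ge> T * ln ((R + 1) / \<epsilon>)" and e: "e \<le> \<alpha> ^ k * R"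
  shows "e \<le> \<epsilon>"
\<comment> \<open>A nonpositive logarithm puts no condition on \<open>k\<close>, but then \<epsilon>
  already exceeds R.\<close>
proof (cases "ln ((R + 1) / \<epsilon>) \<le> 0")
  case True
  then have "R + 1 \<le> \<epsilon>" using R \<epsilon> by (simp add: ln_le_zero_iff)
  moreover have "\<alpha> ^ k * R \<le> 1 * R" using \<alpha> R by (intro mult_right_mono power_le_one) auto
  ultimately show ?thesis using e by linarith
next
  case False
  define l where "l = ln ((R + 1) / \<epsilon>)"
  have l: "l > 0" using False by (simp add: l_def)
  have "1 / (1 - \<alpha>) * l \<le> real k" using mult_right_mono[OF T, of l] l k by (simp add: l_def)
  then have kl: "l \<le> (1 - \<alpha>) * real k" using \<alpha> by (simp add: field_simps)
  have "\<alpha> \<le> exp (- (1 - \<alpha>))" using exp_ge_add_one_self[of "- (1 - \<alpha>)"] by simp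
  then have "\<alpha> ^ k \<le> exp (- (1 - \<alpha>)) ^ k" using \<alpha> by (intro power_mono)
  also have "\<dots> = exp (- ((1 - \<alpha>) * real k))" by (simp add: exp_of_nat_mult[symmetric] algebra_simps)
  also have "\<dots> \<le> exp (- l)" using kl by simp
  also have "\<dots> = \<epsilon> / (R + 1)" using R \<epsilon> by (simp add: l_def exp_minus)
  finally have "\<alpha> ^ k * R \<le> \<epsilon> / (R + 1) * R" using R by (intro mult_right_mono)
  also have "\<dots> \<le> \<epsilon>" using R \<epsilon> by (simp add: field_simps)
  finally show ?thesis using e by simp
qed

theorem theorem4p1:
  "\<exists>C>0. \<forall>(d::nat) (M::nat) (n::nat) (F :: nat \<Rightarrow> nat \<Rightarrow> rvec \<Rightarrow> rvec) (g :: rvec \<Rightarrow> ereal)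
      (E :: (nat \<times> nat) set) (W :: real mat) (chi :: real) (L :: real) (Lbar :: real) (\<mu> :: real)
      (b::nat) (p :: real) (\<alpha> :: real) (\<beta> :: real) (\<gamma> :: real) (\<eta> :: real) (\<theta> :: real)
      (z0 :: lvec) (y0 :: lvec) (zs :: rvec).
     d \<ge> 1 \<longrightarrow> M \<ge> 1 \<longrightarrow> n \<ge> 1 \<longrightarrow>
     operators_on d M n F \<longrightarrow>
     proper_lsc_convex d g \<longrightarrow>
     (\<forall>m<M. Lipschitz d L (mean_op n (F m))) \<longrightarrow>
     \<mu> > 0 \<longrightarrow>
     (\<forall>m<M. strongly_monotone d \<mu> (mean_op n (F m))) \<longrightarrow>
     (\<forall>m<M. average_Lipschitz d n Lbar (F m)) \<longrightarrow>
     connected_graph M E \<longrightarrow>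
     gossip_matrix M E W \<longrightarrow>
     chi = 1 / lambda_min_pos W \<longrightarrow>
     VI_solution d M n F g zs \<longrightarrow>
     b \<in> {1..n} \<longrightarrow>
     0 < p \<longrightarrow> p < 1 \<longrightarrow>
     \<gamma> = p \<longrightarrow> p \<le> 1/8 \<longrightarrow>
     \<eta> = min (sqrt (\<gamma> * real b) / (4 * Lbar)) (1 / (16 * L * sqrt chi)) \<longrightarrow>
     \<beta> = min (\<mu> / (4 * L\<^sup>2)) (real b * \<gamma> / (4 * \<eta> * Lbar\<^sup>2)) \<longrightarrow>
     \<theta> = min (1 / (2 * \<beta>)) (1 / (16 * \<eta>)) \<longrightarrow>
     \<alpha> = Max {1 - \<mu> * \<eta> / 4, 1 - \<beta> * \<theta> * inverse chi, 1 - p * \<eta> * \<mu> / (2 * \<gamma> + \<eta> * \<mu>)} \<longrightarrow>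
     z0 \<in> Lifted d M \<longrightarrow> (\<forall>m<M. g (z0 m) \<noteq> \<infinity>) \<longrightarrow>
     y0 \<in> consensus_perp d M \<longrightarrow>
     (\<exists>C0>0. \<forall>\<epsilon>>0. \<forall>k::nat.
        real k \<ge> C * (1 / p + chi + 1 / sqrt (p * real b) * (Lbar / \<mu>) + sqrt chi * (L / \<mu>))
                  * ln (C0 / \<epsilon>)
        \<longrightarrow> expected_error d M (iterates d M n F g W \<eta> \<theta> \<alpha> \<beta> \<gamma> b p z0 y0 k) (lift M zs) \<le> \<epsilon>)"
\<comment> \<open>64 is the constant of \<open>rate_bound\<close>.\<close>
proof (rule exI[of _ 64], rule conjI, simp, intro allI impI)
  fix d M n :: nat and F :: "nat \<Rightarrow> nat \<Rightarrow> rvec \<Rightarrow> rvec" and g :: "rvec \<Rightarrow> ereal"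
    and E :: "(nat \<times> nat) set" and W :: "real mat" and chi L Lbar \<mu> :: real
    and b :: nat and p \<alpha> \<beta> \<gamma> \<eta> \<theta> :: real and z0 y0 :: lvec and zs :: rvec
  assume d: "d \<ge> 1" and M: "M \<ge> 1" and n: "n \<ge> 1" and ops: "operators_on d M n F"
    and g: "proper_lsc_convex d g" and lip: "\<forall>m<M. Lipschitz d L (mean_op n (F m))"
    and \<mu>: "\<mu> > 0" and mono: "\<forall>m<M. strongly_monotone d \<mu> (mean_op n (F m))"
    and avg: "\<forall>m<M. average_Lipschitz d n Lbar (F m)" 
    and W: "gossip_matrix M E W" and chi: "chi = 1 / lambda_min_pos W"
    and sol: "VI_solution d M n F g zs" and b: "b \<in> {1..n}" and p: "0 < p" "p \<le> 1/8" and \<gamma>: "\<gamma> = p"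
    and \<eta>: "\<eta> = min (sqrt (\<gamma> * real b) / (4 * Lbar)) (1 / (16 * L * sqrt chi))"
    and \<beta>: "\<beta> = min (\<mu> / (4 * L\<^sup>2)) (real b * \<gamma> / (4 * \<eta> * Lbar\<^sup>2))"
    and \<theta>: "\<theta> = min (1 / (2 * \<beta>)) (1 / (16 * \<eta>))"
    and \<alpha>: "\<alpha> = Max {1 - \<mu> * \<eta> / 4, 1 - \<beta> * \<theta> * inverse chi, 1 - p * \<eta> * \<mu> / (2 * \<gamma> + \<eta> * \<mu>)}"
    and z0: "z0 \<in> Lifted d M" and y0: "y0 \<in> consensus_perp d M"
  \<comment> \<open>The network locale comes first: its bounds on \<open>lambda_min_pos\<close> give
    \<open>chi1\<close>, on which conditions of the larger locale rest.\<close>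
  interpret gossip_network M E W by unfold_locales (rule M W)+
  have m0: "0 < M" using M by simp
  have \<mu>L: "\<mu> \<le> L" using strongly_monotone_le_Lipschitz[OF d] lip mono m0 \<mu> by blast
  have Lbar: "Lbar > 0"
    by (rule average_Lipschitz_pos[OF d n, of "F 0"]) (use ops avg mono m0 \<mu> in \<open>auto simp: operators_on_def\<close>)
  have L: "L > 0" using \<mu>L \<mu> by simp
  have chi1: "chi \<ge> 1" using lambda_min_pos(1,2) by (simp add: chi)
  have b0: "real b > 0" using b by simp
  have \<eta>0: "\<eta> > 0" using p b0 Lbar L chi1 by (simp add: \<eta> \<gamma>)
  have \<beta>0: "\<beta> > 0" using p b0 Lbar L \<mu> \<eta>0 by (simp add: \<beta> \<gamma>)
  have \<theta>0: "\<theta> > 0" using \<beta>0 \<eta>0 by (simp add: \<theta>)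
  have \<eta>L: "\<eta> * L \<le> 1/16"
  proof -
    have "\<eta> * L \<le> 1 / (16 * L * sqrt chi) * L" using L by (intro mult_right_mono) (auto simp: \<eta>)
    also have "\<dots> = 1 / (16 * sqrt chi)" using L by simp
    also have "\<dots> \<le> 1 / 16" using chi1 by (simp add: field_simps)
    finally show ?thesis .
  qed
  have "\<eta> * \<mu> \<le> \<eta> * L" using \<mu>L \<eta>0 by (intro mult_left_mono) auto
  then have \<eta>\<mu>: "\<eta> * \<mu> \<le> 1/16" using \<eta>L by linarith
  have \<eta>Lbar: "16 * \<eta>\<^sup>2 * Lbar\<^sup>2 \<le> p * real b"
  proof -
    have "\<eta> \<le> sqrt (p * real b) / (4 * Lbar)" by (simp add: \<eta> \<gamma>)
    then have "\<eta> * (4 * Lbar) \<le> sqrt (p * real b)" using Lbar by (simp add: pos_le_divide_eq)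
    then have "(\<eta> * (4 * Lbar))\<^sup>2 \<le> (sqrt (p * real b))\<^sup>2" using \<eta>0 Lbar by (intro power_mono) auto
    then show ?thesis using p b0 by (simp add: power_mult_distrib mult_ac)
  qed
  have \<beta>L: "\<beta> * L\<^sup>2 \<le> \<mu> / 4"
  proof -
    have "\<beta> \<le> \<mu> / (4 * L\<^sup>2)" by (simp add: \<beta>)
    then have "\<beta> * (4 * L\<^sup>2) \<le> \<mu>" using L by (simp add: pos_le_divide_eq)
    then show ?thesis by simp
  qed
  have \<beta>Lbar: "4 * \<eta> * \<beta> * Lbar\<^sup>2 \<le> real b * p"
  proof -
    have "\<beta> \<le> real b * p / (4 * \<eta> * Lbar\<^sup>2)" by (simp add: \<beta> \<gamma>)
    then have "\<beta> * (4 * \<eta> * Lbar\<^sup>2) \<le> real b * p" using \<eta>0 Lbar by (simp add: pos_le_divide_eq)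
    then show ?thesis by (simp add: mult_ac)
  qed
  have \<theta>\<beta>: "\<theta> * \<beta> \<le> 1/2"
  proof -
    have "\<theta> \<le> 1 / (2 * \<beta>)" by (simp add: \<theta>)
    then have "\<theta> * (2 * \<beta>) \<le> 1" using \<beta>0 by (simp add: pos_le_divide_eq)
    then show ?thesis by simp
  qed
  have \<eta>\<theta>: "\<eta> * \<theta> \<le> 1/16"
  proof -
    have "\<theta> \<le> 1 / (16 * \<eta>)" by (simp add: \<theta>)
    then have "\<theta> * (16 * \<eta>) \<le> 1" using \<eta>0 by (simp add: pos_le_divide_eq)
    then show ?thesis by (simp add: mult_ac)
  qed
  have max: "x \<le> \<alpha>"
    if "x \<in> {1 - \<mu> * \<eta> / 4, 1 - \<beta> * \<theta> * inverse chi, 1 - p * \<eta> * \<mu> / (2 * \<gamma> + \<eta> * \<mu>)}" for x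
    unfolding \<alpha> by (rule Max_ge[OF _ that]) simp
  have \<alpha>': "1 - \<mu> * \<eta> / 4 \<le> \<alpha>" "1 - \<beta> * \<theta> / chi \<le> \<alpha>" "1 - p * \<eta> * \<mu> / (2 * p + \<eta> * \<mu>) \<le> \<alpha>"
    unfolding divide_inverse[of "\<beta> * \<theta>"] by (rule max, simp add: \<gamma>)+
  define T where "T = 1 / p + chi + 1 / sqrt (p * real b) * (Lbar / \<mu>) + sqrt chi * (L / \<mu>)"
  have "0 < chi" using chi1 by simp
  note rate = rate_bound[OF \<mu> L Lbar this p(1) b0 \<eta>[unfolded \<gamma>] \<beta>[unfolded \<gamma>] \<theta> \<alpha>[unfolded \<gamma>], folded T_def]
  interpret decentralized_vi M E W d n F g L Lbar \<mu> b p \<alpha> \<beta> \<eta> \<theta> chi zs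
    by unfold_locales (use n b ops g lip mono avg sol chi p \<mu> L \<eta>0 \<theta>0 \<beta>0 \<eta>L \<eta>\<mu> \<eta>Lbar \<beta>L \<beta>Lbar \<theta>\<beta> \<eta>\<theta> rate(1) \<alpha>' in auto)
  \<comment> \<open>Twice the initial potential: it depends on the problem, the parameters and the
    starting point, but not on \<open>k\<close> or \<epsilon>.\<close>
  define R where "R = 2 * potential (z0, z0, z0, z0, y0, y0)"
  have "valid (z0, z0, z0, z0, y0, y0)" using z0 y0 by (simp add: valid_def)
  from potential_ge[OF this] have "N (z0 - zst) \<le> R" by (simp add: R_def)
  then have R: "R \<ge> 0" using l.nonneg[of "z0 - zst"] by linarith
  show "\<exists>C0>0. \<forall>\<epsilon>>0. \<forall>k::nat.
        real k \<ge> 64 * (1 / p + chi + 1 / sqrt (p * real b) * (Lbar / \<mu>) + sqrt chi * (L / \<mu>)) * ln (C0 / \<epsilon>)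
        \<longrightarrow> expected_error d M (iterates d M n F g W \<eta> \<theta> \<alpha> \<beta> \<gamma> b p z0 y0 k) (lift M zs) \<le> \<epsilon>"
    unfolding T_def[symmetric] \<gamma>
  proof (intro exI[of _ "R + 1"] conjI allI impI)
    show "R + 1 > 0" using R by simp
    fix \<epsilon> :: real and k :: nat
    assume \<epsilon>: "\<epsilon> > 0" and k: "64 * T * ln ((R + 1) / \<epsilon>) \<le> real k"
    have "expected_error d M (iter z0 y0 k) (lift M zs) \<le> \<alpha> ^ k * R"
      using expected_error_le[OF z0 y0, of k] by (simp add: R_def)
    then show "expected_error d M (iter z0 y0 k) (lift M zs) \<le> \<epsilon>"
      by (rule geometric_decay[OF _ rate R \<epsilon> k, rotated]) (use \<alpha>_ge in simp)
  qed
qed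

end
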